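(* Let $k\ge 1$ and let $\mathcal{A}$ (a set of probability vectors of length $k$), $\mathcal{Q}$ (a set of symmetric $k\times k$ matrices), $\alpha^*\in\mathcal{A}$ and $\boldsymbol{Q}^*\in\mathcal{Q}$ be such that: (1) there exist $c>0$ and a compact interval $C_{\boldsymbol{Q}}\subset(0,1)$ such that every $\alpha\in\mathcal{A}$ has all its coordinates in $[c,1-c]$, and $\mathcal{Q}\subset C_{\boldsymbol{Q}}^{k\times k}$; (2) $\alpha^*$ and $\boldsymbol{Q}^*$ lie respectively in the interior of $\mathcal{A}$ (relative to the simplex of probability vectors of length $k$) and in the interior of $\mathcal{Q}$ (relative to the space of symmetric $k\times k$ matrices); (3) the coordinates of the vector $\alpha^*\boldsymbol{Q}^*\in\mathbb{R}^k$ are pairwise distinct. For each $n$, let $\boldsymbol{A}$ be the adjacency matrix of a stochastic block model on $n$ nodes with parameters $(\alpha^*,\boldsymbol{Q}^* )$, with random label function $z^*$ and matrix of connection probabilities $\boldsymbol{\Theta}^*$, observed through a sampling matrix $\boldsymbol{X}$ with sampling rate $p=p_n$, where $p\to 0$ and $p\,n/\log(n)\to\infty$ as $n\to\infty$. Let $\widehat{z}^{VAR}$, $\widehat{z}$ and $\widehat{\boldsymbol{\Theta}}^{VAR}$ be respectively the variational label estimator, the maximum likelihood label estimator, and the variational estimator of the matrix of connection probabilities (defined with the parameter spaces $\mathcal{A},\mathcal{Q}$). Then $$\mathbb{P}\left(\widehat{z}^{VAR}\sim\widehat{z}\right)\to 1\quad\text{as } n\to\infty.$$ Moreover, there exists a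 constant $C_{\boldsymbol{Q}^*}>0$ depending on $\boldsymbol{Q}^*$ such that $$\mathbb{P}\left(\left\Vert\boldsymbol{\Theta}^*-\widehat{\boldsymbol{\Theta}}^{VAR}\right\Vert_2^2\le\frac{C_{\boldsymbol{Q}^*}\left(k^2+n\log(k)\right)}{p}\right)\underset{n\to\infty}{\longrightarrow}1.$$
   Context: **Model.** $[n]=\{1,\dots,n\}$; $\mathcal{Z}_{n,k}$ is the set of all label functions $z:[n]\to[k]$. In the stochastic block model with parameters $(\alpha^*,\boldsymbol{Q}^* )$, where $\alpha^*$ is a probability vector on $[k]$ and $\boldsymbol{Q}^*\in[0,1]^{k\times k}$ is symmetric, the labels $z^*(1),\dots,z^*(n)$ are i.i.d. with $\mathbb{P}(z^*(i)=a)=\alpha^*_a$. Set $\boldsymbol{\Theta}^*_{ij}=\boldsymbol{Q}^*_{z^*(i)z^*(j)}$ for $i\ne j$ and $\boldsymbol{\Theta}^*_{ii}=0$. Conditionally on $z^*$, the entries $\boldsymbol{A}_{ij}$, $i<j$, are independent Bernoulli variables with parameters $\boldsymbol{\Theta}^*_{ij}$; $\boldsymbol{A}$ is symmetric with zero diagonal. **Missing observations.** $\boldsymbol{X}\in\{0,1\}^{n\times n}$ is symmetric and known, independent of $\boldsymbol{A}$ and $\boldsymbol{\Theta}^*$, with entries $\boldsymbol{X}_{ij}$, $i<j$, independent Bernoulli($p$). $\boldsymbol{A}_{ij}$ is observed if and only if $\boldsymbol{X}_{ij}=1$. $\boldsymbol{X}\odot\boldsymbol{A}$ denotes the entrywise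 product and stands for the observed entries of $\boldsymbol{A}$. **Likelihoods.** For $z\in\mathcal{Z}_{n,k}$, a symmetric $k\times k$ matrix $\boldsymbol{Q}$ and a probability vector $\alpha$, $$\mathcal{L}_{\boldsymbol{X}}(\boldsymbol{A};z,\boldsymbol{Q})=\sum_{1\le i<j\le n}\boldsymbol{X}_{ij}\left(\boldsymbol{A}_{ij}\log(\boldsymbol{Q}_{z(i)z(j)})+(1-\boldsymbol{A}_{ij})\log(1-\boldsymbol{Q}_{z(i)z(j)})\right),$$ $$l_{\boldsymbol{X}}(\boldsymbol{A};\alpha,\boldsymbol{Q})=\sum_{z\in\mathcal{Z}_{n,k}}\Big(\prod_{i\le n}\alpha_{z(i)}\Big)\exp\left(\mathcal{L}_{\boldsymbol{X}}(\boldsymbol{A};z,\boldsymbol{Q})\right).$$ The posterior distribution of the labels is $\mathbb{P}(z\mid\boldsymbol{X}\odot\boldsymbol{A},\alpha,\boldsymbol{Q})=\big(\prod_{i\le n}\alpha_{z(i)}\big)\exp(\mathcal{L}_{\boldsymbol{X}}(\boldsymbol{A};z,\boldsymbol{Q}))/l_{\boldsymbol{X}}(\boldsymbol{A};\alpha,\boldsymbol{Q})$. **Maximum likelihood estimator.** $(\widehat{\boldsymbol{Q}},\widehat{z})\in\arg\max_{\boldsymbol{Q}\in\mathcal{Q},\,z\in\mathcal{Z}_{n,k}}\mathcal{L}_{\boldsymbol{X}}(\boldsymbol{A};z,\boldsymbol{Q})$. **Variational estimator.** Let $\mathcal{T}$ be the set of $\tau=(\tau^1,\dots,\tau^n)$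 where each $\tau^i=(\tau^i_1,\dots,\tau^i_k)$ is a probability vector on $[k]$, and let $\mathbb{P}_\tau(z)=\prod_{i\le n}\tau^i_{z(i)}$ be the corresponding product distribution on $\mathcal{Z}_{n,k}$. With $KL$ the Kullback–Leibler divergence, $$\mathcal{J}_{\boldsymbol{X}}(\boldsymbol{A};\tau,\alpha,\boldsymbol{Q})=\log\left(l_{\boldsymbol{X}}(\boldsymbol{A};\alpha,\boldsymbol{Q})\right)-KL\left(\mathbb{P}_\tau(\cdot)\,\Vert\,\mathbb{P}(\cdot\mid\boldsymbol{X}\odot\boldsymbol{A},\alpha,\boldsymbol{Q})\right),$$ $$(\widehat{\alpha}^{VAR},\widehat{\boldsymbol{Q}}^{VAR},\widehat{\tau}^{VAR})\in\arg\max_{\alpha\in\mathcal{A},\,\boldsymbol{Q}\in\mathcal{Q},\,\tau\in\mathcal{T}}\mathcal{J}_{\boldsymbol{X}}(\boldsymbol{A};\tau,\alpha,\boldsymbol{Q}).$$ The variational label estimator is $\widehat{z}^{VAR}(i)\in\arg\max_{a\le k}(\widehat{\tau}^{VAR})^i_a$ for $i\le n$. For a label function $z$ write $z^{-1}(a,b)=\{(i,j):z(i)=a,\ z(j)=b,\ i\ne j\}$. For $a,b\le k$, $$\widehat{\boldsymbol{Q}}^{ML-VAR}_{ab}=\frac{\sum_{(i,j)\in(\widehat{z}^{VAR})^{-1}(a,b)}\boldsymbol{X}_{ij}\boldsymbol{A}_{ij}}{\sum_{(i,j)\in(\widehat{z}^{VAR})^{-1}(a,b)}\boldsymbol{X}_{ij}},$$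 and $\widehat{\boldsymbol{\Theta}}^{VAR}_{ij}=\widehat{\boldsymbol{Q}}^{ML-VAR}_{\widehat{z}^{VAR}(i),\widehat{z}^{VAR}(j)}$ for $i\ne j$, $\widehat{\boldsymbol{\Theta}}^{VAR}_{ii}=0$. **Notation.** For label functions $z,z'$, $z\sim z'$ means that there is a permutation $\sigma$ of $[k]$ with $z'(i)=\sigma(z(i))$ for all $i\in[n]$. $\Vert\boldsymbol{M}\Vert_2=\sqrt{\sum_{i,j}\boldsymbol{M}_{ij}^2}$ is the Frobenius norm. The parameters $k,\alpha^*,\boldsymbol{Q}^*,\mathcal{A},\mathcal{Q}$ do not depend on $n$. *)

theory Defs
  imports "HOL-Analysis.Analysis" "HOL-Probability.Probability"
begin

(* The number k of communities is CARD('k) and [k] is the type 'k itself. Probability vectors are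
   elements of real^'k, connectivity matrices elements of real^'k^'k. Since n varies, n x n matrices
   are functions nat => nat => real, only looked at on {1..n} x {1..n}. *)

type_synonym nmat = "nat \<Rightarrow> nat \<Rightarrow> real"

definition prob_simplex :: "(real^'k) set" where
  "prob_simplex = {\<alpha>. (\<forall>a. 0 \<le> \<alpha> $ a) \<and> (\<Sum>a\<in>UNIV. \<alpha> $ a) = 1}"

definition sym_mats :: "(real^'k^'k) set" where
  "sym_mats = {Q. transpose Q = Q}"

definition label_funs :: "nat \<Rightarrow> (nat \<Rightarrow> 'k) set" where
  "label_funs n = {1..n} \<rightarrow>\<^sub>E UNIV"

definition label_equiv :: "nat \<Rightarrow> (nat \<Rightarrow> 'k) \<Rightarrow> (nat \<Rightarrow> 'k) \<Rightarrow> bool" where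
  "label_equiv n z z' \<longleftrightarrow> (\<exists>\<sigma>. \<sigma> permutes UNIV \<and> (\<forall>i\<in>{1..n}. z' i = \<sigma> (z i)))"

definition upper_pairs :: "nat \<Rightarrow> (nat \<times> nat) set" where
  "upper_pairs n = {(i, j). 1 \<le> i \<and> i < j \<and> j \<le> n}"

definition frob_norm :: "nat \<Rightarrow> nmat \<Rightarrow> real" where
  "frob_norm n M = sqrt (\<Sum>i\<in>{1..n}. \<Sum>j\<in>{1..n}. (M i j)\<^sup>2)"

definition theta :: "real^'k^'k \<Rightarrow> (nat \<Rightarrow> 'k) \<Rightarrow> nmat" where
  "theta Q z i j = (if i = j then 0 else Q $ z i $ z j)"

(* Only meaningful for \<alpha> in the probability simplex. *)
definition vec_pmf :: "real^'k \<Rightarrow> ('k::finite) pmf" where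
  "vec_pmf \<alpha> = embed_pmf (\<lambda>a. \<alpha> $ a)"

definition labels_pmf :: "nat \<Rightarrow> real^'k \<Rightarrow> (nat \<Rightarrow> 'k::finite) pmf" where
  "labels_pmf n \<alpha> = Pi_pmf {1..n} undefined (\<lambda>_. vec_pmf \<alpha>)"

(* Law of a symmetric 0/1 matrix with zero diagonal whose entries (i,j), i < j, are independent
   Bernoulli (P i j). The draw B is False off upper_pairs n, so the entry (i,i) is 0. *)
definition sym_bernoulli_pmf :: "nat \<Rightarrow> nmat \<Rightarrow> nmat pmf" where
  "sym_bernoulli_pmf n P =
     map_pmf (\<lambda>B i j. of_bool (B (min i j, max i j)))
       (Pi_pmf (upper_pairs n) False (\<lambda>(i, j). bernoulli_pmf (P i j)))"

definition sbm_pmf :: "nat \<Rightarrow> real^'k \<Rightarrow> real^'k^'k \<Rightarrow> ((nat \<Rightarrow> 'k::finite) \<times> nmat) pmf" where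
  "sbm_pmf n \<alpha> Q =
     bind_pmf (labels_pmf n \<alpha>) (\<lambda>z.
       map_pmf (\<lambda>A. (z, A)) (sym_bernoulli_pmf n (theta Q z)))"

(* Joint law of the outcome ((z, A), X), with the sampling matrix X independent of (z, A). *)
definition observed_sbm_pmf ::
    "nat \<Rightarrow> real^'k \<Rightarrow> real^'k^'k \<Rightarrow> real \<Rightarrow> (((nat \<Rightarrow> 'k::finite) \<times> nmat) \<times> nmat) pmf" where
  "observed_sbm_pmf n \<alpha> Q p =
     pair_pmf (sbm_pmf n \<alpha> Q) (sym_bernoulli_pmf n (\<lambda>_ _. p))"

definition log_lik :: "nat \<Rightarrow> nmat \<Rightarrow> nmat \<Rightarrow> (nat \<Rightarrow> 'k) \<Rightarrow> real^'k^'k \<Rightarrow> real" where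
  "log_lik n X A z Q =
     (\<Sum>(i, j)\<in>upper_pairs n.
        X i j * (A i j * ln (Q $ z i $ z j) + (1 - A i j) * ln (1 - Q $ z i $ z j)))"

definition joint_lik ::
    "nat \<Rightarrow> nmat \<Rightarrow> nmat \<Rightarrow> real^'k \<Rightarrow> real^'k^'k \<Rightarrow> (nat \<Rightarrow> 'k) \<Rightarrow> real" where
  "joint_lik n X A \<alpha> Q z = (\<Prod>i\<in>{1..n}. \<alpha> $ z i) * exp (log_lik n X A z Q)"

definition lik :: "nat \<Rightarrow> nmat \<Rightarrow> nmat \<Rightarrow> real^'k \<Rightarrow> real^'k^'k \<Rightarrow> real" where
  "lik n X A \<alpha> Q = (\<Sum>z\<in>label_funs n. joint_lik n X A \<alpha> Q z)"

definition label_posterior ::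
    "nat \<Rightarrow> nmat \<Rightarrow> nmat \<Rightarrow> real^'k \<Rightarrow> real^'k^'k \<Rightarrow> (nat \<Rightarrow> 'k) \<Rightarrow> real" where
  "label_posterior n X A \<alpha> Q z = joint_lik n X A \<alpha> Q z / lik n X A \<alpha> Q"

definition var_params :: "nat \<Rightarrow> (nat \<Rightarrow> real^'k) set" where
  "var_params n = {\<tau>. \<forall>i\<in>{1..n}. \<tau> i \<in> prob_simplex}"

definition prod_distr :: "nat \<Rightarrow> (nat \<Rightarrow> real^'k) \<Rightarrow> (nat \<Rightarrow> 'k) \<Rightarrow> real" where
  "prod_distr n \<tau> z = (\<Prod>i\<in>{1..n}. \<tau> i $ z i)"

(* The arguments of KL_divergence are in reverse order: KL_divergence b M N is KL(N || M).
   It is used with a strictly positive f only, where KL(g || f) is finite. *)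
definition KL_labels :: "nat \<Rightarrow> ((nat \<Rightarrow> 'k) \<Rightarrow> real) \<Rightarrow> ((nat \<Rightarrow> 'k) \<Rightarrow> real) \<Rightarrow> real" where
  "KL_labels n g f =
     KL_divergence (exp 1)
       (point_measure (label_funs n) (\<lambda>z. ennreal (f z)))
       (point_measure (label_funs n) (\<lambda>z. ennreal (g z)))"

lemma KL_labels_eq_sum:
  fixes f g :: "(nat \<Rightarrow> 'k::finite) \<Rightarrow> real"
  assumes "\<And>z. z \<in> label_funs n \<Longrightarrow> 0 < f z" and "\<And>z. z \<in> label_funs n \<Longrightarrow> 0 \<le> g z"
  shows "KL_labels n g f = (\<Sum>z\<in>label_funs n. g z * ln (g z / f z))"
proof -
  let ?Z = "label_funs n :: (nat \<Rightarrow> 'k) set"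
  have fin: "finite ?Z"
    by (simp add: label_funs_def finite_PiE)
  interpret sigma_finite_measure "count_space ?Z"
    by (rule sigma_finite_measure_count_space_finite[OF fin])
  have "KL_labels n g f = (\<integral>z. g z * log (exp 1) (g z / f z) \<partial>count_space ?Z)"
    unfolding KL_labels_def point_measure_def
    by (rule KL_density_density) (use assms in \<open>auto simp: AE_count_space less_le\<close>)
  also have "\<dots> = (\<Sum>z\<in>?Z. g z * ln (g z / f z))"
    using fin by (simp add: lebesgue_integral_count_space_finite log_def)
  finally show ?thesis .
qed

definition var_objective ::
    "nat \<Rightarrow> nmat \<Rightarrow> nmat \<Rightarrow> (nat \<Rightarrow> real^'k) \<Rightarrow> real^'k \<Rightarrow> real^'k^'k \<Rightarrow> real" where
  "var_objective n X A \<tau> \<alpha> Q =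
     ln (lik n X A \<alpha> Q) - KL_labels n (prod_distr n \<tau>) (label_posterior n X A \<alpha> Q)"

definition is_mle ::
    "(real^'k^'k) set \<Rightarrow> nat \<Rightarrow> nmat \<Rightarrow> nmat \<Rightarrow> real^'k^'k \<Rightarrow> (nat \<Rightarrow> 'k) \<Rightarrow> bool" where
  "is_mle \<Q> n X A Q z \<longleftrightarrow>
     is_arg_max (\<lambda>(Q, z). log_lik n X A z Q) (\<lambda>(Q, z). Q \<in> \<Q> \<and> z \<in> label_funs n) (Q, z)"

definition is_variational_est ::
    "(real^'k) set \<Rightarrow> (real^'k^'k) set \<Rightarrow> nat \<Rightarrow> nmat \<Rightarrow> nmat \<Rightarrow>
       real^'k \<Rightarrow> real^'k^'k \<Rightarrow> (nat \<Rightarrow> real^'k) \<Rightarrow> bool" where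
  "is_variational_est \<A> \<Q> n X A \<alpha> Q \<tau> \<longleftrightarrow>
     is_arg_max (\<lambda>(\<alpha>, Q, \<tau>). var_objective n X A \<tau> \<alpha> Q)
       (\<lambda>(\<alpha>, Q, \<tau>). \<alpha> \<in> \<A> \<and> Q \<in> \<Q> \<and> \<tau> \<in> var_params n) (\<alpha>, Q, \<tau>)"

definition is_var_labels :: "nat \<Rightarrow> (nat \<Rightarrow> real^'k) \<Rightarrow> (nat \<Rightarrow> 'k) \<Rightarrow> bool" where
  "is_var_labels n \<tau> z \<longleftrightarrow> (\<forall>i\<in>{1..n}. is_arg_max (\<lambda>a. \<tau> i $ a) (\<lambda>_. True) (z i))"

definition label_block :: "nat \<Rightarrow> (nat \<Rightarrow> 'k) \<Rightarrow> 'k \<Rightarrow> 'k \<Rightarrow> (nat \<times> nat) set" where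
  "label_block n z a b = {(i, j) \<in> {1..n} \<times> {1..n}. z i = a \<and> z j = b \<and> i \<noteq> j}"

(* An entry without any observation in its block is 0 by the convention x / 0 = 0. *)
definition Q_ml_var :: "nat \<Rightarrow> nmat \<Rightarrow> nmat \<Rightarrow> (nat \<Rightarrow> 'k) \<Rightarrow> real^'k^('k::finite)" where
  "Q_ml_var n X A z =
     (\<chi> a b. (\<Sum>(i, j)\<in>label_block n z a b. X i j * A i j) /
             (\<Sum>(i, j)\<in>label_block n z a b. X i j))"

definition theta_var :: "nat \<Rightarrow> nmat \<Rightarrow> nmat \<Rightarrow> (nat \<Rightarrow> 'k::finite) \<Rightarrow> nmat" where
  "theta_var n X A z = theta (Q_ml_var n X A z) z"

end

theory Submission
  imports Defs
begin

text \<open>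
  Both estimators recover the true partition exactly, with probability tending to one; everything else
  follows from this. Equality of the two estimated partitions is then immediate. Given exact recovery,
  \<open>Q_ml_var\<close> consists of empirical frequencies over the true blocks, whose total squared error is of order
  \<open>k\<^sup>2 / p\<close>. This is of smaller order than \<open>n * ln k / p\<close>, so the constant \<open>C = 1\<close> works. The bound on the
  coordinates of \<open>\<alpha>s\<close> forces \<open>k \<ge> 2\<close>, so \<open>ln k\<close> is positive.

  Exact recovery is an argument about a single relaxation. A maximiser of the likelihood is the point mass
  at its labels, and the variational objective is the mean log-likelihood under a product distribution
  \<open>\<tau>\<close> minus a Kullback-Leibler distance to the prior. So in both cases there is a product
  distribution on labels whose mean log-likelihood is nearly as large as the log-likelihood of the truth
  (up to \<open>O(n)\<close> in the variational case, against a signal of order \<open>p * n\<^sup>2\<close>).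

  The randomness enters through one event, \<open>low_noise\<close>: for all relabellings \<open>\<rho>\<close> of the true labels and all
  labellings \<open>z\<close>, the noise in the difference of the block sums of \<open>\<rho> \<circ> zs\<close> and \<open>z\<close> is at most \<open>\<epsilon> * p * n\<close>
  times their Hamming distance \<open>s\<close>. Only \<open>n * s\<close> pairs contribute to that difference, so a Chernoff bound
  gives failure probability \<open>exp (- \<kappa> * p * n * s)\<close>, which beats the \<open>(n * k)\<^sup>s\<close> labellings at distance \<open>s\<close> exactly
  because \<open>p * n\<close> dominates \<open>ln n\<close>. Summed over all labellings, the union bound is the explicit number
  \<open>(1 + k * exp (- \<kappa> * p * n)) ^ n - 1\<close> (\<open>low_noise_prob\<close>).

  On this event two deterministic steps remain. A mean log-likelihood close to that of the truth bounds the
  averaged squared error of the connection probabilities (\<open>mass_fit\<close>). Since the rows of \<open>Qs\<close> are distinct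
  (this is what the hypothesis on \<open>\<alpha>s v* Qs\<close> is used for), the soft confusion matrix of \<open>\<tau>\<close> is then close to a permutation
  \<open>\<sigma>\<close>, and the fitted matrix is close to \<open>Qs\<close> up to \<open>\<sigma>\<close> (\<open>soft_confusion_is_permutation\<close>). Near such a
  \<open>\<sigma>\<close>, moving to the labels \<open>\<sigma> \<circ> zs\<close> while keeping the fitted matrix gains at least a constant
  times \<open>p * n\<close> per unit of misplaced mass (\<open>relabelling_gain\<close>). A maximum likelihood estimator admits no gain,
  so it misplaces nothing. A variational estimator may trade the gain against entropy, but Gibbs' inequality
  bounds the trade by the same kind of product \<open>(1 + exp (- \<kappa> * p * n) / c) ^ n - 1\<close>, so the misplaced mass is
  below \<open>1 / 2\<close> and every maximal coordinate of \<open>\<tau> i\<close> is the right one.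
\<close>

section \<open>Product distributions on labellings\<close>

text \<open>
  The relaxation common to both estimators: a labelling is replaced by independent labels with laws
  \<open>\<tau> i\<close>. Means are finite sums, so that the densities of \<open>var_objective\<close> appear in them literally.
\<close>

definition product_mean :: "nat \<Rightarrow> (nat \<Rightarrow> real^'k::finite) \<Rightarrow> ((nat \<Rightarrow> 'k) \<Rightarrow> real) \<Rightarrow> real" where
  "product_mean n \<tau> f = (\<Sum>z\<in>label_funs n. prod_distr n \<tau> z * f z)"

lemma finite_label_funs: "finite (label_funs n :: (nat \<Rightarrow> 'k::finite) set)"
  by (simp add: label_funs_def finite_PiE)

text \<open>
  Sums of products over all labellings factorise. The marginals of a product distribution, the union bound
  over labellings and the normalising constant in Gibbs' inequality are all instances.
\<close>

lemma sum_label_funs_prod: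
  fixes g :: "nat \<Rightarrow> 'k::finite \<Rightarrow> 'a::comm_semiring_1"
  shows "(\<Sum>z\<in>label_funs n. \<Prod>i\<in>{1..n}. g i (z i)) = (\<Prod>i\<in>{1..n}. \<Sum>a\<in>UNIV. g i a)"
  unfolding label_funs_def by (rule prod_sum_PiE[symmetric]) auto

lemma var_params_nonneg: "\<tau> \<in> var_params n \<Longrightarrow> i \<in> {1..n} \<Longrightarrow> 0 \<le> \<tau> i $ a"
  and var_params_sum: "\<tau> \<in> var_params n \<Longrightarrow> i \<in> {1..n} \<Longrightarrow> (\<Sum>a\<in>UNIV. \<tau> i $ a) = 1"
  by (auto simp: var_params_def prob_simplex_def)

lemma var_params_le_1:
  assumes "\<tau> \<in> var_params n" "i \<in> {1..n}"
  shows "\<tau> i $ a \<le> 1"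
  using member_le_sum[of a UNIV "\<lambda>a. \<tau> i $ a"] assms
  by (simp add: var_params_sum var_params_nonneg)

lemma prod_distr_nonneg: "\<tau> \<in> var_params n \<Longrightarrow> 0 \<le> prod_distr n \<tau> z"
  by (auto simp: prod_distr_def intro!: prod_nonneg var_params_nonneg)

lemma prod_distr_sum: "\<tau> \<in> var_params n \<Longrightarrow> (\<Sum>z\<in>label_funs n. prod_distr n \<tau> z) = 1"
  unfolding prod_distr_def by (subst sum_label_funs_prod) (simp add: var_params_sum)

lemma product_mean_const: "\<tau> \<in> var_params n \<Longrightarrow> product_mean n \<tau> (\<lambda>_. c) = c"
  by (simp add: product_mean_def prod_distr_sum flip: sum_distrib_right)

lemma product_mean_mono:
  "\<tau> \<in> var_params n \<Longrightarrow> (\<And>z. z \<in> label_funs n \<Longrightarrow> f z \<le> g z) \<Longrightarrow> product_mean n \<tau> f \<le> product_mean n \<tau> g"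
  by (auto simp: product_mean_def intro!: sum_mono mult_left_mono prod_distr_nonneg)

lemma product_mean_add: "product_mean n \<tau> (\<lambda>z. f z + g z) = product_mean n \<tau> f + product_mean n \<tau> g"
  and product_mean_diff: "product_mean n \<tau> (\<lambda>z. f z - g z) = product_mean n \<tau> f - product_mean n \<tau> g"
  and product_mean_cmult: "product_mean n \<tau> (\<lambda>z. c * f z) = c * product_mean n \<tau> f"
  and product_mean_sum: "product_mean n \<tau> (\<lambda>z. \<Sum>i\<in>I. h i z) = (\<Sum>i\<in>I. product_mean n \<tau> (h i))"
  by (simp_all add: product_mean_def algebra_simps sum.distrib sum_subtractf sum_distrib_left sum.swap[of _ I])

lemma product_mean_single:
  assumes \<tau>: "\<tau> \<in> var_params n" and i: "i \<in> {1..n}"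
  shows "product_mean n \<tau> (\<lambda>z. f (z i)) = (\<Sum>a\<in>UNIV. \<tau> i $ a * f a)"
proof -
  have "product_mean n \<tau> (\<lambda>z. f (z i)) = (\<Sum>z\<in>label_funs n. \<Prod>l\<in>{1..n}. \<tau> l $ z l * (if l = i then f (z l) else 1))"
    unfolding product_mean_def prod_distr_def prod.distrib using i by (simp add: prod.delta)
  also have "\<dots> = (\<Prod>l\<in>{1..n}. \<Sum>a\<in>UNIV. \<tau> l $ a * (if l = i then f a else 1))"
    by (rule sum_label_funs_prod[where g = "\<lambda>l a. \<tau> l $ a * (if l = i then f a else 1)"])
  also have "\<dots> = (\<Prod>l\<in>{1..n}. if l = i then \<Sum>a\<in>UNIV. \<tau> l $ a * f a else 1)"
    by (intro prod.cong) (auto simp: var_params_sum[OF \<tau>])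
  also have "\<dots> = (\<Sum>a\<in>UNIV. \<tau> i $ a * f a)" using i by (simp add: prod.delta)
  finally show ?thesis .
qed

lemma product_mean_pair_prod:
  assumes \<tau>: "\<tau> \<in> var_params n" and i: "i \<in> {1..n}" and j: "j \<in> {1..n}" and ij: "i \<noteq> j"
  shows "product_mean n \<tau> (\<lambda>z. f (z i) * h (z j)) = (\<Sum>a\<in>UNIV. \<tau> i $ a * f a) * (\<Sum>a\<in>UNIV. \<tau> j $ a * h a)"
proof -
  have "product_mean n \<tau> (\<lambda>z. f (z i) * h (z j))
      = (\<Sum>z\<in>label_funs n. \<Prod>l\<in>{1..n}. \<tau> l $ z l * ((if l = i then f (z l) else 1) * (if l = j then h (z l) else 1)))"
    unfolding product_mean_def prod_distr_def prod.distrib using i j by (simp add: prod.delta)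
  also have "\<dots> = (\<Prod>l\<in>{1..n}. \<Sum>a\<in>UNIV. \<tau> l $ a * ((if l = i then f a else 1) * (if l = j then h a else 1)))"
    by (rule sum_label_funs_prod[where g = "\<lambda>l a. \<tau> l $ a * ((if l = i then f a else 1) * (if l = j then h a else 1))"])
  also have "\<dots> = (\<Prod>l\<in>{1..n}. (if l = i then \<Sum>a\<in>UNIV. \<tau> l $ a * f a else 1) * (if l = j then \<Sum>a\<in>UNIV. \<tau> l $ a * h a else 1))"
    using ij by (intro prod.cong) (auto simp: var_params_sum[OF \<tau>])
  also have "\<dots> = (\<Sum>a\<in>UNIV. \<tau> i $ a * f a) * (\<Sum>a\<in>UNIV. \<tau> j $ a * h a)"
    unfolding prod.distrib using i j by (simp add: prod.delta)
  finally show ?thesis .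
qed

lemma product_mean_pair:
  fixes \<tau> :: "nat \<Rightarrow> real^'k::finite"
  assumes \<tau>: "\<tau> \<in> var_params n" and i: "i \<in> {1..n}" and j: "j \<in> {1..n}" and ij: "i \<noteq> j"
  shows "product_mean n \<tau> (\<lambda>z. F (z i) (z j)) = (\<Sum>a\<in>UNIV. \<Sum>b\<in>UNIV. \<tau> i $ a * \<tau> j $ b * F a b)"
proof -
  have F: "F x y = (\<Sum>a\<in>UNIV. \<Sum>b\<in>UNIV. F a b * (of_bool (x = a) * of_bool (y = b)))" for x y :: 'k
    by (simp add: sum.delta of_bool_def if_distrib[of "\<lambda>t. _ * t"] cong: if_cong)
  have "product_mean n \<tau> (\<lambda>z. F (z i) (z j)) = product_mean n \<tau> (\<lambda>z. \<Sum>a\<in>UNIV. \<Sum>b\<in>UNIV. F a b * (of_bool (z i = a) * of_bool (z j = b)))"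
    by (subst F) simp
  also have "\<dots> = (\<Sum>a\<in>UNIV. \<Sum>b\<in>UNIV. F a b * (\<tau> i $ a * \<tau> j $ b))"
    unfolding product_mean_sum product_mean_cmult product_mean_pair_prod[OF assms, where f = "\<lambda>x. of_bool (x = _)" and h = "\<lambda>x. of_bool (x = _)"]
    by (simp add: of_bool_def if_distrib[of "\<lambda>t. _ * t"] sum.delta cong: if_cong)
  finally show ?thesis by (simp add: mult_ac)
qed

text \<open>
  Point masses are product distributions; this is how an estimated labelling becomes a case of the relaxation.
\<close>

lemma product_mean_axis:
  fixes z :: "nat \<Rightarrow> 'k::finite"
  assumes z: "z \<in> label_funs n"
  shows "product_mean n (\<lambda>i. axis (z i) 1) f = f z"
proof -
  have *: "prod_distr n (\<lambda>i. axis (z i) 1) z' = of_bool (z' = z)" if z': "z' \<in> label_funs n" for z'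
  proof (cases "z' = z")
    case True
    then show ?thesis by (simp add: prod_distr_def axis_def)
  next
    case False
    with z z' obtain i where i: "i \<in> {1..n}" "z' i \<noteq> z i"
      unfolding label_funs_def by (metis PiE_ext)
    have "prod_distr n (\<lambda>i. axis (z i) (1::real)) z' = 0"
      unfolding prod_distr_def using i by (intro prod_zero) (auto simp: axis_def intro!: bexI[of _ i])
    with False show ?thesis by simp
  qed
  show ?thesis unfolding product_mean_def
    using z * by (simp add: finite_label_funs of_bool_def if_distrib[of "\<lambda>t. t * _"] sum.delta cong: if_cong sum.cong)
qed

lemma axis_var_params: "(\<lambda>i. axis (z i) 1) \<in> (var_params n :: (nat \<Rightarrow> real^'k::finite) set)"
  by (auto simp: var_params_def prob_simplex_def axis_def)

section \<open>The log-likelihood: mean and noise\<close>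

text \<open>
  The mean log-likelihood per observed edge when edges occur with probability \<open>\<theta>\<close> and are fitted with
  \<open>q\<close>. The gap \<open>bern_loglik \<theta> \<theta> - bern_loglik \<theta> q\<close> is the Kullback-Leibler divergence of two Bernoulli laws; the next
  two lemmas compare it with \<open>(\<theta> - q)\<^sup>2\<close> from both sides.
\<close>

definition bern_loglik :: "real \<Rightarrow> real \<Rightarrow> real" where
  "bern_loglik \<theta> q = \<theta> * ln q + (1 - \<theta>) * ln (1 - q)"

text \<open>
  The chi-square bound: apply \<open>ln x \<le> x - 1\<close> to both likelihood ratios.
\<close>

lemma bern_loglik_gap_upper:
  assumes "\<theta> \<in> {0<..<1}" "q \<in> {0<..<1}"
  shows "bern_loglik \<theta> \<theta> - bern_loglik \<theta> q \<le> (\<theta> - q)\<^sup>2 / (q * (1 - q))"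
proof -
  have "bern_loglik \<theta> \<theta> - bern_loglik \<theta> q = \<theta> * ln (\<theta> / q) + (1 - \<theta>) * ln ((1 - \<theta>) / (1 - q))"
    using assms by (simp add: bern_loglik_def ln_div algebra_simps)
  also have "\<dots> \<le> \<theta> * (\<theta> / q - 1) + (1 - \<theta>) * ((1 - \<theta>) / (1 - q) - 1)"
    using assms by (intro add_mono mult_left_mono ln_le_minus_one) auto
  also have "\<dots> = (\<theta> - q)\<^sup>2 / (q * (1 - q))"
    using assms by (simp add: field_simps power2_eq_square)
  finally show ?thesis .
qed

text \<open>
  A weak form of Pinsker's inequality, through the Hellinger distance: \<open>ln x \<le> x - 1\<close> applied to the square roots of
  the likelihood ratios bounds the divergence below by squared differences of square roots.
\<close>

lemma bern_loglik_gap_lower: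
  assumes "\<theta> \<in> {0<..<1}" "q \<in> {0<..<1}"
  shows "(\<theta> - q)\<^sup>2 / 2 \<le> bern_loglik \<theta> \<theta> - bern_loglik \<theta> q"
proof -
  have hellinger: "2 * x - 2 * sqrt (x * y) \<le> x * ln x - x * ln y" if "0 < x" "0 < y" for x y :: real
  proof -
    have "ln (y / x) = 2 * ln (sqrt (y / x))" using that by (simp add: ln_sqrt)
    also have "\<dots> \<le> 2 * (sqrt (y / x) - 1)" using that by (intro mult_left_mono ln_le_minus_one) auto
    finally have "x * ln (y / x) \<le> x * (2 * (sqrt (y / x) - 1))" using that by (intro mult_left_mono) auto
    also have "x * sqrt (y / x) = sqrt (x * y)"
      using that by (simp add: real_sqrt_divide real_sqrt_mult field_simps)
    then have "x * (2 * (sqrt (y / x) - 1)) = 2 * sqrt (x * y) - 2 * x" by (simp add: algebra_simps)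
    finally show ?thesis using that by (simp add: ln_div algebra_simps)
  qed
  have sq: "(x - y)\<^sup>2 \<le> 4 * (x + y - 2 * sqrt (x * y))" if "x \<in> {0<..<1}" "y \<in> {0<..<1}" for x y :: real
  proof -
    have "(x - y)\<^sup>2 = (sqrt x + sqrt y)\<^sup>2 * (sqrt x - sqrt y)\<^sup>2"
      using that by (simp add: power_mult_distrib[symmetric] algebra_simps)
    also have "\<dots> \<le> (1 + 1)\<^sup>2 * (sqrt x - sqrt y)\<^sup>2"
      using that by (intro mult_right_mono power_mono add_mono) auto
    also have "(sqrt x - sqrt y)\<^sup>2 = x + y - 2 * sqrt (x * y)"
      using that by (simp add: power2_diff real_sqrt_mult)
    finally show ?thesis by simp
  qed
  have "(\<theta> - q)\<^sup>2 / 2 \<le> (\<theta> + q - 2 * sqrt (\<theta> * q)) + ((1 - \<theta>) + (1 - q) - 2 * sqrt ((1 - \<theta>) * (1 - q)))"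
  proof -
    have "((1 - \<theta>) - (1 - q))\<^sup>2 = (\<theta> - q)\<^sup>2" by (simp add: power2_commute)
    then show ?thesis using sq[of \<theta> q] sq[of "1 - \<theta>" "1 - q"] assms by simp
  qed
  also have "\<dots> \<le> bern_loglik \<theta> \<theta> - bern_loglik \<theta> q"
    using hellinger[of \<theta> q] hellinger[of "1 - \<theta>" "1 - q"] assms by (simp add: bern_loglik_def)
  finally show ?thesis .
qed

text \<open>
  Observed edges (\<open>r = True\<close>) and observed non-edges (\<open>r = False\<close>) are treated alike: both are indicators of
  probability at most \<open>p\<close>, and the log-likelihood is linear in them.
\<close>

definition edge_obs :: "nmat \<Rightarrow> nmat \<Rightarrow> bool \<Rightarrow> nat \<times> nat \<Rightarrow> real" where
  "edge_obs X A r = (\<lambda>(i, j). X i j * (if r then A i j else 1 - A i j))"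

definition edge_mean :: "real \<Rightarrow> real^'k^'k \<Rightarrow> (nat \<Rightarrow> 'k) \<Rightarrow> bool \<Rightarrow> nat \<times> nat \<Rightarrow> real" where
  "edge_mean p Q z r = (\<lambda>(i, j). p * (if r then Q $ z i $ z j else 1 - Q $ z i $ z j))"

definition edge_noise :: "real \<Rightarrow> real^'k^'k \<Rightarrow> (nat \<Rightarrow> 'k) \<Rightarrow> nmat \<Rightarrow> nmat \<Rightarrow> bool \<Rightarrow> nat \<times> nat \<Rightarrow> real" where
  "edge_noise p Q z X A r e = edge_obs X A r e - edge_mean p Q z r e"

definition block_ind :: "(nat \<Rightarrow> 'k) \<Rightarrow> 'k \<Rightarrow> 'k \<Rightarrow> nat \<times> nat \<Rightarrow> real" where
  "block_ind z a b = (\<lambda>(i, j). of_bool (z i = a \<and> z j = b))"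

definition hamming :: "nat \<Rightarrow> (nat \<Rightarrow> 'k) \<Rightarrow> (nat \<Rightarrow> 'k) \<Rightarrow> nat" where
  "hamming n z z' = card {i \<in> {1..n}. z i \<noteq> z' i}"

text \<open>
  The event on which everything is deterministic. The bound must shrink with the Hamming distance to a relabelling
  of the truth: near the truth the likelihood gain is itself only proportional to that distance.
  The maps \<open>\<rho>\<close> are arbitrary and not only permutations; constant maps turn the difference into a single block sum
  (\<open>low_noise_single\<close>).
\<close>

definition low_noise :: "nat \<Rightarrow> real \<Rightarrow> (nat \<Rightarrow> 'k) \<Rightarrow> (bool \<Rightarrow> nat \<times> nat \<Rightarrow> real) \<Rightarrow> bool" where
  "low_noise n M zs N \<longleftrightarrow> (\<forall>(\<rho> :: 'k \<Rightarrow> 'k) a b r. \<forall>z\<in>label_funs n.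
     \<bar>\<Sum>e\<in>upper_pairs n. (block_ind (\<rho> \<circ> zs) a b e - block_ind z a b e) * N r e\<bar> \<le> M * real (hamming n (\<rho> \<circ> zs) z))"

definition log_term :: "bool \<Rightarrow> real \<Rightarrow> real" where
  "log_term r q = (if r then ln q else ln (1 - q))"

definition weighted_edges :: "nat \<Rightarrow> (bool \<Rightarrow> nat \<times> nat \<Rightarrow> real) \<Rightarrow> (nat \<Rightarrow> 'k) \<Rightarrow> real^'k^'k \<Rightarrow> real" where
  "weighted_edges n N z Q = (\<Sum>e\<in>upper_pairs n. \<Sum>r\<in>UNIV. N r e * log_term r (Q $ z (fst e) $ z (snd e)))"

lemma finite_upper_pairs: "finite (upper_pairs n)"
  by (rule finite_subset[of _ "{1..n} \<times> {1..n}"]) (auto simp: upper_pairs_def)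

text \<open>
  The log-likelihood is its mean under the true labels plus a linear form in the centred edge variables.
\<close>

lemma log_lik_decomp:
  fixes z zs :: "nat \<Rightarrow> 'k::finite"
  shows "log_lik n X A z Q =
    p * (\<Sum>(i, j)\<in>upper_pairs n. bern_loglik (Qs $ zs i $ zs j) (Q $ z i $ z j))
    + weighted_edges n (edge_noise p Qs zs X A) z Q"
  unfolding log_lik_def weighted_edges_def sum_distrib_left sum.distrib[symmetric]
  by (intro sum.cong) (auto simp: UNIV_bool edge_noise_def edge_obs_def edge_mean_def log_term_def bern_loglik_def algebra_simps)

text \<open>
  Linearity in the \<open>2 * k\<^sup>2\<close> block sums makes bounds on the noise uniform in the matrix \<open>Q\<close>: only the labelling
  needs a union bound.
\<close>

lemma weighted_edges_blocks:
  fixes z :: "nat \<Rightarrow> 'k::finite"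
  shows "weighted_edges n N z Q =
    (\<Sum>r\<in>UNIV. \<Sum>a\<in>UNIV. \<Sum>b\<in>UNIV. log_term r (Q $ a $ b) * (\<Sum>e\<in>upper_pairs n. block_ind z a b e * N r e))"
proof -
  have "N r e * log_term r (Q $ z (fst e) $ z (snd e))
     = (\<Sum>a\<in>UNIV. \<Sum>b\<in>UNIV. log_term r (Q $ a $ b) * (block_ind z a b e * N r e))" for r e
  proof -
    have "(\<Sum>a\<in>UNIV. \<Sum>b\<in>UNIV. log_term r (Q $ a $ b) * (block_ind z a b e * N r e))
       = (\<Sum>a\<in>UNIV. \<Sum>b\<in>UNIV. if b = z (snd e) then if a = z (fst e) then log_term r (Q $ a $ b) * N r e else 0 else 0)"
      by (intro sum.cong) (auto simp: block_ind_def split: prod.splits)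
    then show ?thesis by (simp add: sum.delta)
  qed
  then show ?thesis
    unfolding weighted_edges_def sum_distrib_left
    by (simp add: sum.swap[of _ _ "upper_pairs n"])
qed

lemma log_term_bound:
  assumes "q \<in> {l..u}" "0 < l" "u < 1"
  shows "\<bar>log_term r q\<bar> \<le> - ln l - ln (1 - u)"
proof -
  have "ln l \<le> ln q" "ln q \<le> 0" "ln (1 - u) \<le> ln (1 - q)" "ln (1 - q) \<le> 0" "ln l \<le> 0" "ln (1 - u) \<le> 0"
    using assms by auto
  then show ?thesis by (auto simp: log_term_def)
qed

lemma weighted_edges_diff_bound:
  fixes zs z z' :: "nat \<Rightarrow> 'k::finite"
  assumes B: "\<And>r a b. \<bar>log_term r (Q $ a $ b)\<bar> \<le> B"
    and D: "\<And>r a b. \<bar>\<Sum>e\<in>upper_pairs n. (block_ind z a b e - block_ind z' a b e) * N r e\<bar> \<le> D"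
  shows "\<bar>weighted_edges n N z Q - weighted_edges n N z' Q\<bar> \<le> 2 * real CARD('k)^2 * B * D"
proof -
  have "0 \<le> B" using B order_trans[OF abs_ge_zero] by blast
  have "weighted_edges n N z Q - weighted_edges n N z' Q =
    (\<Sum>r\<in>UNIV. \<Sum>a\<in>UNIV. \<Sum>b\<in>UNIV. log_term r (Q $ a $ b) * (\<Sum>e\<in>upper_pairs n. (block_ind z a b e - block_ind z' a b e) * N r e))"
    by (simp add: weighted_edges_blocks sum_subtractf left_diff_distrib right_diff_distrib)
  also have "\<bar>\<dots>\<bar> \<le> (\<Sum>r\<in>(UNIV::bool set). \<Sum>a\<in>(UNIV::'k set). \<Sum>b\<in>(UNIV::'k set). B * D)"
    using \<open>0 \<le> B\<close> by (intro order_trans[OF sum_abs] sum_mono) (auto simp: abs_mult intro!: mult_mono B D)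
  also have "\<dots> = 2 * real CARD('k)^2 * B * D" by (simp add: power2_eq_square)
  finally show ?thesis .
qed

lemma hamming_le: "hamming n z z' \<le> n"
proof -
  have "card {i \<in> {1..n}. z i \<noteq> z' i} \<le> card {1..n}" by (rule card_mono) auto
  then show ?thesis by (simp add: hamming_def)
qed

text \<open>
  If \<open>c \<noteq> a\<close>, the block \<open>(a, b)\<close> of the constant labelling \<open>c\<close> is empty, so the block sum of \<open>z\<close> alone is a difference of
  the kind controlled by \<open>low_noise\<close>. This is where at least two communities are needed.
\<close>

lemma low_noise_single:
  fixes zs z :: "nat \<Rightarrow> 'k::finite"
  assumes N: "low_noise n M zs N" and z: "z \<in> label_funs n" and M: "0 \<le> M" and k: "2 \<le> CARD('k)"
  shows "\<bar>\<Sum>e\<in>upper_pairs n. block_ind z a b e * N r e\<bar> \<le> M * real n"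
proof -
  obtain c where c: "c \<noteq> a"
    using k card_2_iff' by (metis (full_types) UNIV_I card_le_Suc0_iff_eq finite numeral_2_eq_2 not_less_eq_eq)
  have "\<bar>\<Sum>e\<in>upper_pairs n. block_ind z a b e * N r e\<bar>
      = \<bar>\<Sum>e\<in>upper_pairs n. (block_ind ((\<lambda>_. c) \<circ> zs) a b e - block_ind z a b e) * N r e\<bar>"
    using c by (simp add: block_ind_def case_prod_unfold sum_negf)
  also have "\<dots> \<le> M * real (hamming n ((\<lambda>_. c) \<circ> zs) z)" using N z unfolding low_noise_def by blast
  also have "\<dots> \<le> M * real n" using M by (intro mult_left_mono) (auto simp: hamming_le)
  finally show ?thesis .
qed

lemma weighted_edges_bound:
  fixes zs z :: "nat \<Rightarrow> 'k::finite"
  assumes N: "low_noise n M zs N" and z: "z \<in> label_funs n" and M: "0 \<le> M" and k: "2 \<le> CARD('k)"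
    and B: "\<And>r a b. \<bar>log_term r (Q $ a $ b)\<bar> \<le> B"
  shows "\<bar>weighted_edges n N z Q\<bar> \<le> 2 * real CARD('k)^2 * B * (M * real n)"
proof -
  have "0 \<le> B" using B order_trans[OF abs_ge_zero] by blast
  have "\<bar>weighted_edges n N z Q\<bar> \<le> (\<Sum>r\<in>(UNIV::bool set). \<Sum>a\<in>(UNIV::'k set). \<Sum>b\<in>(UNIV::'k set). B * (M * real n))"
    unfolding weighted_edges_blocks
    using \<open>0 \<le> B\<close> by (intro order_trans[OF sum_abs] sum_mono) (auto simp: abs_mult intro!: mult_mono B low_noise_single[OF N z M k])
  also have "\<dots> = 2 * real CARD('k)^2 * B * (M * real n)" by (simp add: power2_eq_square)
  finally show ?thesis .
qed

section \<open>Soft confusion matrices\<close>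

text \<open>
  Think of \<open>R a c\<close> as the mass of true class \<open>a\<close> placed on the estimated class \<open>c\<close>. Each \<open>a\<close> has some
  heavy column \<open>\<sigma> a\<close>. Two classes \<open>a \<noteq> b\<close> cannot both put mass on one column \<open>c\<close>: some class \<open>d\<close> connects to them
  with different probabilities, and both would have to be close to the single number \<open>Q $ c $ \<sigma> d\<close>. Hence \<open>\<sigma>\<close> is
  injective, and all other entries are light.
\<close>

lemma soft_confusion_is_permutation:
  fixes \<gamma> \<Delta> \<delta> e :: real and R :: "'k::finite \<Rightarrow> 'k \<Rightarrow> real" and Qs Q :: "real^'k^'k"
  assumes row: "\<And>a. \<gamma> \<le> (\<Sum>c\<in>UNIV. R a c)"
    and sep: "\<And>a b. a \<noteq> b \<Longrightarrow> \<exists>d. \<Delta> \<le> \<bar>Qs $ a $ d - Qs $ b $ d\<bar>"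
    and fit: "\<And>a b c d. R a c * R b d * (Qs $ a $ b - Q $ c $ d)\<^sup>2 \<le> e"
    and \<gamma>: "0 < \<gamma>" and \<Delta>: "0 < \<Delta>" and \<delta>: "0 < \<delta>" "\<delta> * CARD('k) < \<gamma>"
    and e: "4 * e * CARD('k) < \<Delta>\<^sup>2 * \<delta> * \<gamma>"
  obtains \<sigma> :: "'k \<Rightarrow> 'k" where "bij \<sigma>" "\<And>a c. c \<noteq> \<sigma> a \<Longrightarrow> R a c \<le> \<delta>"
    "\<And>a b. (Qs $ a $ b - Q $ \<sigma> a $ \<sigma> b)\<^sup>2 \<le> e * real CARD('k)^2 / \<gamma>\<^sup>2"
proof -
  let ?k = "real CARD('k)"
  have k: "0 < ?k" by simp
  have "\<exists>c. \<gamma> / ?k \<le> R a c" for a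
  proof (rule ccontr)
    assume "\<not> ?thesis"
    then have "(\<Sum>c\<in>UNIV. R a c) < (\<Sum>c\<in>(UNIV::'k set). \<gamma> / ?k)"
      by (intro sum_strict_mono) (auto simp: not_le)
    with row[of a] show False by simp
  qed
  then obtain \<sigma> where \<sigma>: "\<And>a. \<gamma> / ?k \<le> R a (\<sigma> a)" by metis
  have "\<delta> < \<gamma> / ?k" using \<delta> k by (simp add: field_simps)
  have unique: "a = b" if "\<delta> < R a c" "\<delta> < R b c" for a b c
  proof (rule ccontr)
    assume "a \<noteq> b"
    then obtain d where d: "\<Delta> \<le> \<bar>Qs $ a $ d - Qs $ b $ d\<bar>" using sep by blast
    have near: "(Qs $ x $ d - Q $ c $ \<sigma> d)\<^sup>2 < \<Delta>\<^sup>2 / 4" if "\<delta> < R x c" for x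
    proof -
      have "\<delta> * (\<gamma> / ?k) * (Qs $ x $ d - Q $ c $ \<sigma> d)\<^sup>2 \<le> R x c * R d (\<sigma> d) * (Qs $ x $ d - Q $ c $ \<sigma> d)\<^sup>2"
        using that \<sigma>[of d] \<delta> \<gamma> by (intro mult_right_mono mult_mono) auto
      also have "\<dots> \<le> e" by (rule fit)
      also have "e < \<delta> * (\<gamma> / ?k) * (\<Delta>\<^sup>2 / 4)" using e k by (simp add: field_simps)
      finally show ?thesis by (rule mult_left_less_imp_less) (use \<delta> \<gamma> k in simp)
    qed
    have "\<bar>Qs $ a $ d - Q $ c $ \<sigma> d\<bar> < \<Delta> / 2" "\<bar>Qs $ b $ d - Q $ c $ \<sigma> d\<bar> < \<Delta> / 2"
      by (rule power2_less_imp_less; use near[OF that(1)] near[OF that(2)] \<Delta> in \<open>simp add: power_divide\<close>)+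
    with d show False by linarith
  qed
  have big: "\<delta> < R a (\<sigma> a)" for a using \<open>\<delta> < \<gamma> / ?k\<close> \<sigma>[of a] by linarith
  have "inj \<sigma>" by (rule injI) (metis unique big)
  then have bij: "bij \<sigma>" by (simp add: bij_def finite_UNIV_inj_surj)
  have "R a c \<le> \<delta>" if "c \<noteq> \<sigma> a" for a c
  proof -
    obtain b where "c = \<sigma> b" using bij by (metis bij_pointE)
    then show ?thesis using unique[of a c b] big[of b] that by force
  qed
  moreover have "(Qs $ a $ b - Q $ \<sigma> a $ \<sigma> b)\<^sup>2 \<le> e * ?k^2 / \<gamma>\<^sup>2" for a b
  proof -
    have "\<gamma> / ?k * (\<gamma> / ?k) * (Qs $ a $ b - Q $ \<sigma> a $ \<sigma> b)\<^sup>2 \<le> R a (\<sigma> a) * R b (\<sigma> b) * (Qs $ a $ b - Q $ \<sigma> a $ \<sigma> b)\<^sup>2"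
      using \<sigma>[of a] \<sigma>[of b] \<gamma> k by (intro mult_right_mono mult_mono order_trans[OF _ \<sigma>[of a]]) auto
    also have "\<dots> \<le> e" by (rule fit)
    finally show ?thesis using \<gamma> k by (simp add: field_simps power2_eq_square)
  qed
  ultimately show thesis using that bij by blast
qed

section \<open>Likelihood comparisons on the good event\<close>

lemma sum_upper_pairs_symmetric:
  fixes h :: "nat \<Rightarrow> nat \<Rightarrow> real"
  shows "(\<Sum>(i, j)\<in>upper_pairs n. h i j + h j i) = (\<Sum>i\<in>{1..n}. \<Sum>j\<in>{1..n} - {i}. h i j)"
proof -
  have "(\<Sum>i\<in>{1..n}. \<Sum>j\<in>{1..n} - {i}. h i j) = (\<Sum>(i, j)\<in>(SIGMA i:{1..n}. {1..n} - {i}). h i j)"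
    by (subst sum.Sigma) auto
  also have "(SIGMA i:{1..n}. {1..n} - {i}) = upper_pairs n \<union> prod.swap ` upper_pairs n"
    by (force simp: upper_pairs_def image_iff)
  also have "(\<Sum>(i, j)\<in>\<dots>. h i j) = (\<Sum>(i, j)\<in>upper_pairs n. h i j) + (\<Sum>(i, j)\<in>prod.swap ` upper_pairs n. h i j)"
    by (rule sum.union_disjoint) (auto simp: finite_upper_pairs, auto simp: upper_pairs_def)
  also have "(\<Sum>(i, j)\<in>prod.swap ` upper_pairs n. h i j) = (\<Sum>(i, j)\<in>upper_pairs n. h j i)"
    by (subst sum.reindex) (auto intro!: sum.cong)
  finally show ?thesis by (simp add: case_prod_unfold sum.distrib)
qed

lemma upper_pairsD: "(i, j) \<in> upper_pairs n \<Longrightarrow> i \<in> {1..n} \<and> j \<in> {1..n} \<and> i \<noteq> j"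
  by (auto simp: upper_pairs_def)

text \<open>
  One sample on the good event, with \<open>\<gamma>\<close> the least class proportion, \<open>\<Delta>\<close> the separation of the rows of the true
  matrix, \<open>M\<close> the noise level and \<open>{l..u}\<close> the range of the connection probabilities.
\<close>

locale sbm_sample =
  fixes n :: nat and p l u \<gamma> \<Delta> M :: real and zs :: "nat \<Rightarrow> 'k::finite" and Qs :: "real^'k^'k" and X A :: nmat
  assumes labels: "zs \<in> label_funs n"
    and Qs_sym: "\<And>a b. Qs $ a $ b = Qs $ b $ a" and Qs_range: "\<And>a b. Qs $ a $ b \<in> {l..u}"
    and lu: "0 < l" "u < 1"
    and p: "0 < p" and \<gamma>: "0 < \<gamma>" and \<Delta>: "0 < \<Delta>" and M: "0 \<le> M" and k2: "2 \<le> CARD('k)"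
    and balanced: "\<And>a. \<gamma> * n \<le> card {i \<in> {1..n}. zs i = a}"
    and separated: "\<And>a b. a \<noteq> b \<Longrightarrow> \<exists>d. \<Delta> \<le> \<bar>Qs $ a $ d - Qs $ b $ d\<bar>"
    and noise: "low_noise n M zs (edge_noise p Qs zs X A)"
begin

definition log_bound :: real where "log_bound = - ln l - ln (1 - u)"

definition candidate :: "real^'k^'k \<Rightarrow> bool" where
  "candidate Q \<longleftrightarrow> (\<forall>a b. Q $ a $ b = Q $ b $ a) \<and> (\<forall>a b. Q $ a $ b \<in> {l..u})"

text \<open>
  The unnormalised soft confusion matrix.
\<close>

definition mass :: "(nat \<Rightarrow> real^'k) \<Rightarrow> 'k \<Rightarrow> 'k \<Rightarrow> real" where
  "mass \<tau> a c = (\<Sum>i\<in>{i \<in> {1..n}. zs i = a}. \<tau> i $ c)"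

text \<open>
  The expected Hamming distance to \<open>\<sigma> \<circ> zs\<close> under the product distribution \<open>\<tau>\<close> (see \<open>product_mean_hamming\<close>).
\<close>

definition miss :: "('k \<Rightarrow> 'k) \<Rightarrow> (nat \<Rightarrow> real^'k) \<Rightarrow> real" where
  "miss \<sigma> \<tau> = (\<Sum>i\<in>{1..n}. 1 - \<tau> i $ \<sigma> (zs i))"

lemma candidate_Qs: "candidate Qs"
  using Qs_sym Qs_range by (auto simp: candidate_def)

lemma candidate_log_bound: "candidate Q \<Longrightarrow> \<bar>log_term r (Q $ a $ b)\<bar> \<le> log_bound"
  unfolding log_bound_def by (rule log_term_bound) (use lu in \<open>auto simp: candidate_def\<close>)

lemma candidate_01: "candidate Q \<Longrightarrow> Q $ a $ b \<in> {0<..<1}"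
  using lu unfolding candidate_def by (metis atLeastAtMost_iff greaterThanLessThan_iff less_le_trans le_less_trans)

lemma log_bound_nonneg: "0 \<le> log_bound"
  using order_trans[OF abs_ge_zero candidate_log_bound[OF candidate_Qs]] .

text \<open>
  The likelihood deficit \<open>D\<close> and the noise bound the mean divergence between true and fitted connection
  probabilities, hence their mean squared distance. For this global comparison the crude noise bound of order
  \<open>M * n\<close> is enough.
\<close>

lemma square_deviation_bound:
  assumes Q: "candidate Q" and \<tau>: "\<tau> \<in> var_params n"
    and fit: "log_lik n X A zs Qs - D \<le> product_mean n \<tau> (\<lambda>z. log_lik n X A z Q)"
  shows "(\<Sum>(i, j)\<in>upper_pairs n. product_mean n \<tau> (\<lambda>z. (Qs $ zs i $ zs j - Q $ z i $ z j)\<^sup>2))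
    \<le> 2 * (D + 4 * real CARD('k)^2 * log_bound * (M * n)) / p"
proof -
  let ?N = "edge_noise p Qs zs X A" and ?C = "2 * real CARD('k)^2 * log_bound * (M * n)"
  let ?S = "\<lambda>z. \<Sum>(i, j)\<in>upper_pairs n. (Qs $ zs i $ zs j - Q $ z i $ z j)\<^sup>2"
  have "log_lik n X A z Q \<le> (log_lik n X A zs Qs + 2 * ?C) - p / 2 * ?S z" if z: "z \<in> label_funs n" for z
  proof -
    have "?S z / 2 \<le> (\<Sum>(i, j)\<in>upper_pairs n. bern_loglik (Qs $ zs i $ zs j) (Qs $ zs i $ zs j)
           - bern_loglik (Qs $ zs i $ zs j) (Q $ z i $ z j))"
      unfolding sum_divide_distrib case_prod_unfold
      by (intro sum_mono bern_loglik_gap_lower candidate_01 candidate_Qs Q)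
    then have "p * (?S z / 2) \<le> p * (\<Sum>(i, j)\<in>upper_pairs n. bern_loglik (Qs $ zs i $ zs j) (Qs $ zs i $ zs j)
           - bern_loglik (Qs $ zs i $ zs j) (Q $ z i $ z j))"
      using p by (intro mult_left_mono) auto
    moreover have "\<bar>weighted_edges n ?N zs Qs\<bar> \<le> ?C" "\<bar>weighted_edges n ?N z Q\<bar> \<le> ?C"
      by (intro weighted_edges_bound[OF noise] labels z M k2 candidate_log_bound candidate_Qs Q)+
    ultimately show ?thesis
      unfolding log_lik_decomp[where p = p and Qs = Qs and zs = zs]
      by (simp add: case_prod_unfold sum_subtractf right_diff_distrib)
  qed
  then have "product_mean n \<tau> (\<lambda>z. log_lik n X A z Q)
      \<le> product_mean n \<tau> (\<lambda>z. (log_lik n X A zs Qs + 2 * ?C) - p / 2 * ?S z)"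
    by (intro product_mean_mono \<tau>)
  also have "\<dots> = (log_lik n X A zs Qs + 2 * ?C) - p / 2 * product_mean n \<tau> ?S"
    by (simp only: product_mean_diff product_mean_cmult product_mean_const[OF \<tau>])
  finally have "p / 2 * product_mean n \<tau> ?S \<le> D + 2 * ?C" using fit by linarith
  then have "product_mean n \<tau> ?S \<le> 2 * (D + 2 * ?C) / p" using p by (simp add: field_simps)
  then show ?thesis by (simp add: product_mean_sum case_prod_unfold mult.assoc)
qed

text \<open>
  Independence of distinct labels under \<open>\<tau>\<close> turns the mean squared distance into a quadratic form in the
  confusion matrix. The additive \<open>n\<close> pays for the \<open>n\<close> diagonal pairs, each of which contributes at most one.
\<close>

lemma mass_fit:
  assumes Q: "candidate Q" and \<tau>: "\<tau> \<in> var_params n"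
    and fit: "log_lik n X A zs Qs - D \<le> product_mean n \<tau> (\<lambda>z. log_lik n X A z Q)"
  shows "mass \<tau> a c * mass \<tau> b d * (Qs $ a $ b - Q $ c $ d)\<^sup>2
    \<le> 4 * (D + 4 * real CARD('k)^2 * log_bound * (M * n)) / p + n"
proof -
  define f where "f i j = (\<Sum>x\<in>UNIV. \<Sum>y\<in>UNIV. \<tau> i $ x * \<tau> j $ y * (Qs $ zs i $ zs j - Q $ x $ y)\<^sup>2)" for i j
  note nn = var_params_nonneg[OF \<tau>]
  have f_nonneg: "0 \<le> f i j" if "i \<in> {1..n}" "j \<in> {1..n}" for i j
    unfolding f_def using that by (intro sum_nonneg mult_nonneg_nonneg nn) auto
  have f_sym: "f i j = f j i" for i j
    unfolding f_def using Q Qs_sym by (subst sum.swap) (simp add: candidate_def mult.commute[of "\<tau> i $ _"])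
  have f_diag: "f i i \<le> 1" if i: "i \<in> {1..n}" for i
  proof -
    have "f i i \<le> (\<Sum>x\<in>UNIV. \<Sum>y\<in>UNIV. \<tau> i $ x * \<tau> i $ y * 1)"
      unfolding f_def
    proof (intro sum_mono mult_left_mono)
      fix x y
      have "\<bar>Qs $ zs i $ zs i - Q $ x $ y\<bar> \<le> 1"
        using candidate_01[OF Q, of x y] candidate_01[OF candidate_Qs, of "zs i" "zs i"] by auto
      then show "(Qs $ zs i $ zs i - Q $ x $ y)\<^sup>2 \<le> 1" by (simp add: abs_square_le_1)
    qed (use nn i in auto)
    also have "\<dots> = 1" using i by (simp add: sum_distrib_left[symmetric] var_params_sum[OF \<tau>])
    finally show ?thesis .
  qed
  have pm: "product_mean n \<tau> (\<lambda>z. (Qs $ zs i $ zs j - Q $ z i $ z j)\<^sup>2) = f i j"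
    if "(i, j) \<in> upper_pairs n" for i j
    unfolding f_def using product_mean_pair[OF \<tau>, of i j "\<lambda>x y. (Qs $ zs i $ zs j - Q $ x $ y)\<^sup>2"] upper_pairsD[OF that] by simp
  have off: "(\<Sum>i\<in>{1..n}. \<Sum>j\<in>{1..n} - {i}. f i j) \<le> 4 * (D + 4 * real CARD('k)^2 * log_bound * (M * n)) / p"
  proof -
    have "(\<Sum>i\<in>{1..n}. \<Sum>j\<in>{1..n} - {i}. f i j) = (\<Sum>(i, j)\<in>upper_pairs n. 2 * f i j)"
      unfolding sum_upper_pairs_symmetric[symmetric] by (intro sum.cong) (auto simp: f_sym)
    also have "\<dots> = 2 * (\<Sum>(i, j)\<in>upper_pairs n. product_mean n \<tau> (\<lambda>z. (Qs $ zs i $ zs j - Q $ z i $ z j)\<^sup>2))"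
      unfolding sum_distrib_left by (intro sum.cong) (auto simp: pm)
    also have "\<dots> \<le> 2 * (2 * (D + 4 * real CARD('k)^2 * log_bound * (M * n)) / p)"
      by (intro mult_left_mono square_deviation_bound[OF assms]) auto
    finally show ?thesis by simp
  qed
  have "mass \<tau> a c * mass \<tau> b d * (Qs $ a $ b - Q $ c $ d)\<^sup>2
      = (\<Sum>i\<in>{i \<in> {1..n}. zs i = a}. \<Sum>j\<in>{j \<in> {1..n}. zs j = b}. \<tau> i $ c * \<tau> j $ d * (Qs $ zs i $ zs j - Q $ c $ d)\<^sup>2)"
    unfolding mass_def sum_product by (simp add: sum_distrib_right)
  also have "\<dots> \<le> (\<Sum>i\<in>{i \<in> {1..n}. zs i = a}. \<Sum>j\<in>{j \<in> {1..n}. zs j = b}. f i j)"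
  proof (intro sum_mono)
    fix i j assume "i \<in> {i \<in> {1..n}. zs i = a}" "j \<in> {j \<in> {1..n}. zs j = b}"
    then have i: "i \<in> {1..n}" and j: "j \<in> {1..n}" by auto
    have "\<tau> i $ c * \<tau> j $ d * (Qs $ zs i $ zs j - Q $ c $ d)\<^sup>2
        \<le> (\<Sum>y\<in>UNIV. \<tau> i $ c * \<tau> j $ y * (Qs $ zs i $ zs j - Q $ c $ y)\<^sup>2)"
      using i j nn by (intro member_le_sum) auto
    also have "\<dots> \<le> f i j"
      unfolding f_def using i j nn by (intro member_le_sum[of c UNIV "\<lambda>x. \<Sum>y\<in>UNIV. \<tau> i $ x * \<tau> j $ y * (Qs $ zs i $ zs j - Q $ x $ y)\<^sup>2"]) (auto intro!: sum_nonneg)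
    finally show "\<tau> i $ c * \<tau> j $ d * (Qs $ zs i $ zs j - Q $ c $ d)\<^sup>2 \<le> f i j" .
  qed
  also have "\<dots> \<le> (\<Sum>i\<in>{1..n}. \<Sum>j\<in>{1..n}. f i j)"
    by (intro order_trans[OF sum_mono[OF sum_mono2] sum_mono2] sum_nonneg f_nonneg) auto
  also have "\<dots> = (\<Sum>i\<in>{1..n}. f i i + (\<Sum>j\<in>{1..n} - {i}. f i j))"
    by (intro sum.cong refl sum.remove) auto
  also have "\<dots> \<le> (\<Sum>i\<in>{1..n}. 1) + 4 * (D + 4 * real CARD('k)^2 * log_bound * (M * n)) / p"
    unfolding sum.distrib by (intro add_mono sum_mono f_diag off)
  finally show ?thesis by (simp add: add.commute)
qed

lemma mass_row_sum:
  assumes \<tau>: "\<tau> \<in> var_params n"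
  shows "\<gamma> * n \<le> (\<Sum>c\<in>UNIV. mass \<tau> a c)"
proof -
  have "(\<Sum>c\<in>UNIV. mass \<tau> a c) = (\<Sum>i\<in>{i \<in> {1..n}. zs i = a}. \<Sum>c\<in>UNIV. \<tau> i $ c)"
    unfolding mass_def by (rule sum.swap)
  also have "\<dots> = (\<Sum>i\<in>{i \<in> {1..n}. zs i = a}. 1)"
    by (intro sum.cong) (auto intro!: var_params_sum[OF \<tau>])
  finally show ?thesis using balanced[of a] by simp
qed

lemma miss_eq_mass:
  assumes \<tau>: "\<tau> \<in> var_params n"
  shows "miss \<sigma> \<tau> = (\<Sum>a\<in>UNIV. \<Sum>c\<in>UNIV - {\<sigma> a}. mass \<tau> a c)"
proof -
  have "miss \<sigma> \<tau> = (\<Sum>i\<in>{1..n}. \<Sum>c\<in>UNIV - {\<sigma> (zs i)}. \<tau> i $ c)"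
    unfolding miss_def
  proof (intro sum.cong refl)
    fix i assume "i \<in> {1..n}"
    then show "1 - \<tau> i $ \<sigma> (zs i) = (\<Sum>c\<in>UNIV - {\<sigma> (zs i)}. \<tau> i $ c)"
      using sum.remove[of UNIV "\<sigma> (zs i)" "\<lambda>c. \<tau> i $ c"] var_params_sum[OF \<tau>, of i] by simp
  qed
  also have "\<dots> = (\<Sum>a\<in>UNIV. \<Sum>i\<in>{i \<in> {1..n}. zs i = a}. \<Sum>c\<in>UNIV - {\<sigma> (zs i)}. \<tau> i $ c)"
    by (rule sum.group[symmetric]) auto
  also have "\<dots> = (\<Sum>a\<in>UNIV. \<Sum>c\<in>UNIV - {\<sigma> a}. mass \<tau> a c)"
  proof (intro sum.cong refl)
    fix a
    have "(\<Sum>c\<in>UNIV - {\<sigma> a}. mass \<tau> a c) = (\<Sum>i\<in>{i \<in> {1..n}. zs i = a}. \<Sum>c\<in>UNIV - {\<sigma> a}. \<tau> i $ c)"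
      unfolding mass_def by (rule sum.swap)
    then show "(\<Sum>i\<in>{i \<in> {1..n}. zs i = a}. \<Sum>c\<in>UNIV - {\<sigma> (zs i)}. \<tau> i $ c) = (\<Sum>c\<in>UNIV - {\<sigma> a}. mass \<tau> a c)"
      by (auto intro: sum.cong)
  qed
  finally show ?thesis .
qed

lemma product_mean_hamming:
  assumes \<tau>: "\<tau> \<in> var_params n"
  shows "product_mean n \<tau> (\<lambda>z. real (hamming n (\<sigma> \<circ> zs) z)) = miss \<sigma> \<tau>"
proof -
  have hamming_sum: "real (hamming n (\<sigma> \<circ> zs) z) = (\<Sum>i\<in>{1..n}. of_bool (z i \<noteq> \<sigma> (zs i)))" for z
  proof -
    have "{i \<in> {1..n}. (\<sigma> \<circ> zs) i \<noteq> z i} = {i \<in> {1..n}. z i \<noteq> \<sigma> (zs i)}" by auto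
    moreover have "(\<Sum>i\<in>{1..n}. of_bool (z i \<noteq> \<sigma> (zs i))) = (\<Sum>i\<in>{i \<in> {1..n}. z i \<noteq> \<sigma> (zs i)}. 1::real)"
      by (subst sum.inter_filter) (auto simp: of_bool_def)
    ultimately show ?thesis by (simp add: hamming_def)
  qed
  have mean_miss: "product_mean n \<tau> (\<lambda>z. of_bool (z i \<noteq> \<sigma> (zs i))) = 1 - \<tau> i $ \<sigma> (zs i)" if "i \<in> {1..n}" for i
  proof -
    have "product_mean n \<tau> (\<lambda>z. of_bool (z i \<noteq> \<sigma> (zs i))) = product_mean n \<tau> (\<lambda>z. 1 - of_bool (z i = \<sigma> (zs i)))"
      by (simp add: of_bool_not_iff)
    also have "\<dots> = 1 - (\<Sum>a\<in>UNIV. \<tau> i $ a * of_bool (a = \<sigma> (zs i)))"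
      unfolding product_mean_diff product_mean_const[OF \<tau>]
      using product_mean_single[OF \<tau> that, of "\<lambda>a. of_bool (a = \<sigma> (zs i))"] by simp
    finally show ?thesis by (simp add: of_bool_def if_distrib[of "\<lambda>t. _ * t"] sum.delta cong: if_cong)
  qed
  show ?thesis unfolding hamming_sum product_mean_sum miss_def by (intro sum.cong refl mean_miss)
qed

text \<open>
  Compare the labels \<open>\<sigma> \<circ> zs\<close> with random labels \<open>z\<close> of law \<open>\<tau>\<close>, both with the fitted matrix \<open>Q\<close>. Pairs on which the
  two agree cancel. A pair with exactly one wrong label, say at \<open>i\<close>, costs a divergence of
  order \<open>\<Delta>\<^sup>2\<close> whenever \<open>j\<close> lies in a class that tells the true label of \<open>i\<close> from the wrong one, and there are about
  \<open>\<gamma> * n\<close> such \<open>j\<close>, most of them correctly labelled because little mass is misplaced. The fitted matrix being only close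
  to \<open>Qs\<close> costs at most \<open>H / (l * (1 - u))\<close> per touched pair. Since \<open>\<tau>\<close> is a product, the
  expected number of pairs with a wrong \<open>i\<close> and a correct \<open>j\<close> factorises, so even atypically bad \<open>z\<close> need no separate treatment.
\<close>

lemma relabelling_gain:
  assumes Q: "candidate Q" and \<tau>: "\<tau> \<in> var_params n"
    and close: "\<And>a b. (Qs $ a $ b - Q $ \<sigma> a $ \<sigma> b)\<^sup>2 \<le> H"
    and \<sigma>: "bij \<sigma>" and H: "H \<le> \<Delta>\<^sup>2 / 4" "H / (l * (1 - u)) \<le> \<Delta>\<^sup>2 * \<gamma> / 64"
    and small_miss: "miss \<sigma> \<tau> \<le> \<gamma> * n / 4" and n: "4 \<le> \<gamma> * n"
    and small_noise: "2 * real CARD('k)^2 * log_bound * M \<le> p * n * (\<Delta>\<^sup>2 * \<gamma> / 64)"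
  shows "p * n * (\<Delta>\<^sup>2 * \<gamma> / 32) * miss \<sigma> \<tau>
    \<le> log_lik n X A (\<sigma> \<circ> zs) Q - product_mean n \<tau> (\<lambda>z. log_lik n X A z Q)"
proof -
  define H' where "H' = H / (l * (1 - u))"
  define t where "t i = 1 - \<tau> i $ \<sigma> (zs i)" for i
  let ?N = "edge_noise p Qs zs X A"
  note nn = var_params_nonneg[OF \<tau>]
  have t01: "0 \<le> t i" "t i \<le> 1" if "i \<in> {1..n}" for i
    using that nn var_params_le_1[OF \<tau>] by (auto simp: t_def)
  have miss_t: "miss \<sigma> \<tau> = (\<Sum>i\<in>{1..n}. t i)" by (simp add: miss_def t_def)
  have "0 \<le> H" using order_trans[OF zero_le_power2 close] .
  then have "0 \<le> H'" using lu by (auto simp: H'_def intro!: divide_nonneg_nonneg mult_nonneg_nonneg)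
  \<comment> \<open>lower bound for the contribution of the ordered pair (i, j), when i carries the label x and j the label y\<close>
  define F where "F i j x y = of_bool (x \<noteq> \<sigma> (zs i) \<and> y = \<sigma> (zs j)) * ((Qs $ zs i $ zs j - Q $ x $ y)\<^sup>2 / 2) - H' * of_bool (x \<noteq> \<sigma> (zs i))" for i j x y
  have gap_near: "bern_loglik (Qs $ a $ b) (Qs $ a $ b) - bern_loglik (Qs $ a $ b) (Q $ \<sigma> a $ \<sigma> b) \<le> H'" for a b
  proof -
    have q: "Q $ \<sigma> a $ \<sigma> b \<in> {l..u}" using Q by (auto simp: candidate_def)
    have "bern_loglik (Qs $ a $ b) (Qs $ a $ b) - bern_loglik (Qs $ a $ b) (Q $ \<sigma> a $ \<sigma> b)
       \<le> (Qs $ a $ b - Q $ \<sigma> a $ \<sigma> b)\<^sup>2 / (Q $ \<sigma> a $ \<sigma> b * (1 - Q $ \<sigma> a $ \<sigma> b))"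
      by (intro bern_loglik_gap_upper candidate_01 Q candidate_Qs)
    also have "\<dots> \<le> H'"
      unfolding H'_def using close lu q \<open>0 \<le> H\<close> by (intro frac_le mult_mono mult_pos_pos) auto
    finally show ?thesis .
  qed
  have edge_gain: "F i j (z i) (z j) + F j i (z j) (z i) \<le>
      bern_loglik (Qs $ zs i $ zs j) (Q $ \<sigma> (zs i) $ \<sigma> (zs j)) - bern_loglik (Qs $ zs i $ zs j) (Q $ z i $ z j)" for i j z
  proof -
    have 1: "(Qs $ zs i $ zs j - Q $ z i $ z j)\<^sup>2 / 2 \<le>
       bern_loglik (Qs $ zs i $ zs j) (Qs $ zs i $ zs j) - bern_loglik (Qs $ zs i $ zs j) (Q $ z i $ z j)"
      by (intro bern_loglik_gap_lower candidate_01 Q candidate_Qs)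
    have swap: "F j i (z j) (z i) = of_bool (z j \<noteq> \<sigma> (zs j) \<and> z i = \<sigma> (zs i)) * ((Qs $ zs i $ zs j - Q $ z i $ z j)\<^sup>2 / 2) - H' * of_bool (z j \<noteq> \<sigma> (zs j))"
      using Q Qs_sym[of "zs j" "zs i"] unfolding F_def candidate_def by metis
    have "0 \<le> bern_loglik (Qs $ zs i $ zs j) (Qs $ zs i $ zs j) - bern_loglik (Qs $ zs i $ zs j) (Q $ z i $ z j)"
      by (rule order_trans[OF _ 1]) simp
    then show ?thesis using 1 gap_near[of "zs i" "zs j"] \<open>0 \<le> H'\<close> unfolding swap
      by (cases "z i = \<sigma> (zs i)"; cases "z j = \<sigma> (zs j)") (simp_all add: F_def)
  qed
  have wrong_label: "\<Delta>\<^sup>2 * \<gamma> * n / 8 \<le> (\<Sum>j\<in>{1..n} - {i}. (1 - t j) * (Qs $ zs i $ zs j - Q $ x $ \<sigma> (zs j))\<^sup>2)"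
    if i: "i \<in> {1..n}" and x: "x \<noteq> \<sigma> (zs i)" for i x
  proof -
    obtain b where b: "x = \<sigma> b" using surjE[OF bij_is_surj[OF \<sigma>]] .
    with x have "zs i \<noteq> b" by auto
    then obtain d where d: "\<Delta> \<le> \<bar>Qs $ zs i $ d - Qs $ b $ d\<bar>" using separated by blast
    have "\<bar>Qs $ b $ d - Q $ x $ \<sigma> d\<bar> \<le> \<Delta> / 2"
    proof (rule power2_le_imp_le)
      show "\<bar>Qs $ b $ d - Q $ x $ \<sigma> d\<bar>\<^sup>2 \<le> (\<Delta> / 2)\<^sup>2"
        using close[of b d] H(1) b by (simp add: power_divide)
    qed (use \<Delta> in simp)
    with d have far: "\<Delta> / 2 \<le> \<bar>Qs $ zs i $ d - Q $ x $ \<sigma> d\<bar>" by linarith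
    have sq: "\<Delta>\<^sup>2 / 4 \<le> (Qs $ zs i $ d - Q $ x $ \<sigma> d)\<^sup>2"
      using power_mono[OF far, of 2] \<Delta> by (simp add: power_divide)
    let ?C = "{j \<in> {1..n}. zs j = d}"
    \<comment> \<open>enough members of the separating class d are, in mean, correctly labelled\<close>
    have "(\<Sum>j\<in>?C - {i}. t j) \<le> miss \<sigma> \<tau>"
      unfolding miss_t by (intro sum_mono2) (auto intro!: t01)
    moreover have "card ?C \<le> card (?C - {i}) + 1" using diff_card_le_card_Diff[of "{i}" ?C] by simp
    then have "\<gamma> * n - 1 \<le> card (?C - {i})" using balanced[of d] by linarith
    ultimately have "\<gamma> * n / 2 \<le> (\<Sum>j\<in>?C - {i}. 1 - t j)"
      using small_miss n by (simp add: sum_subtractf)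
    then have "\<Delta>\<^sup>2 / 4 * (\<gamma> * n / 2) \<le> \<Delta>\<^sup>2 / 4 * (\<Sum>j\<in>?C - {i}. 1 - t j)"
      by (intro mult_left_mono) auto
    also have "\<dots> \<le> (\<Sum>j\<in>?C - {i}. (1 - t j) * (Qs $ zs i $ zs j - Q $ x $ \<sigma> (zs j))\<^sup>2)"
      unfolding sum_distrib_left
    proof (intro sum_mono)
      fix j assume "j \<in> ?C - {i}"
      then show "\<Delta>\<^sup>2 / 4 * (1 - t j) \<le> (1 - t j) * (Qs $ zs i $ zs j - Q $ x $ \<sigma> (zs j))\<^sup>2"
        using mult_right_mono[OF sq, of "1 - t j"] t01(2)[of j] by (simp add: mult.commute)
    qed
    also have "\<dots> \<le> (\<Sum>j\<in>{1..n} - {i}. (1 - t j) * (Qs $ zs i $ zs j - Q $ x $ \<sigma> (zs j))\<^sup>2)"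
      by (intro sum_mono2) (auto simp: t01(2))
    finally show ?thesis by simp
  qed
  have mean_F: "product_mean n \<tau> (\<lambda>z. F i j (z i) (z j)) =
      (\<Sum>x\<in>UNIV - {\<sigma> (zs i)}. \<tau> i $ x * ((1 - t j) * (Qs $ zs i $ zs j - Q $ x $ \<sigma> (zs j))\<^sup>2)) / 2 - H' * t i"
    if ij: "i \<in> {1..n}" "j \<in> {1..n} - {i}" for i j
  proof -
    have "product_mean n \<tau> (\<lambda>z. F i j (z i) (z j)) = (\<Sum>x\<in>UNIV. \<Sum>y\<in>UNIV. \<tau> i $ x * \<tau> j $ y * F i j x y)"
      by (rule product_mean_pair[OF \<tau>]) (use ij in auto)
    also have "\<dots> = (\<Sum>x\<in>UNIV. of_bool (x \<noteq> \<sigma> (zs i)) *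
        (\<tau> i $ x * ((1 - t j) * (Qs $ zs i $ zs j - Q $ x $ \<sigma> (zs j))\<^sup>2) / 2 - H' * \<tau> i $ x))"
    proof (intro sum.cong refl)
      fix x
      have "(\<Sum>y\<in>UNIV. \<tau> i $ x * \<tau> j $ y * F i j x y)
        = (\<Sum>y\<in>UNIV. if y = \<sigma> (zs j) then of_bool (x \<noteq> \<sigma> (zs i)) * (\<tau> i $ x * \<tau> j $ y * ((Qs $ zs i $ zs j - Q $ x $ y)\<^sup>2 / 2)) else 0)
          - (\<Sum>y\<in>UNIV. H' * of_bool (x \<noteq> \<sigma> (zs i)) * \<tau> i $ x * \<tau> j $ y)"
        unfolding sum_subtractf[symmetric] F_def by (intro sum.cong) (auto simp: algebra_simps)
      also have "(\<Sum>y\<in>UNIV. H' * of_bool (x \<noteq> \<sigma> (zs i)) * \<tau> i $ x * \<tau> j $ y) = H' * of_bool (x \<noteq> \<sigma> (zs i)) * \<tau> i $ x"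
        using ij by (simp add: sum_distrib_left[symmetric] var_params_sum[OF \<tau>])
      finally show "(\<Sum>y\<in>UNIV. \<tau> i $ x * \<tau> j $ y * F i j x y) = of_bool (x \<noteq> \<sigma> (zs i)) *
        (\<tau> i $ x * ((1 - t j) * (Qs $ zs i $ zs j - Q $ x $ \<sigma> (zs j))\<^sup>2) / 2 - H' * \<tau> i $ x)"
        by (simp add: sum.delta t_def)
    qed
    also have "\<dots> = (\<Sum>x\<in>UNIV - {\<sigma> (zs i)}. \<tau> i $ x * ((1 - t j) * (Qs $ zs i $ zs j - Q $ x $ \<sigma> (zs j))\<^sup>2) / 2 - H' * \<tau> i $ x)"
      by (rule sum.mono_neutral_cong_right) auto
    also have "(\<Sum>x\<in>UNIV - {\<sigma> (zs i)}. \<tau> i $ x) = t i"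
      using sum.remove[of UNIV "\<sigma> (zs i)" "\<lambda>c. \<tau> i $ c"] var_params_sum[OF \<tau> ij(1)] by (simp add: t_def)
    then have "(\<Sum>x\<in>UNIV - {\<sigma> (zs i)}. \<tau> i $ x * ((1 - t j) * (Qs $ zs i $ zs j - Q $ x $ \<sigma> (zs j))\<^sup>2) / 2 - H' * \<tau> i $ x)
       = (\<Sum>x\<in>UNIV - {\<sigma> (zs i)}. \<tau> i $ x * ((1 - t j) * (Qs $ zs i $ zs j - Q $ x $ \<sigma> (zs j))\<^sup>2)) / 2 - H' * t i"
      by (simp add: sum_subtractf sum_distrib_left[symmetric] sum_divide_distrib)
    finally show ?thesis .
  qed
  have row_gain: "n * (\<Delta>\<^sup>2 * \<gamma> / 16 - H') * t i \<le> (\<Sum>j\<in>{1..n} - {i}. product_mean n \<tau> (\<lambda>z. F i j (z i) (z j)))"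
    if i: "i \<in> {1..n}" for i
  proof -
    have ti: "(\<Sum>x\<in>UNIV - {\<sigma> (zs i)}. \<tau> i $ x) = t i"
      using sum.remove[of UNIV "\<sigma> (zs i)" "\<lambda>c. \<tau> i $ c"] var_params_sum[OF \<tau> i] by (simp add: t_def)
    have "t i * (\<Delta>\<^sup>2 * \<gamma> * n / 8) = (\<Sum>x\<in>UNIV - {\<sigma> (zs i)}. \<tau> i $ x * (\<Delta>\<^sup>2 * \<gamma> * n / 8))"
      unfolding ti[symmetric] sum_distrib_right ..
    also have "\<dots> \<le> (\<Sum>x\<in>UNIV - {\<sigma> (zs i)}. \<tau> i $ x * (\<Sum>j\<in>{1..n} - {i}. (1 - t j) * (Qs $ zs i $ zs j - Q $ x $ \<sigma> (zs j))\<^sup>2))"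
      by (intro sum_mono mult_left_mono wrong_label nn i) auto
    also have "\<dots> = (\<Sum>j\<in>{1..n} - {i}. \<Sum>x\<in>UNIV - {\<sigma> (zs i)}. \<tau> i $ x * ((1 - t j) * (Qs $ zs i $ zs j - Q $ x $ \<sigma> (zs j))\<^sup>2))"
      unfolding sum_distrib_left by (rule sum.swap)
    finally have "t i * (\<Delta>\<^sup>2 * \<gamma> * n / 8) \<le> (\<Sum>j\<in>{1..n} - {i}. \<Sum>x\<in>UNIV - {\<sigma> (zs i)}. \<tau> i $ x * ((1 - t j) * (Qs $ zs i $ zs j - Q $ x $ \<sigma> (zs j))\<^sup>2))" .
    from divide_right_mono[OF this, of 2]
    have 1: "t i * (\<Delta>\<^sup>2 * \<gamma> * n / 8) / 2 \<le> (\<Sum>j\<in>{1..n} - {i}. (\<Sum>x\<in>UNIV - {\<sigma> (zs i)}. \<tau> i $ x * ((1 - t j) * (Qs $ zs i $ zs j - Q $ x $ \<sigma> (zs j))\<^sup>2)) / 2)"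
      by (simp only: sum_divide_distrib)
    have "real (card ({1..n} - {i})) * (H' * t i) \<le> n * (H' * t i)"
      using \<open>0 \<le> H'\<close> t01[OF i] i by (intro mult_right_mono) (auto simp: card_Diff_singleton_if)
    then have "n * (\<Delta>\<^sup>2 * \<gamma> / 16 - H') * t i \<le> t i * (\<Delta>\<^sup>2 * \<gamma> * n / 8) / 2 - (\<Sum>j\<in>{1..n} - {i}. H' * t i)"
      by (simp add: algebra_simps)
    also have "\<dots> \<le> (\<Sum>j\<in>{1..n} - {i}. product_mean n \<tau> (\<lambda>z. F i j (z i) (z j)))"
      using 1 by (simp add: mean_F[OF i] sum_subtractf del: sum_constant)
    finally show ?thesis .
  qed
  have total_gain: "n * (3 * \<Delta>\<^sup>2 * \<gamma> / 64) * miss \<sigma> \<tau> \<le> product_mean n \<tau> (\<lambda>z. \<Sum>(i, j)\<in>upper_pairs n. F i j (z i) (z j) + F j i (z j) (z i))"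
  proof -
    have "n * (3 * \<Delta>\<^sup>2 * \<gamma> / 64) * miss \<sigma> \<tau> \<le> n * (\<Delta>\<^sup>2 * \<gamma> / 16 - H') * miss \<sigma> \<tau>"
    proof (intro mult_right_mono mult_left_mono)
      show "3 * \<Delta>\<^sup>2 * \<gamma> / 64 \<le> \<Delta>\<^sup>2 * \<gamma> / 16 - H'" using H(2) unfolding H'_def[symmetric] by linarith
    qed (auto simp: miss_t intro!: sum_nonneg t01)
    also have "\<dots> \<le> (\<Sum>i\<in>{1..n}. \<Sum>j\<in>{1..n} - {i}. product_mean n \<tau> (\<lambda>z. F i j (z i) (z j)))"
      unfolding miss_t sum_distrib_left by (intro sum_mono row_gain)
    also have "\<dots> = (\<Sum>(i, j)\<in>upper_pairs n. product_mean n \<tau> (\<lambda>z. F i j (z i) (z j)) + product_mean n \<tau> (\<lambda>z. F j i (z j) (z i)))"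
      by (rule sum_upper_pairs_symmetric[symmetric])
    finally show ?thesis by (simp add: product_mean_sum product_mean_add case_prod_unfold)
  qed
  have pointwise: "p * (\<Sum>(i, j)\<in>upper_pairs n. F i j (z i) (z j) + F j i (z j) (z i))
      - 2 * real CARD('k)^2 * log_bound * M * hamming n (\<sigma> \<circ> zs) z \<le> log_lik n X A (\<sigma> \<circ> zs) Q - log_lik n X A z Q"
    if z: "z \<in> label_funs n" for z
  proof -
    have "p * (\<Sum>(i, j)\<in>upper_pairs n. F i j (z i) (z j) + F j i (z j) (z i))
       \<le> p * (\<Sum>(i, j)\<in>upper_pairs n. bern_loglik (Qs $ zs i $ zs j) (Q $ \<sigma> (zs i) $ \<sigma> (zs j)) - bern_loglik (Qs $ zs i $ zs j) (Q $ z i $ z j))"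
      using p by (intro mult_left_mono sum_mono) (auto intro!: edge_gain)
    moreover have "\<bar>weighted_edges n ?N (\<sigma> \<circ> zs) Q - weighted_edges n ?N z Q\<bar>
        \<le> 2 * real CARD('k)^2 * log_bound * (M * hamming n (\<sigma> \<circ> zs) z)"
      using noise z unfolding low_noise_def by (intro weighted_edges_diff_bound candidate_log_bound Q) blast
    ultimately show ?thesis
      unfolding log_lik_decomp[where p = p and Qs = Qs and zs = zs]
      by (simp add: case_prod_unfold sum_subtractf right_diff_distrib)
  qed
  have "p * n * (\<Delta>\<^sup>2 * \<gamma> / 32) * miss \<sigma> \<tau> \<le> p * (n * (3 * \<Delta>\<^sup>2 * \<gamma> / 64) * miss \<sigma> \<tau>) - 2 * real CARD('k)^2 * log_bound * M * miss \<sigma> \<tau>"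
  proof -
    have "0 \<le> miss \<sigma> \<tau>" unfolding miss_t by (intro sum_nonneg t01)
    from mult_right_mono[OF small_noise this] show ?thesis by (simp add: algebra_simps)
  qed
  also have "\<dots> \<le> p * product_mean n \<tau> (\<lambda>z. \<Sum>(i, j)\<in>upper_pairs n. F i j (z i) (z j) + F j i (z j) (z i))
      - 2 * real CARD('k)^2 * log_bound * M * miss \<sigma> \<tau>"
    using total_gain p by simp
  also have "\<dots> = product_mean n \<tau> (\<lambda>z. p * (\<Sum>(i, j)\<in>upper_pairs n. F i j (z i) (z j) + F j i (z j) (z i))
      - 2 * real CARD('k)^2 * log_bound * M * hamming n (\<sigma> \<circ> zs) z)"
    unfolding product_mean_diff product_mean_cmult product_mean_hamming[OF \<tau>] ..
  also have "\<dots> \<le> product_mean n \<tau> (\<lambda>z. log_lik n X A (\<sigma> \<circ> zs) Q - log_lik n X A z Q)"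
    by (intro product_mean_mono \<tau> pointwise)
  finally show ?thesis unfolding product_mean_diff product_mean_const[OF \<tau>] .
qed

end

section \<open>Exact recovery by both estimators\<close>

text \<open>
  The relative fit error below which the confusion matrix is forced close to a permutation and the fitted matrix
  close enough to the truth for \<open>relabelling_gain\<close>. The powers of \<open>\<gamma>\<close> and \<open>k\<close> come from the smallness conditions of
  \<open>soft_confusion_is_permutation\<close>.
\<close>

definition fit_tolerance :: "nat \<Rightarrow> real \<Rightarrow> real \<Rightarrow> real \<Rightarrow> real \<Rightarrow> real" where
  "fit_tolerance k l u \<gamma> \<Delta> = \<Delta>\<^sup>2 * \<gamma> ^ 3 * (l * (1 - u)) / (64 * real k ^ 3)"

lemma log_lik_cong: "(\<And>i. i \<in> {1..n} \<Longrightarrow> z i = z' i) \<Longrightarrow> log_lik n X A z Q = log_lik n X A z' Q"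
  unfolding log_lik_def by (intro sum.cong refl) (auto simp: upper_pairs_def)

definition prior :: "nat \<Rightarrow> real^'k \<Rightarrow> (nat \<Rightarrow> 'k) \<Rightarrow> real" where
  "prior n \<alpha> z = (\<Prod>i\<in>{1..n}. \<alpha> $ z i)"

text \<open>
  The weights \<open>w\<close> need not sum to one. Absorbing an energy into \<open>w\<close> thus bounds mean energy plus
  entropy, and for product-form \<open>w\<close> the sum on the right is explicit; no tensorisation of the entropy is
  required.
\<close>

lemma gibbs_inequality:
  fixes g w :: "'a \<Rightarrow> real"
  assumes "finite S" and g: "\<And>z. z \<in> S \<Longrightarrow> 0 \<le> g z" "(\<Sum>z\<in>S. g z) = 1" and w: "\<And>z. z \<in> S \<Longrightarrow> 0 < w z"
  shows "(\<Sum>z\<in>S. g z * ln (w z / g z)) \<le> (\<Sum>z\<in>S. w z) - 1"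
proof -
  have "(\<Sum>z\<in>S. g z * ln (w z / g z)) \<le> (\<Sum>z\<in>S. w z - g z)"
  proof (intro sum_mono)
    fix z assume z: "z \<in> S"
    show "g z * ln (w z / g z) \<le> w z - g z"
    proof (cases "g z = 0")
      case True
      then show ?thesis using w[OF z] by simp
    next
      case False
      then have "0 < g z" using g(1)[OF z] by simp
      then have "g z * ln (w z / g z) \<le> g z * (w z / g z - 1)"
        using w[OF z] by (intro mult_left_mono ln_le_minus_one) auto
      then show ?thesis using \<open>0 < g z\<close> by (simp add: right_diff_distrib)
    qed
  qed
  then show ?thesis by (simp add: sum_subtractf g(2))
qed

text \<open>
  The evidence lower bound: the intractable normalisation \<open>lik\<close> cancels.
\<close>

lemma var_objective_eq:
  fixes \<alpha> :: "real^'k::finite"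
  assumes \<alpha>: "\<And>a. 0 < \<alpha> $ a" and \<tau>: "\<tau> \<in> var_params n"
  shows "var_objective n X A \<tau> \<alpha> Q = product_mean n \<tau> (\<lambda>z. log_lik n X A z Q)
     + (\<Sum>z\<in>label_funs n. prod_distr n \<tau> z * ln (prior n \<alpha> z / prod_distr n \<tau> z))"
proof -
  let ?g = "prod_distr n \<tau>" and ?L = "lik n X A \<alpha> Q"
  have prior_pos: "0 < prior n \<alpha> z" for z using \<alpha> by (auto simp: prior_def intro!: prod_pos)
  have joint: "joint_lik n X A \<alpha> Q z = prior n \<alpha> z * exp (log_lik n X A z Q)" for z
    by (simp add: joint_lik_def prior_def)
  have L: "0 < ?L"
    unfolding lik_def joint using prior_pos
    by (intro sum_pos finite_label_funs) (auto simp: label_funs_def PiE_eq_empty_iff)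
  have post: "label_posterior n X A \<alpha> Q z = prior n \<alpha> z * exp (log_lik n X A z Q) / ?L" for z
    by (simp add: label_posterior_def joint)
  have "KL_labels n ?g (label_posterior n X A \<alpha> Q) = (\<Sum>z\<in>label_funs n. ?g z * ln (?g z / label_posterior n X A \<alpha> Q z))"
    using L prior_pos prod_distr_nonneg[OF \<tau>] by (intro KL_labels_eq_sum) (auto simp: post)
  also have "\<dots> = (\<Sum>z\<in>label_funs n. ?g z * ln ?L - ?g z * log_lik n X A z Q - ?g z * ln (prior n \<alpha> z / ?g z))"
  proof (intro sum.cong refl)
    fix z
    show "?g z * ln (?g z / label_posterior n X A \<alpha> Q z)
        = ?g z * ln ?L - ?g z * log_lik n X A z Q - ?g z * ln (prior n \<alpha> z / ?g z)"
    proof (cases "?g z = 0")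
      case False
      then have "0 < ?g z" using prod_distr_nonneg[OF \<tau>, of z] by simp
      then show ?thesis using L prior_pos[of z] by (simp add: post ln_div ln_mult algebra_simps)
    qed simp
  qed
  finally show ?thesis
    by (simp add: var_objective_def product_mean_def sum_subtractf prod_distr_sum[OF \<tau>] flip: sum_distrib_right)
qed

lemma var_objective_le:
  fixes \<alpha> :: "real^'k::finite"
  assumes \<alpha>: "\<And>a. 0 < \<alpha> $ a" "\<alpha> \<in> prob_simplex" and \<tau>: "\<tau> \<in> var_params n"
  shows "var_objective n X A \<tau> \<alpha> Q \<le> product_mean n \<tau> (\<lambda>z. log_lik n X A z Q)"
proof -
  have "(\<Sum>z\<in>label_funs n. prod_distr n \<tau> z * ln (prior n \<alpha> z / prod_distr n \<tau> z)) \<le> (\<Sum>z\<in>label_funs n. prior n \<alpha> z) - 1"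
    using \<alpha> by (intro gibbs_inequality finite_label_funs prod_distr_nonneg \<tau> prod_distr_sum) (auto simp: prior_def intro!: prod_pos)
  also have "(\<Sum>z\<in>label_funs n. prior n \<alpha> z) = 1"
    unfolding prior_def using \<alpha> by (subst sum_label_funs_prod) (simp add: prob_simplex_def)
  finally show ?thesis by (simp add: var_objective_eq[OF \<alpha>(1) \<tau>])
qed

lemma var_objective_axis:
  fixes \<alpha> :: "real^'k::finite"
  assumes \<alpha>: "\<And>a. 0 < \<alpha> $ a" and z: "z \<in> label_funs n"
  shows "var_objective n X A (\<lambda>i. axis (z i) 1) \<alpha> Q = log_lik n X A z Q + ln (prior n \<alpha> z)"
proof -
  have "prod_distr n (\<lambda>i. axis (z i) 1) z = 1" by (simp add: prod_distr_def axis_def)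
  then have "(\<Sum>z'\<in>label_funs n. prod_distr n (\<lambda>i. axis (z i) 1) z' * ln (prior n \<alpha> z' / prod_distr n (\<lambda>i. axis (z i) 1) z')) = ln (prior n \<alpha> z)"
    using product_mean_axis[OF z, of "\<lambda>z'. ln (prior n \<alpha> z' / prod_distr n (\<lambda>i. axis (z i) 1) z')"]
    unfolding product_mean_def by simp
  then show ?thesis
    by (simp add: var_objective_eq[OF \<alpha> axis_var_params] product_mean_axis[OF z])
qed

lemma relabel_permutation:
  fixes \<sigma> \<sigma>' :: "'k \<Rightarrow> 'k"
  assumes "bij \<sigma>" "bij \<sigma>'" and "\<And>i. i \<in> {1..n} \<Longrightarrow> z i = \<sigma> (zs i)" "\<And>i. i \<in> {1..n} \<Longrightarrow> z' i = \<sigma>' (zs i)"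
  shows "label_equiv n z z'"
  unfolding label_equiv_def
proof (intro exI conjI ballI)
  show "(\<sigma>' \<circ> inv \<sigma>) permutes UNIV"
    by (intro bij_imp_permutes bij_comp bij_imp_bij_inv assms(1,2)) auto
  show "z' i = (\<sigma>' \<circ> inv \<sigma>) (z i)" if "i \<in> {1..n}" for i
    using assms that by (simp add: bij_is_inj)
qed

context sbm_sample
begin

text \<open>
  The confusion matrix and the gain combined: an almost optimal product distribution determines a permutation \<open>\<sigma>\<close> towards which
  it is profitable to move.
\<close>

lemma recovery_margin:
  defines "e \<equiv> fit_tolerance CARD('k) l u \<gamma> \<Delta>"
  assumes Q: "candidate Q" and \<tau>: "\<tau> \<in> var_params n" and \<gamma>1: "\<gamma> \<le> 1" and \<Delta>1: "\<Delta> \<le> 1"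
    and M_small: "64 * real CARD('k)^2 * (log_bound + 1) * M \<le> e * p * n" and n: "4 / e \<le> n"
    and fit: "log_lik n X A zs Qs - e * p * n\<^sup>2 / 16 \<le> product_mean n \<tau> (\<lambda>z. log_lik n X A z Q)"
  obtains \<sigma> where "bij \<sigma>"
    "p * n * (\<Delta>\<^sup>2 * \<gamma> / 32) * miss \<sigma> \<tau> \<le> log_lik n X A (\<sigma> \<circ> zs) Q - product_mean n \<tau> (\<lambda>z. log_lik n X A z Q)"
proof -
  let ?k = "real CARD('k)"
  define v where "v = l * (1 - u)"
  have v: "0 < v" "v \<le> 1"
  proof -
    have "l \<le> u" using Qs_range by (metis atLeastAtMost_iff order_trans)
    then show "0 < v" "v \<le> 1" using lu by (auto simp: v_def intro: mult_le_one)
  qed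
  have k: "1 \<le> ?k" "2 \<le> ?k" using k2 by auto
  have e: "e = \<Delta>\<^sup>2 * \<gamma> ^ 3 * v / (64 * ?k ^ 3)" by (simp add: e_def fit_tolerance_def v_def)
  have e0: "0 < e" using \<Delta> \<gamma> v k by (simp add: e)
  have \<gamma>3: "\<gamma> ^ 3 * v \<le> \<gamma>\<^sup>2 * 1" "\<gamma> ^ 3 * v \<le> \<gamma> * 1" 
    using \<gamma> \<gamma>1 v power_decreasing[of 2 3 \<gamma>] power_decreasing[of 1 3 \<gamma>] by (intro mult_mono; simp)+
  have "e \<le> \<Delta>\<^sup>2 * \<gamma> / 64"
  proof -
    have "e \<le> \<Delta>\<^sup>2 * \<gamma> ^ 3 * v / (64 * 1)"
      unfolding e using \<Delta> \<gamma> v k by (intro divide_left_mono mult_left_mono) (auto simp: one_le_power)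
    also have "\<dots> \<le> \<Delta>\<^sup>2 * \<gamma> / 64" using mult_left_mono[OF \<gamma>3(2), of "\<Delta>\<^sup>2"] by (simp add: mult.assoc)
    finally show ?thesis .
  qed
  also have "\<dots> \<le> \<gamma>" 
  proof -
    have "\<Delta>\<^sup>2 * \<gamma> \<le> 1 * \<gamma>" using \<Delta> \<Delta>1 \<gamma> by (intro mult_right_mono power_le_one) auto
    then show ?thesis using \<gamma> by linarith
  qed
  finally have "e \<le> \<gamma>" .
  have n': "4 \<le> e * n" using n e0 by (simp add: field_simps)
  then have n4: "4 \<le> \<gamma> * n" using mult_right_mono[OF \<open>e \<le> \<gamma>\<close>, of "real n"] by linarith
  have n0: "0 < real n" using n' e0 by (auto intro: ccontr)
  define R where "R a c = mass \<tau> a c / n" for a c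
  \<comment> \<open>a light entry is at most \<open>\<gamma> / (8 * k\<^sup>2)\<close>, so all \<open>k\<^sup>2\<close> of them together misplace a mass below \<open>\<gamma> * n / 4\<close>\<close>
  obtain \<sigma> where \<sigma>: "bij \<sigma>" "\<And>a c. c \<noteq> \<sigma> a \<Longrightarrow> R a c \<le> \<gamma> / (8 * ?k^2)"
    "\<And>a b. (Qs $ a $ b - Q $ \<sigma> a $ \<sigma> b)\<^sup>2 \<le> e * ?k^2 / \<gamma>\<^sup>2"
  proof (rule soft_confusion_is_permutation[of \<gamma> R \<Delta> Qs Q e "\<gamma> / (8 * ?k^2)"])
    show "\<gamma> \<le> (\<Sum>c\<in>UNIV. R a c)" for a
      using mass_row_sum[OF \<tau>, of a] n0 by (simp add: R_def sum_divide_distrib[symmetric] field_simps)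
    show "R a c * R b d * (Qs $ a $ b - Q $ c $ d)\<^sup>2 \<le> e" for a b c d
    proof -
      have "?k^2 * log_bound * M \<le> ?k^2 * (log_bound + 1) * M" using M by (intro mult_right_mono mult_left_mono) auto
      then have "64 * ?k^2 * log_bound * M \<le> e * p * n" using M_small by linarith
      then have "64 * ?k^2 * log_bound * M * n \<le> e * p * n * n" by (rule mult_right_mono) simp
      then have noise_part: "16 * ?k^2 * log_bound * (M * n) / p \<le> e * n\<^sup>2 / 4"
        using p by (simp add: field_simps power2_eq_square)
      have "4 * (e * p * n\<^sup>2 / 16 + 4 * ?k^2 * log_bound * (M * n)) / p + n
          = e * n\<^sup>2 / 4 + 16 * ?k^2 * log_bound * (M * n) / p + n"
        using p by (simp add: field_simps)
      also have "\<dots> \<le> e * n\<^sup>2"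
      proof -
        have "4 * real n \<le> e * n\<^sup>2" using mult_right_mono[OF n', of "real n"] by (simp add: power2_eq_square mult_ac)
        then show ?thesis using noise_part by linarith
      qed
      finally have "mass \<tau> a c * mass \<tau> b d * (Qs $ a $ b - Q $ c $ d)\<^sup>2 \<le> e * n\<^sup>2"
        using mass_fit[OF Q \<tau> fit, of a c b d] by linarith
      then show ?thesis using n0 by (simp add: R_def field_simps power2_eq_square)
    qed
    have "\<gamma> * ?k < \<gamma> * (8 * ?k\<^sup>2)" using \<gamma> k by (intro mult_strict_left_mono) (auto simp: power2_eq_square)
    then show "\<gamma> / (8 * ?k^2) * ?k < \<gamma>" using k by (simp add: field_simps)
    have "4 * e * ?k = \<Delta>\<^sup>2 * (\<gamma> ^ 3 * v) / (16 * ?k\<^sup>2)"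
      using k by (simp add: e field_simps power2_eq_square power3_eq_cube)
    also have "\<dots> \<le> \<Delta>\<^sup>2 * (\<gamma>\<^sup>2 * 1) / (16 * ?k\<^sup>2)"
      by (intro divide_right_mono mult_left_mono \<gamma>3) auto
    also have "\<dots> < \<Delta>\<^sup>2 * (\<gamma> / (8 * ?k\<^sup>2)) * \<gamma>"
      using \<Delta> \<gamma> k by (simp add: field_simps power2_eq_square)
    finally show "4 * e * ?k < \<Delta>\<^sup>2 * (\<gamma> / (8 * ?k\<^sup>2)) * \<gamma>" .
  qed (use separated \<gamma> \<Delta> k in auto)
  define H where "H = e * ?k^2 / \<gamma>\<^sup>2"
  have H: "H = \<Delta>\<^sup>2 * \<gamma> / 64 * v / ?k" using \<gamma> k by (simp add: H_def e field_simps power2_eq_square power3_eq_cube)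
  have Hv: "H / v \<le> \<Delta>\<^sup>2 * \<gamma> / 64"
    unfolding H using v \<gamma> k divide_left_mono[of 1 ?k "\<Delta>\<^sup>2 * \<gamma>"] by simp
  have H4: "H \<le> \<Delta>\<^sup>2 / 4"
  proof -
    have "H = H / v * v" using v by simp
    also have "\<dots> \<le> (\<Delta>\<^sup>2 * \<gamma> / 64) * 1" using Hv v \<gamma> by (intro mult_mono) auto
    also have "\<dots> \<le> \<Delta>\<^sup>2 / 4" using \<gamma> \<gamma>1 mult_left_mono[OF \<gamma>1, of "\<Delta>\<^sup>2"] zero_le_power2[of \<Delta>] by linarith
    finally show ?thesis .
  qed
  have small_miss: "miss \<sigma> \<tau> \<le> \<gamma> * n / 4"
  proof -
    have "miss \<sigma> \<tau> \<le> (\<Sum>a\<in>(UNIV::'k set). \<Sum>c\<in>UNIV - {\<sigma> a}. \<gamma> / (8 * ?k^2) * n)"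
      unfolding miss_eq_mass[OF \<tau>]
      using \<sigma>(2) n0 by (intro sum_mono) (simp add: R_def pos_divide_le_eq)
    also have "\<dots> \<le> (\<Sum>a\<in>(UNIV::'k set). \<Sum>c\<in>(UNIV::'k set). \<gamma> / (8 * ?k^2) * n)"
      using \<gamma> by (intro sum_mono sum_mono2) auto
    also have "\<dots> = \<gamma> * n / 8" using k by (simp add: field_simps power2_eq_square)
    also have "\<dots> \<le> \<gamma> * n / 4" using \<gamma> by simp
    finally show ?thesis .
  qed
  have small_noise: "2 * ?k^2 * log_bound * M \<le> p * n * (\<Delta>\<^sup>2 * \<gamma> / 64)"
  proof -
    have "2 * ?k^2 * log_bound * M \<le> 64 * ?k^2 * (log_bound + 1) * M"
      using log_bound_nonneg M by (intro mult_right_mono mult_mono) auto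
    also have "\<dots> \<le> e * p * n" by (rule M_small)
    also have "\<dots> \<le> \<Delta>\<^sup>2 * \<gamma> / 64 * p * n" using \<open>e \<le> \<Delta>\<^sup>2 * \<gamma> / 64\<close> p by (intro mult_right_mono) auto
    finally show ?thesis by (simp add: mult_ac)
  qed
  show thesis
    by (rule that[OF \<sigma>(1) relabelling_gain[OF Q \<tau> _ \<sigma>(1) H4 Hv[unfolded v_def] small_miss n4 small_noise]])
      (use \<sigma>(3) in \<open>simp add: H_def\<close>)
qed

text \<open>
  For a point mass the gain of moving to \<open>\<sigma> \<circ> zs\<close> cannot be positive, since the estimator maximises the likelihood;
  so no label is misplaced.
\<close>

lemma mle_exact_recovery:
  defines "e \<equiv> fit_tolerance CARD('k) l u \<gamma> \<Delta>"
  assumes mle: "is_mle \<Q> n X A Qh zh" and \<Q>: "\<And>Q. Q \<in> \<Q> \<Longrightarrow> candidate Q" "Qs \<in> \<Q>"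
    and \<gamma>1: "\<gamma> \<le> 1" and \<Delta>1: "\<Delta> \<le> 1"
    and M_small: "64 * real CARD('k)^2 * (log_bound + 1) * M \<le> e * p * n" and n: "4 / e \<le> n" and e: "0 < e"
  obtains \<sigma> where "bij \<sigma>" "\<And>i. i \<in> {1..n} \<Longrightarrow> zh i = \<sigma> (zs i)"
proof -
  let ?\<tau> = "\<lambda>i. axis (zh i) (1::real)"
  have h: "Qh \<in> \<Q>" "zh \<in> label_funs n"
    and max: "\<And>Q z. Q \<in> \<Q> \<Longrightarrow> z \<in> label_funs n \<Longrightarrow> log_lik n X A z Q \<le> log_lik n X A zh Qh"
    using mle by (auto simp: is_mle_def is_arg_max_linorder)
  have "0 \<le> e * p * n\<^sup>2 / 16" using e p by simp
  then have "log_lik n X A zs Qs - e * p * n\<^sup>2 / 16 \<le> product_mean n ?\<tau> (\<lambda>z. log_lik n X A z Qh)"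
    using max[OF \<Q>(2) labels] by (simp add: product_mean_axis[OF h(2)])
  then obtain \<sigma> where \<sigma>: "bij \<sigma>"
    "p * n * (\<Delta>\<^sup>2 * \<gamma> / 32) * miss \<sigma> ?\<tau> \<le> log_lik n X A (\<sigma> \<circ> zs) Qh - product_mean n ?\<tau> (\<lambda>z. log_lik n X A z Qh)"
    using recovery_margin[OF \<Q>(1)[OF h(1)] axis_var_params \<gamma>1 \<Delta>1 M_small[unfolded e_def] n[unfolded e_def], folded e_def] by blast
  moreover have "log_lik n X A (\<sigma> \<circ> zs) Qh - product_mean n ?\<tau> (\<lambda>z. log_lik n X A z Qh) \<le> 0"
  proof -
    \<comment> \<open>a labelling is undefined outside the nodes, so the comparison labels have to be restricted\<close>
    have "log_lik n X A (\<sigma> \<circ> zs) Qh = log_lik n X A (restrict (\<sigma> \<circ> zs) {1..n}) Qh" by (rule log_lik_cong) simp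
    also have "\<dots> \<le> log_lik n X A zh Qh" by (rule max[OF h(1)]) (simp add: label_funs_def)
    finally show ?thesis by (simp add: product_mean_axis[OF h(2)])
  qed
  ultimately have gain: "p * n * (\<Delta>\<^sup>2 * \<gamma> / 32) * miss \<sigma> ?\<tau> \<le> 0" by linarith
  have "0 < real n" using n e by (cases n) (auto simp: field_simps)
  then have "0 < p * n * (\<Delta>\<^sup>2 * \<gamma> / 32)" using p \<Delta> \<gamma> by simp
  moreover have "p * n * (\<Delta>\<^sup>2 * \<gamma> / 32) * miss \<sigma> ?\<tau> \<le> p * n * (\<Delta>\<^sup>2 * \<gamma> / 32) * 0" using gain by simp
  ultimately have "miss \<sigma> ?\<tau> \<le> 0" by (rule mult_left_le_imp_le[rotated])
  moreover have nonneg: "0 \<le> 1 - ?\<tau> i $ \<sigma> (zs i)" for i by (simp add: axis_def)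
  ultimately have "zh i = \<sigma> (zs i)" if "i \<in> {1..n}" for i
    using member_le_sum[of i "{1..n}" "\<lambda>i. 1 - ?\<tau> i $ \<sigma> (zs i)"] that
    by (auto simp: miss_def axis_def split: if_splits)
  with \<sigma>(1) show thesis by (rule that)
qed

text \<open>
  The estimator is compared with two point masses. Against the truth \<open>(zs, \<alpha>s, Qs)\<close> it shows that \<open>\<tau>\<close> is almost optimal,
  because prior terms cost only \<open>n * ln (1 / c)\<close>. Against \<open>(\<sigma> \<circ> zs, \<alpha>, Q)\<close>, with its own \<open>\<alpha>\<close> and \<open>Q\<close>, it shows that the
  gain in likelihood is at most the gain in entropy. Half of the likelihood gain is put into the weights of Gibbs'
  inequality, whose total mass is then barely above one; the other half bounds the misplaced mass.
\<close>

lemma variational_exact_recovery: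
  defines "e \<equiv> fit_tolerance CARD('k) l u \<gamma> \<Delta>"
  assumes est: "is_variational_est \<A> \<Q> n X A \<alpha> Q \<tau>" and zv: "is_var_labels n \<tau> zv"
    and \<Q>: "\<And>Q. Q \<in> \<Q> \<Longrightarrow> candidate Q" "Qs \<in> \<Q>"
    and \<A>: "\<A> \<subseteq> prob_simplex" "\<alpha>s \<in> \<A>" "\<And>\<alpha> a. \<alpha> \<in> \<A> \<Longrightarrow> c \<le> \<alpha> $ a" and c: "0 < c"
    and \<gamma>1: "\<gamma> \<le> 1" and \<Delta>1: "\<Delta> \<le> 1"
    and M_small: "64 * real CARD('k)^2 * (log_bound + 1) * M \<le> e * p * n" and n: "4 / e \<le> n"
    and prior_small: "- 16 * ln c \<le> e * p * n"
    and tail: "(1 + exp (- (p * n * (\<Delta>\<^sup>2 * \<gamma> / 64))) / c) ^ n - 1 < p * n * (\<Delta>\<^sup>2 * \<gamma> / 64) / 2"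
  obtains \<sigma> where "bij \<sigma>" "\<And>i. i \<in> {1..n} \<Longrightarrow> zv i = \<sigma> (zs i)"
proof -
  define \<kappa> where "\<kappa> = p * n * (\<Delta>\<^sup>2 * \<gamma> / 64)"
  have h: "\<alpha> \<in> \<A>" "Q \<in> \<Q>" and \<tau>: "\<tau> \<in> var_params n"
    and max: "\<And>\<alpha>' Q' \<tau>'. \<alpha>' \<in> \<A> \<Longrightarrow> Q' \<in> \<Q> \<Longrightarrow> \<tau>' \<in> var_params n \<Longrightarrow>
      var_objective n X A \<tau>' \<alpha>' Q' \<le> var_objective n X A \<tau> \<alpha> Q"
    using est by (auto simp: is_variational_est_def is_arg_max_linorder)
  have pos: "0 < \<alpha>' $ a" if "\<alpha>' \<in> \<A>" for \<alpha>' a using \<A>(3)[OF that, of a] c by linarith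
  have \<alpha>: "\<alpha> \<in> prob_simplex" using h(1) \<A>(1) by blast
  let ?PM = "product_mean n \<tau> (\<lambda>z. log_lik n X A z Q)"
  have "c ^ n = (\<Prod>i\<in>{1..n}. c)" by simp
  also have "\<dots> \<le> prior n \<alpha>s zs"
    unfolding prior_def using \<A>(3)[OF \<A>(2)] c by (intro prod_mono) auto
  finally have "ln (c ^ n) \<le> ln (prior n \<alpha>s zs)"
    using c order.strict_trans2[of 0 "c ^ n" "prior n \<alpha>s zs"] by (simp add: ln_le_cancel_iff)
  then have "n * ln c \<le> ln (prior n \<alpha>s zs)" using c by (simp add: ln_realpow)
  moreover have "- (n * ln c) \<le> e * p * n\<^sup>2 / 16"
    using mult_left_mono[OF prior_small, of "real n"] by (simp add: power2_eq_square algebra_simps)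
  ultimately have "log_lik n X A zs Qs - e * p * n\<^sup>2 / 16 \<le> var_objective n X A (\<lambda>i. axis (zs i) 1) \<alpha>s Qs"
    using var_objective_axis[OF pos[OF \<A>(2)] labels, of X A Qs] by linarith
  also have "\<dots> \<le> var_objective n X A \<tau> \<alpha> Q" by (rule max[OF \<A>(2) \<Q>(2) axis_var_params])
  also have "\<dots> \<le> ?PM" by (rule var_objective_le[OF pos[OF h(1)] \<alpha> \<tau>])
  finally obtain \<sigma> where \<sigma>: "bij \<sigma>"
    "p * n * (\<Delta>\<^sup>2 * \<gamma> / 32) * miss \<sigma> \<tau> \<le> log_lik n X A (\<sigma> \<circ> zs) Q - ?PM"
    using recovery_margin[OF \<Q>(1)[OF h(2)] \<tau> \<gamma>1 \<Delta>1 M_small[unfolded e_def] n[unfolded e_def], folded e_def] by blast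
  define z0 where "z0 = restrict (\<sigma> \<circ> zs) {1..n}"
  have z0: "z0 \<in> label_funs n" by (simp add: z0_def label_funs_def)
  have ll0: "log_lik n X A (\<sigma> \<circ> zs) Q = log_lik n X A z0 Q" by (rule log_lik_cong) (simp add: z0_def)
  define P where "P = (\<Sum>z\<in>label_funs n. prod_distr n \<tau> z * ln (prior n \<alpha> z / prod_distr n \<tau> z))"
  \<comment> \<open>prior relative to the comparison labels, damped by half of the likelihood gain\<close>
  define w where "w z = prior n \<alpha> z / prior n \<alpha> z0 * exp (- \<kappa> * hamming n (\<sigma> \<circ> zs) z)" for z
  have prior_pos: "0 < prior n \<alpha> z" for z using pos[OF h(1)] by (auto simp: prior_def intro!: prod_pos)
  have w_pos: "0 < w z" for z using prior_pos by (simp add: w_def)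
  have "var_objective n X A (\<lambda>i. axis (z0 i) 1) \<alpha> Q \<le> var_objective n X A \<tau> \<alpha> Q"
    by (rule max[OF h axis_var_params])
  then have "log_lik n X A z0 Q + ln (prior n \<alpha> z0) \<le> ?PM + P"
    by (simp add: var_objective_axis[OF pos[OF h(1)] z0] var_objective_eq[OF pos[OF h(1)] \<tau>] P_def)
  then have "2 * \<kappa> * miss \<sigma> \<tau> \<le> P - ln (prior n \<alpha> z0)"
  proof -
    have "p * n * (\<Delta>\<^sup>2 * \<gamma> / 32) * miss \<sigma> \<tau> = 2 * \<kappa> * miss \<sigma> \<tau>" by (simp add: \<kappa>_def)
    with \<open>_ \<le> ?PM + P\<close> show ?thesis using \<sigma>(2) ll0 by linarith
  qed
  moreover have "P - ln (prior n \<alpha> z0) - \<kappa> * miss \<sigma> \<tau> = (\<Sum>z\<in>label_funs n. prod_distr n \<tau> z * ln (w z / prod_distr n \<tau> z))"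
  proof -
    have "prod_distr n \<tau> z * ln (w z / prod_distr n \<tau> z) = prod_distr n \<tau> z * ln (prior n \<alpha> z / prod_distr n \<tau> z)
        - prod_distr n \<tau> z * ln (prior n \<alpha> z0) - \<kappa> * (prod_distr n \<tau> z * hamming n (\<sigma> \<circ> zs) z)" for z
    proof (cases "prod_distr n \<tau> z = 0")
      case False
      then have "0 < prod_distr n \<tau> z" using prod_distr_nonneg[OF \<tau>, of z] by simp
      then show ?thesis using prior_pos[of z] prior_pos[of z0] by (simp add: w_def ln_div ln_mult algebra_simps)
    qed simp
    then show ?thesis
      using product_mean_hamming[OF \<tau>, of \<sigma>]
      by (simp add: P_def sum_subtractf prod_distr_sum[OF \<tau>] product_mean_def flip: sum_distrib_right sum_distrib_left)
  qed
  ultimately have "\<kappa> * miss \<sigma> \<tau> \<le> (\<Sum>z\<in>label_funs n. prod_distr n \<tau> z * ln (w z / prod_distr n \<tau> z))" by linarith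
  also have "\<dots> \<le> (\<Sum>z\<in>label_funs n. w z) - 1"
    by (intro gibbs_inequality finite_label_funs prod_distr_nonneg \<tau> prod_distr_sum w_pos)
  also have "(\<Sum>z\<in>label_funs n. w z) \<le> (1 + exp (- \<kappa>) / c) ^ n"
  proof -
    have "w z = (\<Prod>i\<in>{1..n}. \<alpha> $ z i / \<alpha> $ z0 i * (if z i = z0 i then 1 else exp (- \<kappa>)))" for z
    proof -
      have "exp (- \<kappa> * hamming n (\<sigma> \<circ> zs) z) = (\<Prod>i\<in>{i \<in> {1..n}. (\<sigma> \<circ> zs) i \<noteq> z i}. exp (- \<kappa>))"
        by (simp add: hamming_def exp_of_nat_mult[symmetric] mult.commute)
      also have "\<dots> = (\<Prod>i\<in>{1..n}. if z i = z0 i then 1 else exp (- \<kappa>))"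
        by (subst prod.inter_filter) (auto simp: z0_def intro!: prod.cong)
      finally show ?thesis by (simp add: w_def prior_def prod.distrib prod_dividef)
    qed
    then have "(\<Sum>z\<in>label_funs n. w z) = (\<Prod>i\<in>{1..n}. \<Sum>a\<in>UNIV. \<alpha> $ a / \<alpha> $ z0 i * (if a = z0 i then 1 else exp (- \<kappa>)))"
      by (simp only: sum_label_funs_prod[where g = "\<lambda>i a. \<alpha> $ a / \<alpha> $ z0 i * (if a = z0 i then 1 else exp (- \<kappa>))"])
    also have "\<dots> \<le> (\<Prod>i\<in>{1..n}. 1 + exp (- \<kappa>) / c)"
    proof (intro prod_mono conjI sum_nonneg)
      fix i assume "i \<in> {1..n}"
      have "(\<Sum>a\<in>UNIV. \<alpha> $ a / \<alpha> $ z0 i * (if a = z0 i then 1 else exp (- \<kappa>)))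
          \<le> (\<Sum>a\<in>UNIV. of_bool (a = z0 i) + \<alpha> $ a * (exp (- \<kappa>) / c))"
      proof (intro sum_mono)
        fix a
        have "1 / \<alpha> $ z0 i \<le> 1 / c" using \<A>(3)[OF h(1)] c by (intro frac_le) auto
        then have "\<alpha> $ a * exp (- \<kappa>) * (1 / \<alpha> $ z0 i) \<le> \<alpha> $ a * exp (- \<kappa>) * (1 / c)"
          using pos[OF h(1), of a] by (intro mult_left_mono) auto
        then show "\<alpha> $ a / \<alpha> $ z0 i * (if a = z0 i then 1 else exp (- \<kappa>)) \<le> of_bool (a = z0 i) + \<alpha> $ a * (exp (- \<kappa>) / c)"
          using pos[OF h(1), of a] c by (cases "a = z0 i") auto
      qed
      also have "\<dots> = 1 + exp (- \<kappa>) / c"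
        using \<alpha> by (simp add: sum.distrib prob_simplex_def flip: sum_distrib_right sum_divide_distrib)
      finally show "(\<Sum>a\<in>UNIV. \<alpha> $ a / \<alpha> $ z0 i * (if a = z0 i then 1 else exp (- \<kappa>))) \<le> 1 + exp (- \<kappa>) / c" .
    qed (use pos[OF h(1)] in \<open>auto simp: less_imp_le\<close>)
    finally show ?thesis by simp
  qed
  finally have "\<kappa> * miss \<sigma> \<tau> < \<kappa> * (1 / 2)" using tail unfolding \<kappa>_def[symmetric] by linarith
  moreover have "0 \<le> \<kappa>" using p \<Delta> \<gamma> by (simp add: \<kappa>_def)
  ultimately have miss: "miss \<sigma> \<tau> < 1 / 2" by (rule mult_left_less_imp_less)
  have "zv i = \<sigma> (zs i)" if i: "i \<in> {1..n}" for i
  proof (rule ccontr)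
    assume ne: "zv i \<noteq> \<sigma> (zs i)"
    have "1 - \<tau> i $ \<sigma> (zs i) \<le> miss \<sigma> \<tau>"
      unfolding miss_def using i var_params_le_1[OF \<tau>]
      by (intro member_le_sum[of i "{1..n}" "\<lambda>i. 1 - \<tau> i $ \<sigma> (zs i)"]) auto
    then have "1 / 2 < \<tau> i $ \<sigma> (zs i)" using miss by linarith
    moreover have "\<tau> i $ \<sigma> (zs i) \<le> \<tau> i $ zv i"
      using zv i by (auto simp: is_var_labels_def is_arg_max_linorder)
    moreover have "\<tau> i $ \<sigma> (zs i) + \<tau> i $ zv i \<le> 1"
      using sum_mono2[of UNIV "{\<sigma> (zs i), zv i}" "\<lambda>a. \<tau> i $ a"] ne i
        var_params_nonneg[OF \<tau> i] var_params_sum[OF \<tau> i] by simp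
    ultimately show False by linarith
  qed
  with \<sigma>(1) show thesis by (rule that)
qed

end

section \<open>Concentration of the noise\<close>

lemma exp_le_quadratic:
  fixes x :: real
  assumes "\<bar>x\<bar> \<le> 1"
  shows "exp x \<le> 1 + x + x\<^sup>2"
proof (cases "0 \<le> x")
  case True
  then show ?thesis using exp_bound[of x] assms by simp
next
  case False
  have "exp x * (1 - x) \<le> exp x * exp (- x)"
    using exp_ge_add_one_self[of "- x"] by (intro mult_left_mono) auto
  also have "\<dots> = 1" by (simp add: exp_minus)
  also have "1 \<le> (1 + x + x\<^sup>2) * (1 - x)"
  proof -
    have "(1 + x + x\<^sup>2) * (1 - x) = 1 - x ^ 3" by (simp add: algebra_simps power2_eq_square power3_eq_cube)
    moreover have "x ^ 3 \<le> 0" using False by (simp add: power_le_zero_eq)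
    ultimately show ?thesis by simp
  qed
  finally show ?thesis using False by (simp add: mult_le_cancel_right)
qed

lemma prob_exp_markov:
  fixes f :: "'a \<Rightarrow> real"
  assumes "(\<integral>\<^sup>+\<omega>. ennreal (exp (f \<omega>)) \<partial>measure_pmf D) \<le> ennreal B" and "0 \<le> B"
  shows "measure_pmf.prob D {\<omega>. s \<le> f \<omega>} \<le> exp (- s) * B"
proof -
  have "emeasure D {\<omega>. s \<le> f \<omega>} = (\<integral>\<^sup>+\<omega>. indicator {\<omega>. s \<le> f \<omega>} \<omega> \<partial>measure_pmf D)" by simp
  also have "\<dots> \<le> (\<integral>\<^sup>+\<omega>. ennreal (exp (- s)) * ennreal (exp (f \<omega>)) \<partial>measure_pmf D)"
  proof (intro nn_integral_mono)
    fix \<omega>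
    show "indicator {\<omega>. s \<le> f \<omega>} \<omega> \<le> ennreal (exp (- s)) * ennreal (exp (f \<omega>))"
      by (auto simp: indicator_def ennreal_mult[symmetric] mult_exp_exp simp flip: ennreal_1)
  qed
  also have "\<dots> = ennreal (exp (- s)) * (\<integral>\<^sup>+\<omega>. ennreal (exp (f \<omega>)) \<partial>measure_pmf D)"
    by (rule nn_integral_cmult) simp
  also have "\<dots> \<le> ennreal (exp (- s)) * ennreal B" by (intro mult_left_mono assms) simp
  finally have "emeasure D {\<omega>. s \<le> f \<omega>} \<le> ennreal (exp (- s) * B)" by (simp add: ennreal_mult assms)
  then show ?thesis using assms(2) by (simp add: measure_pmf.emeasure_eq_measure)
qed

text \<open>
  Centred products of independent Bernoulli variables: \<open>B i\<close> is the edge, \<open>S i\<close> its sampling indicator.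
\<close>

definition thinned_noise :: "real \<Rightarrow> ('i \<Rightarrow> real) \<Rightarrow> bool \<Rightarrow> 'i \<Rightarrow> ('i \<Rightarrow> bool) \<times> ('i \<Rightarrow> bool) \<Rightarrow> real" where
  "thinned_noise p P r i = (\<lambda>(B, S). of_bool (S i \<and> B i = r) - p * (if r then P i else 1 - P i))"

definition thinned_pmf :: "'i set \<Rightarrow> real \<Rightarrow> ('i \<Rightarrow> real) \<Rightarrow> (('i \<Rightarrow> bool) \<times> ('i \<Rightarrow> bool)) pmf" where
  "thinned_pmf I p P = pair_pmf (Pi_pmf I False (\<lambda>i. bernoulli_pmf (P i))) (Pi_pmf I False (\<lambda>_. bernoulli_pmf p))"

text \<open>
  The variance of the thinned variable is at most \<open>p\<close>, whatever the edge probability; this factor \<open>p\<close> in the exponent is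
  what makes sparse sampling tractable.
\<close>

lemma thinned_bernoulli_mgf:
  assumes P: "P \<in> {0..1}" and p: "p \<in> {0..1}" and x: "\<bar>x\<bar> \<le> 1"
  shows "(\<integral>\<^sup>+b. \<integral>\<^sup>+s. ennreal (exp (x * (of_bool (s \<and> b = r) - p * (if r then P else 1 - P)))) \<partial>bernoulli_pmf p \<partial>bernoulli_pmf P)
    \<le> ennreal (exp (x\<^sup>2 * p))"
proof -
  define t where "t = (if r then P else 1 - P)"
  have t: "t \<in> {0..1}" using P by (auto simp: t_def)
  have "(\<integral>\<^sup>+b. \<integral>\<^sup>+s. ennreal (exp (x * (of_bool (s \<and> b = r) - p * t))) \<partial>bernoulli_pmf p \<partial>bernoulli_pmf P)
     = ennreal (exp (- x * (p * t)) * (1 + p * t * (exp x - 1)))"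
  proof -
    define f where "f b s = exp (x * (of_bool (s \<and> b = r) - p * t))" for b s
    have "(\<integral>\<^sup>+b. \<integral>\<^sup>+s. ennreal (f b s) \<partial>bernoulli_pmf p \<partial>bernoulli_pmf P)
      = ennreal ((f True True * p + f True False * (1 - p)) * P + (f False True * p + f False False * (1 - p)) * (1 - P))"
      using P p by (simp add: f_def ennreal_plus[symmetric] ennreal_mult[symmetric] del: ennreal_plus)
    moreover have "exp (x * (1 - p * t)) = exp x * exp (- x * (p * t))" by (simp add: exp_add[symmetric] algebra_simps)
    then have "(f True True * p + f True False * (1 - p)) * P + (f False True * p + f False False * (1 - p)) * (1 - P)
      = exp (- x * (p * t)) * (1 + p * t * (exp x - 1))"
      by (cases r) (simp_all add: f_def, simp_all add: t_def algebra_simps)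
    ultimately show ?thesis by (simp only: f_def)
  qed
  also have "exp (- x * (p * t)) * (1 + p * t * (exp x - 1)) \<le> exp (- x * (p * t)) * exp (p * t * (exp x - 1))"
    by (intro mult_left_mono exp_ge_add_one_self) auto
  also have "\<dots> = exp (p * t * (exp x - 1 - x))" by (simp add: exp_add[symmetric] algebra_simps)
  also have "\<dots> \<le> exp (x\<^sup>2 * p)"
  proof -
    have "0 \<le> exp x - 1 - x" "exp x - 1 - x \<le> x\<^sup>2"
      using exp_le_quadratic[OF x] exp_ge_add_one_self[of x] by linarith+
    then have "p * t * (exp x - 1 - x) \<le> p * 1 * x\<^sup>2"
      using p t by (intro mult_mono mult_left_mono) auto
    then show ?thesis by (simp add: mult.commute)
  qed
  finally show ?thesis by (simp add: t_def ennreal_leI)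
qed

lemma thinned_noise_mgf:
  fixes I :: "'i set"
  assumes "finite I" and P: "\<And>i. i \<in> I \<Longrightarrow> P i \<in> {0..1}" and p: "p \<in> {0..1}"
    and c: "\<And>i. i \<in> I \<Longrightarrow> \<bar>c i\<bar> \<le> 1"
  shows "(\<integral>\<^sup>+\<omega>. ennreal (exp (\<Sum>i\<in>I. c i * thinned_noise p P r i \<omega>)) \<partial>thinned_pmf I p P) \<le> ennreal (exp (p * (\<Sum>i\<in>I. (c i)\<^sup>2)))"
proof -
  let ?E = "\<lambda>i b s. ennreal (exp (c i * (of_bool (s \<and> b = r) - p * (if r then P i else 1 - P i))))"
  have "(\<integral>\<^sup>+\<omega>. ennreal (exp (\<Sum>i\<in>I. c i * thinned_noise p P r i \<omega>)) \<partial>thinned_pmf I p P)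
      = (\<integral>\<^sup>+B. \<integral>\<^sup>+S. (\<Prod>i\<in>I. ?E i (B i) (S i)) \<partial>Pi_pmf I False (\<lambda>_. bernoulli_pmf p) \<partial>Pi_pmf I False (\<lambda>i. bernoulli_pmf (P i)))"
    using assms(1) by (simp add: thinned_pmf_def nn_integral_pair_pmf' thinned_noise_def exp_sum prod_ennreal)
  also have "\<dots> = (\<Prod>i\<in>I. \<integral>\<^sup>+b. \<integral>\<^sup>+s. ?E i b s \<partial>bernoulli_pmf p \<partial>bernoulli_pmf (P i))"
  proof -
    have "(\<integral>\<^sup>+S. (\<Prod>i\<in>I. ?E i (B i) (S i)) \<partial>Pi_pmf I False (\<lambda>_. bernoulli_pmf p))
        = (\<Prod>i\<in>I. \<integral>\<^sup>+s. ?E i (B i) s \<partial>bernoulli_pmf p)" for B :: "'i \<Rightarrow> bool"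
      by (rule nn_integral_prod_Pi_pmf[OF assms(1), where f = "\<lambda>i s. ?E i (B i) s"])
    moreover have "(\<integral>\<^sup>+B. (\<Prod>i\<in>I. \<integral>\<^sup>+s. ?E i (B i) s \<partial>bernoulli_pmf p) \<partial>Pi_pmf I False (\<lambda>i. bernoulli_pmf (P i)))
        = (\<Prod>i\<in>I. \<integral>\<^sup>+b. \<integral>\<^sup>+s. ?E i b s \<partial>bernoulli_pmf p \<partial>bernoulli_pmf (P i))"
      by (rule nn_integral_prod_Pi_pmf[OF assms(1), where f = "\<lambda>i b. \<integral>\<^sup>+s. ?E i b s \<partial>bernoulli_pmf p"])
    ultimately show ?thesis by presburger
  qed
  also have "\<dots> \<le> (\<Prod>i\<in>I. ennreal (exp ((c i)\<^sup>2 * p)))"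
    by (intro prod_mono_ennreal thinned_bernoulli_mgf P p c)
  also have "\<dots> = ennreal (exp (p * (\<Sum>i\<in>I. (c i)\<^sup>2)))"
    using assms(1) by (simp add: prod_ennreal exp_sum[symmetric] sum_distrib_left mult.commute)
  finally show ?thesis .
qed

text \<open>
  Chernoff's bound with exponential weight \<open>\<epsilon> / 2\<close>, applied to both signs.
\<close>

lemma thinned_noise_tail:
  assumes "finite I" and P: "\<And>i. i \<in> I \<Longrightarrow> P i \<in> {0..1}" and p: "p \<in> {0..1}"
    and c: "\<And>i. i \<in> I \<Longrightarrow> \<bar>c i\<bar> \<le> 1" "(\<Sum>i\<in>I. (c i)\<^sup>2) \<le> m" and \<epsilon>: "0 \<le> \<epsilon>" "\<epsilon> \<le> 1"
  shows "measure_pmf.prob (thinned_pmf I p P) {\<omega>. \<epsilon> * p * m < \<bar>\<Sum>i\<in>I. c i * thinned_noise p P r i \<omega>\<bar>}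
    \<le> 2 * exp (- (\<epsilon>\<^sup>2 * p * m / 4))"
proof -
  let ?D = "thinned_pmf I p P" and ?f = "\<lambda>\<omega>. \<Sum>i\<in>I. c i * thinned_noise p P r i \<omega>"
  have one_sided: "measure_pmf.prob ?D {\<omega>. \<epsilon> * p * m * (\<epsilon> / 2) \<le> (\<Sum>i\<in>I. (x * c i) * thinned_noise p P r i \<omega>)} \<le> exp (- (\<epsilon>\<^sup>2 * p * m / 4))"
    if x: "\<bar>x\<bar> = \<epsilon> / 2" for x
  proof -
    have "\<bar>x\<bar> * \<bar>c i\<bar> \<le> 1 * 1" if "i \<in> I" for i using x \<epsilon> c(1)[OF that] by (intro mult_mono) auto
    then have "(\<integral>\<^sup>+\<omega>. ennreal (exp (\<Sum>i\<in>I. (x * c i) * thinned_noise p P r i \<omega>)) \<partial>?D) \<le> ennreal (exp (p * (\<Sum>i\<in>I. (x * c i)\<^sup>2)))"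
      by (intro thinned_noise_mgf assms(1) P p) (auto simp: abs_mult)
    also have "p * (\<Sum>i\<in>I. (x * c i)\<^sup>2) \<le> p * (\<epsilon>\<^sup>2 / 4 * m)"
    proof -
      have "x\<^sup>2 = (\<epsilon> / 2)\<^sup>2" using x by (metis power2_abs)
      then have "x\<^sup>2 = \<epsilon>\<^sup>2 / 4" by (simp add: power_divide)
      then have "(\<Sum>i\<in>I. (x * c i)\<^sup>2) = \<epsilon>\<^sup>2 / 4 * (\<Sum>i\<in>I. (c i)\<^sup>2)" by (simp only: power_mult_distrib sum_distrib_left)
      also have "\<dots> \<le> \<epsilon>\<^sup>2 / 4 * m" by (intro mult_left_mono c) auto
      finally show ?thesis using p by (intro mult_left_mono) auto
    qed
    finally have "measure_pmf.prob ?D {\<omega>. \<epsilon> * p * m * (\<epsilon> / 2) \<le> (\<Sum>i\<in>I. (x * c i) * thinned_noise p P r i \<omega>)}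
        \<le> exp (- (\<epsilon> * p * m * (\<epsilon> / 2))) * exp (p * (\<epsilon>\<^sup>2 / 4 * m))"
      by (intro prob_exp_markov) (auto simp: ennreal_leI)
    also have "\<dots> = exp (- (\<epsilon>\<^sup>2 * p * m / 4))" by (simp add: exp_add[symmetric] power2_eq_square)
    finally show ?thesis .
  qed
  have "{\<omega>. \<epsilon> * p * m < \<bar>?f \<omega>\<bar>} \<subseteq> {\<omega>. \<epsilon> * p * m * (\<epsilon> / 2) \<le> (\<Sum>i\<in>I. (\<epsilon> / 2 * c i) * thinned_noise p P r i \<omega>)}
      \<union> {\<omega>. \<epsilon> * p * m * (\<epsilon> / 2) \<le> (\<Sum>i\<in>I. (- \<epsilon> / 2 * c i) * thinned_noise p P r i \<omega>)}"
  proof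
    fix \<omega> assume "\<omega> \<in> {\<omega>. \<epsilon> * p * m < \<bar>?f \<omega>\<bar>}"
    then have "\<epsilon> * p * m \<le> ?f \<omega> \<or> \<epsilon> * p * m \<le> - ?f \<omega>" by auto
    then have "\<epsilon> / 2 * (\<epsilon> * p * m) \<le> \<epsilon> / 2 * ?f \<omega> \<or> \<epsilon> / 2 * (\<epsilon> * p * m) \<le> \<epsilon> / 2 * (- ?f \<omega>)"
      using \<epsilon>(1) by (metis mult_left_mono divide_nonneg_nonneg zero_le_numeral)
    moreover have "(\<Sum>i\<in>I. (x * c i) * thinned_noise p P r i \<omega>) = x * ?f \<omega>" for x
      by (simp add: sum_distrib_left mult.assoc)
    ultimately show "\<omega> \<in> {\<omega>. \<epsilon> * p * m * (\<epsilon> / 2) \<le> (\<Sum>i\<in>I. (\<epsilon> / 2 * c i) * thinned_noise p P r i \<omega>)}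
      \<union> {\<omega>. \<epsilon> * p * m * (\<epsilon> / 2) \<le> (\<Sum>i\<in>I. (- \<epsilon> / 2 * c i) * thinned_noise p P r i \<omega>)}"
      by (simp only: Un_iff mem_Collect_eq) (simp add: mult.commute)
  qed
  then have "measure_pmf.prob ?D {\<omega>. \<epsilon> * p * m < \<bar>?f \<omega>\<bar>} \<le>
      measure_pmf.prob ?D {\<omega>. \<epsilon> * p * m * (\<epsilon> / 2) \<le> (\<Sum>i\<in>I. (\<epsilon> / 2 * c i) * thinned_noise p P r i \<omega>)}
      + measure_pmf.prob ?D {\<omega>. \<epsilon> * p * m * (\<epsilon> / 2) \<le> (\<Sum>i\<in>I. (- \<epsilon> / 2 * c i) * thinned_noise p P r i \<omega>)}"
    by (intro order_trans[OF measure_pmf.finite_measure_mono measure_Un_le]) auto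
  also have "\<dots> \<le> 2 * exp (- (\<epsilon>\<^sup>2 * p * m / 4))"
    using one_sided[of "\<epsilon> / 2"] one_sided[of "- \<epsilon> / 2"] \<epsilon> by simp
  finally show ?thesis .
qed

text \<open>
  The conditional law of \<open>(A, X)\<close> given the labels.
\<close>

definition graph_pmf :: "nat \<Rightarrow> real^'k^'k \<Rightarrow> real \<Rightarrow> (nat \<Rightarrow> 'k) \<Rightarrow> (nmat \<times> nmat) pmf" where
  "graph_pmf n Q p z = pair_pmf (sym_bernoulli_pmf n (theta Q z)) (sym_bernoulli_pmf n (\<lambda>_ _. p))"

lemma edge_noise_tail:
  fixes z :: "nat \<Rightarrow> 'k::finite"
  assumes Q: "\<And>a b. Q $ a $ b \<in> {0..1}" and p: "p \<in> {0..1}"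
    and c: "\<And>e. e \<in> upper_pairs n \<Longrightarrow> \<bar>c e\<bar> \<le> 1" "(\<Sum>e\<in>upper_pairs n. (c e)\<^sup>2) \<le> m" and \<epsilon>: "0 \<le> \<epsilon>" "\<epsilon> \<le> 1"
  shows "measure_pmf.prob (graph_pmf n Q p z) {(A, X). \<epsilon> * p * m < \<bar>\<Sum>e\<in>upper_pairs n. c e * edge_noise p Q z X A r e\<bar>}
    \<le> 2 * exp (- (\<epsilon>\<^sup>2 * p * m / 4))"
proof -
  define sym :: "(nat \<times> nat \<Rightarrow> bool) \<Rightarrow> nmat" where "sym = (\<lambda>B i j. of_bool (B (min i j, max i j)))"
  define P where "P = (\<lambda>(i, j). theta Q z i j)"
  let ?D = "thinned_pmf (upper_pairs n) p P"
  have graph: "graph_pmf n Q p z = map_pmf (\<lambda>(B, S). (sym B, sym S)) ?D"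
  proof -
    have "(\<lambda>(i, j). bernoulli_pmf (theta Q z i j)) = (\<lambda>e. bernoulli_pmf (P e))" "(\<lambda>(i, j). bernoulli_pmf p) = (\<lambda>_ :: nat \<times> nat. bernoulli_pmf p)"
      by (auto simp: P_def)
    then show ?thesis
      by (simp only: graph_pmf_def sym_bernoulli_pmf_def thinned_pmf_def map_pair sym_def)
  qed
  have noise: "edge_noise p Q z (sym S) (sym B) r e = thinned_noise p P r e (B, S)" if "e \<in> upper_pairs n" for e B S
    using that by (cases e) (auto simp: upper_pairs_def edge_noise_def edge_obs_def edge_mean_def thinned_noise_def
      sym_def P_def theta_def min_def max_def)
  have "measure_pmf.prob (graph_pmf n Q p z) {(A, X). \<epsilon> * p * m < \<bar>\<Sum>e\<in>upper_pairs n. c e * edge_noise p Q z X A r e\<bar>}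
     = measure_pmf.prob ?D {\<omega>. \<epsilon> * p * m < \<bar>\<Sum>e\<in>upper_pairs n. c e * thinned_noise p P r e \<omega>\<bar>}"
    unfolding graph measure_map_pmf
    by (rule arg_cong[where f = "measure_pmf.prob ?D"]) (auto simp: noise cong: sum.cong)
  also have "\<dots> \<le> 2 * exp (- (\<epsilon>\<^sup>2 * p * m / 4))"
    by (rule thinned_noise_tail) (use Q p c \<epsilon> in \<open>auto simp: finite_upper_pairs P_def theta_def\<close>)
  finally show ?thesis .
qed

lemma card_touching_pairs: "card {e \<in> upper_pairs n. fst e \<in> S \<or> snd e \<in> S} \<le> card S * n" if "S \<subseteq> {1..n}"
proof -
  have fin: "finite S" using that finite_subset by auto
  have "{e \<in> upper_pairs n. fst e \<in> S \<or> snd e \<in> S} \<subseteq> (\<lambda>(i, j). (min i j, max i j)) ` (S \<times> {1..n})"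
  proof
    fix e assume "e \<in> {e \<in> upper_pairs n. fst e \<in> S \<or> snd e \<in> S}"
    then obtain i j where e: "e = (i, j)" "1 \<le> i" "i < j" "j \<le> n" "i \<in> S \<or> j \<in> S" by (auto simp: upper_pairs_def)
    then have "e = (\<lambda>(i, j). (min i j, max i j)) (if i \<in> S then (i, j) else (j, i))" by auto
    moreover have "(if i \<in> S then (i, j) else (j, i)) \<in> S \<times> {1..n}" using e by auto
    ultimately show "e \<in> (\<lambda>(i, j). (min i j, max i j)) ` (S \<times> {1..n})" by (rule image_eqI)
  qed
  then have "card {e \<in> upper_pairs n. fst e \<in> S \<or> snd e \<in> S} \<le> card (S \<times> {1..n})"
    using fin by (meson surj_card_le finite_SigmaI finite_atLeastAtMost)
  then show ?thesis by (simp add: card_cartesian_product)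
qed

text \<open>
  The union bound over all labellings at once, instead of distance by distance: \<open>exp (- \<beta> * hamming n z0 z)\<close> is a
  product over the nodes, so the sum factorises. The labelling at distance zero contributes the \<open>1\<close> that is subtracted.
\<close>

lemma sum_exp_hamming:
  fixes \<beta> :: real and z0 :: "nat \<Rightarrow> 'k::finite"
  shows "(\<Sum>z\<in>{z \<in> label_funs n. 0 < hamming n z0 z}. exp (- \<beta> * hamming n z0 z)) \<le> (1 + CARD('k) * exp (- \<beta>)) ^ n - 1"
proof -
  have w: "exp (- \<beta> * hamming n z0 z) = (\<Prod>i\<in>{1..n}. if z i = z0 i then 1 else exp (- \<beta>))" for z :: "nat \<Rightarrow> 'k"
  proof -
    have "exp (- \<beta> * hamming n z0 z) = (\<Prod>i\<in>{i \<in> {1..n}. z0 i \<noteq> z i}. exp (- \<beta>))"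
      by (simp add: hamming_def exp_of_nat_mult[symmetric] mult.commute)
    also have "\<dots> = (\<Prod>i\<in>{1..n}. if z i = z0 i then 1 else exp (- \<beta>))"
      by (subst prod.inter_filter) (auto intro!: prod.cong)
    finally show ?thesis .
  qed
  let ?z = "restrict z0 {1..n}"
  have z: "?z \<in> label_funs n" "hamming n z0 ?z = 0" by (auto simp: label_funs_def hamming_def)
  have "{z \<in> label_funs n. 0 < hamming n z0 z} \<subseteq> label_funs n - {?z}" using z(2) by auto
  then have "(\<Sum>z\<in>{z \<in> label_funs n. 0 < hamming n z0 z}. exp (- \<beta> * hamming n z0 z))
      \<le> (\<Sum>z\<in>label_funs n - {?z}. exp (- \<beta> * hamming n z0 z))"
    by (intro sum_mono2) (auto simp: finite_label_funs)
  also have "\<dots> = (\<Sum>z\<in>label_funs n. exp (- \<beta> * hamming n z0 z)) - 1"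
    using sum.remove[OF finite_label_funs z(1), of "\<lambda>z. exp (- \<beta> * hamming n z0 z)"] z(2) by simp
  also have "(\<Sum>z\<in>label_funs n. exp (- \<beta> * hamming n z0 z)) = (\<Prod>i\<in>{1..n}. \<Sum>a\<in>UNIV. if a = z0 i then 1 else exp (- \<beta>))"
    unfolding w by (rule sum_label_funs_prod[where g = "\<lambda>i a. if a = z0 i then 1 else exp (- \<beta>)"])
  also have "\<dots> \<le> (\<Prod>i\<in>{1..n}. 1 + CARD('k) * exp (- \<beta>))"
  proof (intro prod_mono conjI sum_nonneg)
    fix i
    have "(\<Sum>a\<in>UNIV. if a = z0 i then 1 else exp (- \<beta>)) \<le> (\<Sum>a\<in>UNIV. of_bool (a = z0 i) + exp (- \<beta>))"
      by (intro sum_mono) auto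
    then show "(\<Sum>a\<in>UNIV. if a = z0 i then 1 else exp (- \<beta>)) \<le> 1 + CARD('k) * exp (- \<beta>)"
      by (simp add: sum.distrib)
  qed auto
  finally show ?thesis by simp
qed

text \<open>
  Two labellings at Hamming distance \<open>s\<close> have block indicators that differ on at most \<open>n * s\<close> pairs, so the tail
  bound applies with \<open>m = n * s\<close>; at distance zero the difference vanishes.
\<close>

lemma low_noise_prob:
  fixes zs :: "nat \<Rightarrow> 'k::finite"
  assumes Q: "\<And>a b. Q $ a $ b \<in> {0..1}" and p: "p \<in> {0..1}" and \<epsilon>: "0 \<le> \<epsilon>" "\<epsilon> \<le> 1"
  shows "measure_pmf.prob (graph_pmf n Q p zs) {(A, X). \<not> low_noise n (\<epsilon> * p * n) zs (edge_noise p Q zs X A)}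
    \<le> 4 * real CARD('k \<Rightarrow> 'k) * (real CARD('k))\<^sup>2 * ((1 + CARD('k) * exp (- (\<epsilon>\<^sup>2 * p * n / 4))) ^ n - 1)"
proof -
  define c where "c \<rho> z a b e = block_ind (\<rho> \<circ> zs) a b e - block_ind z a b e" for \<rho> :: "'k \<Rightarrow> 'k" and z a b e
  define ham where "ham \<rho> z = hamming n (\<rho> \<circ> zs) z" for \<rho> :: "'k \<Rightarrow> 'k" and z
  define T where "T \<rho> = {z \<in> label_funs n. 0 < ham \<rho> z}" for \<rho>
  define bad where "bad \<rho> z a b r = {(A, X). \<epsilon> * p * (n * ham \<rho> z) < \<bar>\<Sum>e\<in>upper_pairs n. c \<rho> z a b e * edge_noise p Q zs X A r e\<bar>}" for \<rho> z a b r
  let ?\<mu> = "graph_pmf n Q p zs"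
  have c_abs: "\<bar>c \<rho> z a b e\<bar> \<le> 1" for \<rho> z a b e by (auto simp: c_def block_ind_def split: prod.splits)
  have c_sq: "(\<Sum>e\<in>upper_pairs n. (c \<rho> z a b e)\<^sup>2) \<le> n * ham \<rho> z" for \<rho> z a b
  proof -
    let ?S = "{i \<in> {1..n}. (\<rho> \<circ> zs) i \<noteq> z i}"
    have "(\<Sum>e\<in>upper_pairs n. (c \<rho> z a b e)\<^sup>2) \<le> (\<Sum>e\<in>upper_pairs n. if fst e \<in> ?S \<or> snd e \<in> ?S then 1 else 0)"
    proof (intro sum_mono)
      fix e assume "e \<in> upper_pairs n"
      then show "(c \<rho> z a b e)\<^sup>2 \<le> (if fst e \<in> ?S \<or> snd e \<in> ?S then 1 else 0)"
        using abs_square_le_1[of "c \<rho> z a b e"] c_abs[of \<rho> z a b e]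
        by (cases e) (auto simp: c_def block_ind_def upper_pairs_def)
    qed
    also have "\<dots> = card {e \<in> upper_pairs n. fst e \<in> ?S \<or> snd e \<in> ?S}"
      by (subst sum.inter_filter[symmetric]) (auto simp: finite_upper_pairs)
    also have "\<dots> \<le> real (card ?S * n)" by (intro of_nat_mono card_touching_pairs) auto
    finally show ?thesis by (simp add: ham_def hamming_def mult.commute)
  qed
  have ham0: "\<bar>\<Sum>e\<in>upper_pairs n. c \<rho> z a b e * N e\<bar> \<le> 0" if "ham \<rho> z = 0" for \<rho> z a b and N :: "nat \<times> nat \<Rightarrow> real"
  proof -
    have "{e \<in> upper_pairs n. c \<rho> z a b e \<noteq> 0} = {}"
    proof -
      have "(\<Sum>e\<in>upper_pairs n. (c \<rho> z a b e)\<^sup>2) = 0"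
        using c_sq[of \<rho> z a b] that by (simp add: sum_nonneg order_antisym)
      then show ?thesis by (simp add: sum_nonneg_eq_0_iff finite_upper_pairs)
    qed
    then show ?thesis by (auto intro!: sum.neutral)
  qed
  have "{(A, X). \<not> low_noise n (\<epsilon> * p * n) zs (edge_noise p Q zs X A)}
      \<subseteq> (\<Union>\<rho>. \<Union>z\<in>T \<rho>. \<Union>a. \<Union>b. \<Union>r. bad \<rho> z a b r)"
  proof safe
    fix A X assume "\<not> low_noise n (\<epsilon> * p * n) zs (edge_noise p Q zs X A)"
    then obtain \<rho> a b r z where *: "z \<in> label_funs n"
      "\<epsilon> * p * n * ham \<rho> z < \<bar>\<Sum>e\<in>upper_pairs n. c \<rho> z a b e * edge_noise p Q zs X A r e\<bar>"
      unfolding low_noise_def c_def ham_def not_le[symmetric] by blast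
    then have "z \<in> T \<rho>" using ham0[of \<rho> z a b "edge_noise p Q zs X A r"] by (auto simp: T_def intro!: gr0I)
    moreover have "(A, X) \<in> bad \<rho> z a b r" using * by (simp add: bad_def mult.assoc)
    ultimately show "(A, X) \<in> (\<Union>\<rho>. \<Union>z\<in>T \<rho>. \<Union>a. \<Union>b. \<Union>r. bad \<rho> z a b r)" by blast
  qed
  then have "measure_pmf.prob ?\<mu> {(A, X). \<not> low_noise n (\<epsilon> * p * n) zs (edge_noise p Q zs X A)}
      \<le> measure_pmf.prob ?\<mu> (\<Union>\<rho>. \<Union>z\<in>T \<rho>. \<Union>a. \<Union>b. \<Union>r. bad \<rho> z a b r)"
    by (intro measure_pmf.finite_measure_mono) auto
  also have "\<dots> \<le> (\<Sum>\<rho>\<in>UNIV. \<Sum>z\<in>T \<rho>. \<Sum>a\<in>UNIV. \<Sum>b\<in>UNIV. \<Sum>r\<in>UNIV. measure_pmf.prob ?\<mu> (bad \<rho> z a b r))"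
    by (intro order_trans[OF measure_pmf.finite_measure_subadditive_finite] sum_mono order_refl)
      (auto simp: T_def finite_label_funs)
  also have "\<dots> \<le> (\<Sum>\<rho>\<in>(UNIV::('k \<Rightarrow> 'k) set). \<Sum>z\<in>T \<rho>. \<Sum>a\<in>(UNIV::'k set). \<Sum>b\<in>(UNIV::'k set). \<Sum>r\<in>(UNIV::bool set).
      2 * exp (- (\<epsilon>\<^sup>2 * p * (n * ham \<rho> z) / 4)))"
    unfolding bad_def by (intro sum_mono edge_noise_tail Q p \<epsilon> c_sq c_abs)
  also have "\<dots> = 4 * (real CARD('k))\<^sup>2 * (\<Sum>\<rho>\<in>(UNIV::('k \<Rightarrow> 'k) set). \<Sum>z\<in>T \<rho>. exp (- (\<epsilon>\<^sup>2 * p * n / 4) * ham \<rho> z))"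
    by (simp add: sum_distrib_left power2_eq_square mult_ac)
  also have "\<dots> \<le> 4 * (real CARD('k))\<^sup>2 * (\<Sum>\<rho>\<in>(UNIV::('k \<Rightarrow> 'k) set). (1 + CARD('k) * exp (- (\<epsilon>\<^sup>2 * p * n / 4))) ^ n - 1)"
  proof (intro mult_left_mono sum_mono)
    show "(\<Sum>z\<in>T \<rho>. exp (- (\<epsilon>\<^sup>2 * p * n / 4) * ham \<rho> z)) \<le> (1 + CARD('k) * exp (- (\<epsilon>\<^sup>2 * p * n / 4))) ^ n - 1" for \<rho>
      unfolding T_def ham_def by (rule sum_exp_hamming)
  qed simp
  finally show ?thesis by (simp add: mult_ac)
qed

text \<open>
  For the true labels alone no union bound over labellings is needed. Here \<open>\<epsilon>\<close> may therefore tend to zero with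
  \<open>n\<close>, which gives the rate of the block frequencies.
\<close>

lemma block_noise_prob:
  fixes zs :: "nat \<Rightarrow> 'k::finite"
  assumes Q: "\<And>a b. Q $ a $ b \<in> {0..1}" and p: "p \<in> {0..1}" and \<epsilon>: "0 \<le> \<epsilon>" "\<epsilon> \<le> 1"
  shows "measure_pmf.prob (graph_pmf n Q p zs)
      {(A, X). \<exists>a b r. \<epsilon> * p * n\<^sup>2 < \<bar>\<Sum>e\<in>upper_pairs n. block_ind zs a b e * edge_noise p Q zs X A r e\<bar>}
    \<le> 4 * (real CARD('k))\<^sup>2 * exp (- (\<epsilon>\<^sup>2 * p * n\<^sup>2 / 4))"
proof -
  define bad where "bad a b r = {(A, X). \<epsilon> * p * n\<^sup>2 < \<bar>\<Sum>e\<in>upper_pairs n. block_ind zs a b e * edge_noise p Q zs X A r e\<bar>}" for a b r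
  let ?\<mu> = "graph_pmf n Q p zs"
  have sq: "(\<Sum>e\<in>upper_pairs n. (block_ind zs a b e)\<^sup>2) \<le> n\<^sup>2" for a b
  proof -
    have "(\<Sum>e\<in>upper_pairs n. (block_ind zs a b e)\<^sup>2) \<le> (\<Sum>e\<in>upper_pairs n. 1)"
      by (intro sum_mono) (auto simp: block_ind_def)
    also have "\<dots> \<le> n\<^sup>2"
    proof -
      have "card (upper_pairs n) \<le> card ({1..n} \<times> {1..n})" by (intro card_mono) (auto simp: upper_pairs_def)
      then have "real (card (upper_pairs n)) \<le> real (n * n)" by (intro of_nat_mono) simp
      then show ?thesis by (simp add: power2_eq_square)
    qed
    finally show ?thesis .
  qed
  have "{(A, X). \<exists>a b r. \<epsilon> * p * n\<^sup>2 < \<bar>\<Sum>e\<in>upper_pairs n. block_ind zs a b e * edge_noise p Q zs X A r e\<bar>}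
     = (\<Union>a. \<Union>b. \<Union>r. bad a b r)" by (auto simp: bad_def)
  also have "measure_pmf.prob ?\<mu> \<dots> \<le> (\<Sum>a\<in>UNIV. \<Sum>b\<in>UNIV. \<Sum>r\<in>UNIV. measure_pmf.prob ?\<mu> (bad a b r))"
    by (intro order_trans[OF measure_pmf.finite_measure_subadditive_finite] sum_mono order_refl) auto
  also have "\<dots> \<le> (\<Sum>a\<in>(UNIV::'k set). \<Sum>b\<in>(UNIV::'k set). \<Sum>r\<in>(UNIV::bool set). 2 * exp (- (\<epsilon>\<^sup>2 * p * n\<^sup>2 / 4)))"
    unfolding bad_def using sq by (intro sum_mono edge_noise_tail Q p \<epsilon>) (auto simp: block_ind_def)
  finally show ?thesis by (simp add: power2_eq_square mult_ac)
qed

section \<open>Class sizes and the error of block frequencies\<close>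

text \<open>
  Every class receives a quarter of its guaranteed share. The factor is generous so that the Chernoff bound with weight \<open>1\<close>
  needs no more than \<open>1 - exp (- 1) \<ge> 1 / 2\<close>.
\<close>

lemma balanced_prob:
  fixes \<alpha> :: "real^'k::finite"
  assumes \<alpha>: "\<alpha> \<in> prob_simplex" and c: "c \<le> \<alpha> $ a" "0 \<le> c"
  shows "measure_pmf.prob (labels_pmf n \<alpha>) {z. card {i \<in> {1..n}. z i = a} \<le> c / 4 * n} \<le> exp (- (c * n / 4))"
proof -
  have \<alpha>0: "0 \<le> \<alpha> $ b" for b using \<alpha> by (simp add: prob_simplex_def)
  have \<alpha>1: "(\<Sum>b\<in>UNIV. \<alpha> $ b) = 1" using \<alpha> by (simp add: prob_simplex_def)
  have pmf: "pmf (vec_pmf \<alpha>) b = \<alpha> $ b" for b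
    unfolding vec_pmf_def
    by (rule pmf_embed_pmf) (use \<alpha>0 \<alpha>1 in \<open>auto simp: nn_integral_count_space_finite sum_ennreal\<close>)
  define f where "f b = exp (- of_bool (b = a) :: real)" for b
  have one: "(\<integral>\<^sup>+b. ennreal (f b) \<partial>vec_pmf \<alpha>) \<le> ennreal (exp (- (c / 2)))"
  proof -
    have "(\<integral>\<^sup>+b. ennreal (f b) \<partial>vec_pmf \<alpha>) = (\<Sum>b\<in>UNIV. ennreal (f b) * ennreal (\<alpha> $ b))"
      by (subst nn_integral_measure_pmf_support[of UNIV]) (auto simp: pmf)
    also have "\<dots> = ennreal (\<Sum>b\<in>UNIV. f b * \<alpha> $ b)"
      using \<alpha>0 by (simp add: ennreal_mult[symmetric] f_def sum_ennreal)
    also have "(\<Sum>b\<in>UNIV. f b * \<alpha> $ b) = (\<Sum>b\<in>UNIV. \<alpha> $ b - of_bool (b = a) * ((1 - exp (- 1)) * \<alpha> $ b))"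
      by (intro sum.cong) (auto simp: f_def algebra_simps)
    also have "\<dots> = 1 - (1 - exp (- 1)) * \<alpha> $ a"
      by (simp add: sum_subtractf \<alpha>1 of_bool_def if_distrib[of "\<lambda>t. t * _"] sum.delta cong: if_cong)
    also have "\<dots> \<le> 1 - c / 2"
    proof -
      have "exp (- 1) \<le> (1 / 2 :: real)" using exp_ge_add_one_self[of "1::real"] by (simp add: exp_minus field_simps)
      then have "1 / 2 * c \<le> (1 - exp (- 1)) * \<alpha> $ a" using c by (intro mult_mono) auto
      then show ?thesis by simp
    qed
    also have "\<dots> \<le> exp (- (c / 2))" using exp_ge_add_one_self[of "- (c / 2)"] by simp
    finally show ?thesis by (simp add: ennreal_leI)
  qed
  have count: "(\<Prod>i\<in>{1..n}. f (z i)) = exp (- real (card {i \<in> {1..n}. z i = a}))" for z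
  proof -
    have "(\<Sum>i\<in>{1..n}. of_bool (z i = a)) = (\<Sum>i\<in>{i \<in> {1..n}. z i = a}. 1::real)"
      by (subst sum.inter_filter) (auto simp: of_bool_def)
    then show ?thesis by (simp only: f_def exp_sum[symmetric] finite_atLeastAtMost sum_negf) simp
  qed
  have "(\<integral>\<^sup>+z. ennreal (exp (- real (card {i \<in> {1..n}. z i = a}))) \<partial>labels_pmf n \<alpha>)
      = (\<integral>\<^sup>+z. (\<Prod>i\<in>{1..n}. ennreal (f (z i))) \<partial>labels_pmf n \<alpha>)"
    unfolding count[symmetric] by (subst prod_ennreal) (auto simp: f_def)
  also have "\<dots> = (\<Prod>i\<in>{1..n}. \<integral>\<^sup>+b. ennreal (f b) \<partial>vec_pmf \<alpha>)"
    unfolding labels_pmf_def by (rule nn_integral_prod_Pi_pmf[where f = "\<lambda>_ b. ennreal (f b)"]) simp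
  also have "\<dots> \<le> (\<Prod>i\<in>{1..n}. ennreal (exp (- (c / 2))))" by (intro prod_mono_ennreal one)
  also have "\<dots> = ennreal (exp (- (c / 2)) ^ n)" by (simp add: ennreal_power)
  also have "exp (- (c / 2)) ^ n = exp (- (c * n / 2))" by (simp add: exp_of_nat_mult[symmetric])
  finally have "measure_pmf.prob (labels_pmf n \<alpha>) {z. - (c / 4 * n) \<le> - real (card {i \<in> {1..n}. z i = a})}
      \<le> exp (- (- (c / 4 * n))) * exp (- (c * n / 2))"
    by (intro prob_exp_markov) auto
  also have "\<dots> = exp (- (c * n / 4))" by (simp add: exp_add[symmetric])
  finally show ?thesis by simp
qed

lemma observed_sbm_pmf_graph:
  "observed_sbm_pmf n \<alpha> Q p = bind_pmf (labels_pmf n \<alpha>) (\<lambda>z. map_pmf (\<lambda>(A, X). ((z, A), X)) (graph_pmf n Q p z))"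
  by (simp add: observed_sbm_pmf_def sbm_pmf_def graph_pmf_def pair_pmf_def map_pmf_def bind_assoc_pmf bind_return_pmf)

lemma observed_prob_le:
  assumes "\<And>z. measure_pmf.prob (graph_pmf n Q p z) {(A, X). P z A X} \<le> b" and "0 \<le> b"
  shows "measure_pmf.prob (observed_sbm_pmf n \<alpha> Q p) {((z, A), X). P z A X} \<le> b"
proof -
  have "emeasure (observed_sbm_pmf n \<alpha> Q p) {((z, A), X). P z A X}
      = (\<integral>\<^sup>+z. emeasure (graph_pmf n Q p z) {(A, X). P z A X} \<partial>labels_pmf n \<alpha>)"
    unfolding observed_sbm_pmf_graph by (simp add: vimage_def case_prod_unfold)
  also have "\<dots> \<le> (\<integral>\<^sup>+z. ennreal b \<partial>labels_pmf n \<alpha>)"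
    using assms by (intro nn_integral_mono) (simp add: measure_pmf.emeasure_eq_measure ennreal_leI)
  also have "\<dots> = ennreal b" by simp
  finally show ?thesis using assms(2) by (simp add: measure_pmf.emeasure_eq_measure)
qed

lemma observed_prob_labels:
  "measure_pmf.prob (observed_sbm_pmf n \<alpha> Q p) {((z, A), X). P z} = measure_pmf.prob (labels_pmf n \<alpha>) {z. P z}"
proof -
  have "map_pmf (\<lambda>((z, A), X). z) (observed_sbm_pmf n \<alpha> Q p) = labels_pmf n \<alpha>"
    unfolding observed_sbm_pmf_graph map_bind_pmf map_pmf_comp
    by (simp add: case_prod_unfold map_pmf_const bind_return_pmf')
  then have "measure_pmf.prob (labels_pmf n \<alpha>) {z. P z} = measure_pmf.prob (map_pmf (\<lambda>((z, A), X). z) (observed_sbm_pmf n \<alpha> Q p)) {z. P z}"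
    by simp
  then show ?thesis by (simp add: measure_map_pmf vimage_def case_prod_unfold)
qed

lemma observed_support:
  assumes "((z, A), X) \<in> set_pmf (observed_sbm_pmf n \<alpha> Q p)"
  shows "z \<in> label_funs n" "\<And>i j. X i j = X j i" "\<And>i j. A i j = A j i"
proof -
  have sym: "M i j = M j i" if "M \<in> set_pmf (sym_bernoulli_pmf n P)" for M :: nmat and P i j
    using that by (auto simp: sym_bernoulli_pmf_def min.commute max.commute)
  have "z \<in> set_pmf (labels_pmf n \<alpha>)" "A \<in> set_pmf (sym_bernoulli_pmf n (theta Q z))" "X \<in> set_pmf (sym_bernoulli_pmf n (\<lambda>_ _. p))"
    using assms by (auto simp: observed_sbm_pmf_def sbm_pmf_def)
  then show "\<And>i j. X i j = X j i" "\<And>i j. A i j = A j i" by (auto dest: sym)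
  have "z \<in> PiE_dflt {1..n} undefined (\<lambda>_. set_pmf (vec_pmf \<alpha>))"
    using \<open>z \<in> set_pmf (labels_pmf n \<alpha>)\<close> set_Pi_pmf_subset'[of "{1..n}" undefined "\<lambda>_. vec_pmf \<alpha>"] by (auto simp: labels_pmf_def)
  then show "z \<in> label_funs n" by (auto simp: label_funs_def PiE_dflt_def PiE_def extensional_def)
qed

lemma label_block_relabel:
  assumes "inj \<sigma>" "\<And>i. i \<in> {1..n} \<Longrightarrow> zv i = \<sigma> (zs i)"
  shows "label_block n zv (\<sigma> a) (\<sigma> b) = label_block n zs a b"
  unfolding label_block_def using assms by (auto dest: injD)

text \<open>
  \<open>label_block\<close> consists of ordered pairs while the independent entries are indexed by \<open>i < j\<close>.
\<close>

lemma sum_label_block: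
  fixes f :: "nat \<Rightarrow> nat \<Rightarrow> real"
  assumes "\<And>i j. f i j = f j i"
  shows "(\<Sum>(i, j)\<in>label_block n z a b. f i j) = (\<Sum>(i, j)\<in>upper_pairs n. (block_ind z a b (i, j) + block_ind z b a (i, j)) * f i j)"
proof -
  define g where "g i j = of_bool (z i = a \<and> z j = b) * f i j" for i j
  have "(\<Sum>(i, j)\<in>label_block n z a b. f i j) = (\<Sum>(i, j)\<in>(SIGMA i:{1..n}. {1..n} - {i}). g i j)"
    by (rule sum.mono_neutral_cong_left) (auto simp: label_block_def g_def split: if_splits)
  also have "\<dots> = (\<Sum>i\<in>{1..n}. \<Sum>j\<in>{1..n} - {i}. g i j)" by (subst sum.Sigma) auto
  also have "\<dots> = (\<Sum>(i, j)\<in>upper_pairs n. g i j + g j i)" by (rule sum_upper_pairs_symmetric[symmetric])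
  also have "\<dots> = (\<Sum>(i, j)\<in>upper_pairs n. (block_ind z a b (i, j) + block_ind z b a (i, j)) * f i j)"
  proof (intro sum.cong refl, clarify)
    fix i j
    have "g j i = of_bool (z i = b \<and> z j = a) * f i j"
      unfolding g_def by (subst assms) (simp only: conj_commute)
    then show "g i j + g j i = (block_ind z a b (i, j) + block_ind z b a (i, j)) * f i j"
      by (simp only: g_def block_ind_def prod.case distrib_right)
  qed
  finally show ?thesis .
qed

lemma card_label_block:
  "real (card (label_block n z a b)) \<ge> real (card {i \<in> {1..n}. z i = a}) * (real (card {i \<in> {1..n}. z i = b}) - 1)"
proof -
  let ?A = "{i \<in> {1..n}. z i = a}" and ?B = "{i \<in> {1..n}. z i = b}"
  have "label_block n z a b = (SIGMA i:?A. ?B - {i})" by (auto simp: label_block_def)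
  then have "real (card (label_block n z a b)) = (\<Sum>i\<in>?A. real (card (?B - {i})))" by simp
  also have "\<dots> \<ge> (\<Sum>i\<in>?A. real (card ?B) - 1)"
  proof (intro sum_mono)
    fix i
    show "real (card ?B) - 1 \<le> real (card (?B - {i}))" using diff_card_le_card_Diff[of "{i}" ?B] by simp
  qed
  finally show ?thesis by simp
qed

text \<open>
  The block frequencies of the labels \<open>\<sigma> \<circ> zs\<close> are those of \<open>zs\<close> with permuted indices, so after exact recovery the error
  does not depend on \<open>\<sigma>\<close>.
\<close>

lemma frob_norm_relabelled:
  fixes zs zv :: "nat \<Rightarrow> 'k::finite"
  assumes \<sigma>: "bij \<sigma>" "\<And>i. i \<in> {1..n} \<Longrightarrow> zv i = \<sigma> (zs i)"
  shows "(frob_norm n (\<lambda>i j. theta Qs zs i j - theta_var n X A zv i j))\<^sup>2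
    = (\<Sum>a\<in>UNIV. \<Sum>b\<in>UNIV. card (label_block n zs a b) * (Qs $ a $ b - Q_ml_var n X A zs $ a $ b)\<^sup>2)"
proof -
  have ml: "Q_ml_var n X A zv $ \<sigma> a $ \<sigma> b = Q_ml_var n X A zs $ a $ b" for a b
    using label_block_relabel[of \<sigma> n zv zs a b] \<sigma> by (simp add: Q_ml_var_def bij_is_inj)
  define g where "g a b = (Qs $ a $ b - Q_ml_var n X A zs $ a $ b)\<^sup>2" for a b
  let ?P = "SIGMA i:{1..n}. {1..n} - {i}"
  have "(frob_norm n (\<lambda>i j. theta Qs zs i j - theta_var n X A zv i j))\<^sup>2
      = (\<Sum>i\<in>{1..n}. \<Sum>j\<in>{1..n}. (theta Qs zs i j - theta_var n X A zv i j)\<^sup>2)"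
    by (simp add: frob_norm_def sum_nonneg)
  also have "\<dots> = (\<Sum>i\<in>{1..n}. \<Sum>j\<in>{1..n} - {i}. g (zs i) (zs j))"
  proof (rule sum.cong[OF refl])
    fix i assume i: "i \<in> {1..n}"
    show "(\<Sum>j\<in>{1..n}. (theta Qs zs i j - theta_var n X A zv i j)\<^sup>2) = (\<Sum>j\<in>{1..n} - {i}. g (zs i) (zs j))"
    proof (rule sum.mono_neutral_cong_right)
      fix j assume "j \<in> {1..n} - {i}"
      then show "(theta Qs zs i j - theta_var n X A zv i j)\<^sup>2 = g (zs i) (zs j)"
        using i by (simp add: theta_def theta_var_def \<sigma>(2) ml g_def)
    qed (auto simp: theta_def theta_var_def)
  qed
  also have "\<dots> = (\<Sum>(i, j)\<in>?P. g (zs i) (zs j))" by (subst sum.Sigma) auto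
  also have "\<dots> = (\<Sum>ab\<in>UNIV. \<Sum>(i, j)\<in>{e \<in> ?P. (zs (fst e), zs (snd e)) = ab}. g (zs i) (zs j))"
    by (rule sum.group[symmetric]) auto
  also have "\<dots> = (\<Sum>(a, b)\<in>UNIV. card (label_block n zs a b) * g a b)"
  proof (intro sum.cong refl)
    fix ab :: "'k \<times> 'k"
    obtain a b where ab: "ab = (a, b)" by (cases ab)
    have "{e \<in> ?P. (zs (fst e), zs (snd e)) = ab} = label_block n zs a b" by (auto simp: ab label_block_def)
    moreover have "(\<Sum>(i, j)\<in>label_block n zs a b. g (zs i) (zs j)) = (\<Sum>(i, j)\<in>label_block n zs a b. g a b)"
      by (intro sum.cong) (auto simp: label_block_def)
    ultimately show "(\<Sum>(i, j)\<in>{e \<in> ?P. (zs (fst e), zs (snd e)) = ab}. g (zs i) (zs j)) = (case ab of (a, b) \<Rightarrow> card (label_block n zs a b) * g a b)"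
      by (simp add: ab)
  qed
  finally show ?thesis by (simp add: g_def sum.cartesian_product)
qed

text \<open>
  The frequency is a ratio of observed edges to observed pairs. Its error is a combination of the two centred block
  sums with weights \<open>1 - q\<close> and \<open>q\<close>, over a number of observed pairs that is at least half of its mean.
  Each block sum over ordered pairs is two sums over \<open>i < j\<close>, which accounts for \<open>2 * \<eta>\<close>.
\<close>

lemma block_estimator_error:
  fixes p \<eta> :: real and zs :: "nat \<Rightarrow> 'k::finite"
  assumes Qs: "\<And>a b. Qs $ a $ b \<in> {0..1}" "\<And>a b. Qs $ a $ b = Qs $ b $ a"
    and sym: "\<And>i j. X i j = X j i" "\<And>i j. A i j = A j i" and p: "0 < p"
    and noise: "\<And>a b r. \<bar>\<Sum>e\<in>upper_pairs n. block_ind zs a b e * edge_noise p Qs zs X A r e\<bar> \<le> \<eta>"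
    and large: "8 * \<eta> \<le> p * card (label_block n zs a b)" "label_block n zs a b \<noteq> {}"
  shows "\<bar>Q_ml_var n X A zs $ a $ b - Qs $ a $ b\<bar> \<le> 4 * \<eta> / (p * card (label_block n zs a b))"
proof -
  let ?L = "label_block n zs a b" and ?q = "Qs $ a $ b"
  define N where "N = real (card ?L)"
  have "finite ?L" by (rule finite_subset[of _ "{1..n} \<times> {1..n}"]) (auto simp: label_block_def)
  then have N: "0 < N" using large(2) by (simp add: N_def card_gt_0_iff)
  define S where "S r = (\<Sum>(i, j)\<in>?L. X i j * (if r then A i j else 1 - A i j))" for r
  define d where "d r = S r - p * (if r then ?q else 1 - ?q) * N" for r
  have d_bound: "\<bar>d r\<bar> \<le> 2 * \<eta>" for r
  proof -
    define f where "f i j = X i j * (if r then A i j else 1 - A i j) - p * (if r then Qs $ zs i $ zs j else 1 - Qs $ zs i $ zs j)" for i j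
    have "d r = (\<Sum>(i, j)\<in>?L. X i j * (if r then A i j else 1 - A i j)) - (\<Sum>(i, j)\<in>?L. p * (if r then ?q else 1 - ?q))"
      by (simp add: d_def S_def N_def)
    also have "\<dots> = (\<Sum>(i, j)\<in>?L. f i j)"
      unfolding sum_subtractf[symmetric] by (intro sum.cong) (auto simp: f_def label_block_def)
    also have "\<dots> = (\<Sum>(i, j)\<in>upper_pairs n. (block_ind zs a b (i, j) + block_ind zs b a (i, j)) * f i j)"
      by (rule sum_label_block) (simp add: f_def sym Qs(2))
    also have "\<dots> = (\<Sum>e\<in>upper_pairs n. block_ind zs a b e * edge_noise p Qs zs X A r e)
        + (\<Sum>e\<in>upper_pairs n. block_ind zs b a e * edge_noise p Qs zs X A r e)"
      unfolding sum.distrib[symmetric]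
      by (intro sum.cong) (auto simp: f_def edge_noise_def edge_obs_def edge_mean_def algebra_simps)
    finally show ?thesis using noise[of a b r] noise[of b a r] by linarith
  qed
  have "S True + S False = (\<Sum>(i, j)\<in>?L. X i j)"
    unfolding S_def sum.distrib[symmetric] by (intro sum.cong) (auto simp: algebra_simps)
  then have ml: "Q_ml_var n X A zs $ a $ b = S True / (S True + S False)"
    by (simp add: Q_ml_var_def S_def)
  have total: "S True + S False = p * N + d True + d False" by (simp add: d_def algebra_simps)
  have denom: "p * N / 2 \<le> S True + S False"
    using d_bound[of True] d_bound[of False] large(1) unfolding total N_def by linarith
  have pN: "0 < p * N" using p N by simp
  have "Q_ml_var n X A zs $ a $ b - ?q = ((1 - ?q) * d True - ?q * d False) / (S True + S False)"
    using denom pN unfolding ml by (simp add: d_def field_simps)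
  also have "\<bar>\<dots>\<bar> \<le> (2 * \<eta>) / (p * N / 2)"
  proof -
    have "\<bar>(1 - ?q) * d True - ?q * d False\<bar> \<le> (1 - ?q) * \<bar>d True\<bar> + ?q * \<bar>d False\<bar>"
      using Qs(1)[of a b] by (intro order_trans[OF abs_triangle_ineq4]) (simp add: abs_mult)
    also have "\<dots> \<le> (1 - ?q) * (2 * \<eta>) + ?q * (2 * \<eta>)"
      using Qs(1)[of a b] by (intro add_mono mult_left_mono d_bound) auto
    finally have "\<bar>(1 - ?q) * d True - ?q * d False\<bar> \<le> 2 * \<eta>" by (simp add: algebra_simps)
    then show ?thesis unfolding abs_divide using denom pN by (intro frac_le) auto
  qed
  finally show ?thesis by (simp add: N_def)
qed

lemma frob_error_bound:
  fixes p \<gamma> \<epsilon> :: real and zs zv :: "nat \<Rightarrow> 'k::finite"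
  assumes Qs: "\<And>a b. Qs $ a $ b \<in> {0..1}" "\<And>a b. Qs $ a $ b = Qs $ b $ a"
    and sym: "\<And>i j. X i j = X j i" "\<And>i j. A i j = A j i" and p: "0 < p"
    and \<sigma>: "bij \<sigma>" "\<And>i. i \<in> {1..n} \<Longrightarrow> zv i = \<sigma> (zs i)"
    and balanced: "\<And>a. \<gamma> * n \<le> card {i \<in> {1..n}. zs i = a}" and \<gamma>: "0 < \<gamma>" "2 \<le> \<gamma> * n"
    and noise: "\<And>a b r. \<bar>\<Sum>e\<in>upper_pairs n. block_ind zs a b e * edge_noise p Qs zs X A r e\<bar> \<le> \<epsilon> * p * n\<^sup>2"
    and \<epsilon>: "0 \<le> \<epsilon>" "16 * \<epsilon> \<le> \<gamma>\<^sup>2"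
  shows "(frob_norm n (\<lambda>i j. theta Qs zs i j - theta_var n X A zv i j))\<^sup>2 \<le> 32 * real CARD('k)^2 * \<epsilon>\<^sup>2 * n\<^sup>2 / \<gamma>\<^sup>2"
proof -
  have n: "0 < real n" using \<gamma> by (cases n) auto
  have "card (label_block n zs a b) * (Qs $ a $ b - Q_ml_var n X A zs $ a $ b)\<^sup>2 \<le> 32 * \<epsilon>\<^sup>2 * n\<^sup>2 / \<gamma>\<^sup>2" for a b
  proof -
    let ?N = "real (card (label_block n zs a b))"
    have "\<gamma>\<^sup>2 * n\<^sup>2 / 2 = \<gamma> * n * (\<gamma> * n / 2)" by (simp add: power2_eq_square)
    also have "\<dots> \<le> card {i \<in> {1..n}. zs i = a} * (real (card {i \<in> {1..n}. zs i = b}) - 1)"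
    proof (rule mult_mono[OF balanced])
      show "\<gamma> * n / 2 \<le> real (card {i \<in> {1..n}. zs i = b}) - 1" using balanced[of b] \<gamma>(2) by linarith
    qed (use \<gamma> n in auto)
    also have "\<dots> \<le> ?N" by (rule card_label_block)
    finally have N: "\<gamma>\<^sup>2 * n\<^sup>2 / 2 \<le> ?N" .
    have pos: "0 < \<gamma>\<^sup>2 * n\<^sup>2 / 2" using \<gamma> n by simp
    have "16 * \<epsilon> * n\<^sup>2 \<le> \<gamma>\<^sup>2 * n\<^sup>2" by (rule mult_right_mono[OF \<epsilon>(2)]) simp
    then have "8 * \<epsilon> * n\<^sup>2 \<le> ?N" using N by linarith
    then have "p * (8 * \<epsilon> * n\<^sup>2) \<le> p * ?N" using p by (intro mult_left_mono) auto
    then have "\<bar>Q_ml_var n X A zs $ a $ b - Qs $ a $ b\<bar> \<le> 4 * (\<epsilon> * p * n\<^sup>2) / (p * ?N)"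
      using N pos by (intro block_estimator_error Qs sym p noise) (auto simp: mult_ac)
    also have "\<dots> = 4 * \<epsilon> * n\<^sup>2 / ?N" using p by simp
    finally have "\<bar>Q_ml_var n X A zs $ a $ b - Qs $ a $ b\<bar>\<^sup>2 \<le> (4 * \<epsilon> * n\<^sup>2 / ?N)\<^sup>2" by (rule power_mono) simp
    then have "?N * (Qs $ a $ b - Q_ml_var n X A zs $ a $ b)\<^sup>2 \<le> ?N * (4 * \<epsilon> * n\<^sup>2 / ?N)\<^sup>2"
      by (intro mult_left_mono) (simp_all add: power2_commute)
    also have "\<dots> = (4 * \<epsilon> * n\<^sup>2)\<^sup>2 / ?N" using N pos by (simp add: power2_eq_square)
    also have "\<dots> \<le> (4 * \<epsilon> * n\<^sup>2)\<^sup>2 / (\<gamma>\<^sup>2 * n\<^sup>2 / 2)" using N pos by (intro divide_left_mono) auto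
    also have "\<dots> = 32 * \<epsilon>\<^sup>2 * n\<^sup>2 / \<gamma>\<^sup>2" using n \<gamma> by (simp add: field_simps power2_eq_square)
    finally show ?thesis .
  qed
  then have "(\<Sum>a\<in>UNIV. \<Sum>b\<in>UNIV. card (label_block n zs a b) * (Qs $ a $ b - Q_ml_var n X A zs $ a $ b)\<^sup>2)
      \<le> (\<Sum>a\<in>(UNIV::'k set). \<Sum>b\<in>(UNIV::'k set). 32 * \<epsilon>\<^sup>2 * n\<^sup>2 / \<gamma>\<^sup>2)"
    by (intro sum_mono)
  also have "\<dots> = 32 * real CARD('k)^2 * \<epsilon>\<^sup>2 * n\<^sup>2 / \<gamma>\<^sup>2" by (simp add: power2_eq_square mult_ac)
  finally show ?thesis by (simp only: frob_norm_relabelled[OF \<sigma>, where Qs = Qs and X = X and A = A])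
qed

section \<open>Asymptotics and conclusion\<close>

lemma dense_sampling_limits:
  fixes p :: "nat \<Rightarrow> real"
  assumes "filterlim (\<lambda>n. p n * real n / ln (real n)) at_top sequentially"
  shows "filterlim (\<lambda>n. p n * real n) at_top sequentially"
    and "0 < \<kappa> \<Longrightarrow> (\<lambda>n. real n * exp (- (\<kappa> * (p n * real n)))) \<longlonglongrightarrow> 0"
proof -
  have ln_top: "filterlim (\<lambda>n. ln (real n)) at_top sequentially"
    by (rule filterlim_compose[OF ln_at_top filterlim_real_sequentially])
  have ev: "\<forall>\<^sub>F n in sequentially. c * ln (real n) \<le> p n * real n" for c
    using filterlim_at_top[THEN iffD1, OF assms, rule_format, of c] eventually_gt_at_top[of 1]
    by eventually_elim (simp add: pos_le_divide_eq)
  show "filterlim (\<lambda>n. p n * real n) at_top sequentially"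
    by (rule filterlim_at_top_mono[OF ln_top]) (use ev[of 1] in simp)
  assume \<kappa>: "0 < \<kappa>"
  show "(\<lambda>n. real n * exp (- (\<kappa> * (p n * real n)))) \<longlonglongrightarrow> 0"
  proof (rule tendsto_sandwich[OF _ _ tendsto_const lim_inverse_n])
    show "\<forall>\<^sub>F n in sequentially. real n * exp (- (\<kappa> * (p n * real n))) \<le> inverse (real n)"
      using ev[of "2 / \<kappa>"] eventually_gt_at_top[of 0]
    proof eventually_elim
      case (elim n)
      then have "2 * ln (real n) \<le> \<kappa> * (p n * real n)" using \<kappa> by (simp add: field_simps)
      then have "exp (- (\<kappa> * (p n * real n))) \<le> exp (- (2 * ln (real n)))" by simp
      also have "\<dots> = (inverse (real n))\<^sup>2"
        using elim by (simp add: exp_minus exp_double power_inverse)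
      finally have "real n * exp (- (\<kappa> * (p n * real n))) \<le> real n * (inverse (real n))\<^sup>2"
        by (intro mult_left_mono) auto
      also have "\<dots> = inverse (real n)" using elim by (simp add: power2_eq_square)
      finally show ?case .
    qed
  qed auto
qed

lemma power_perturbation_limit:
  fixes x :: "nat \<Rightarrow> real"
  assumes x: "\<And>n. 0 \<le> x n" "(\<lambda>n. real n * x n) \<longlonglongrightarrow> 0"
  shows "(\<lambda>n. (1 + x n) ^ n - 1) \<longlonglongrightarrow> 0"
proof (rule tendsto_sandwich[OF _ _ tendsto_const])
  have "(\<lambda>n. exp (real n * x n) - 1) \<longlonglongrightarrow> exp 0 - 1" by (intro tendsto_intros x)
  then show "(\<lambda>n. exp (real n * x n) - 1) \<longlonglongrightarrow> 0" by simp
  show "\<forall>\<^sub>F n in sequentially. (1 + x n) ^ n - 1 \<le> exp (real n * x n) - 1"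
    using x(1) by (intro always_eventually allI) (simp add: exp_of_nat_mult power_mono)
  show "\<forall>\<^sub>F n in sequentially. 0 \<le> (1 + x n) ^ n - 1"
    using x(1) by (intro always_eventually allI) (simp add: one_le_power)
qed

lemma prob_tendsto_1:
  assumes "\<forall>\<^sub>F n in sequentially. measure_pmf.prob (D n) (- E n) \<le> b n" and "b \<longlonglongrightarrow> 0"
  shows "(\<lambda>n. measure_pmf.prob (D n) (E n)) \<longlonglongrightarrow> 1"
proof (rule tendsto_sandwich[OF _ _ _ tendsto_const])
  show "\<forall>\<^sub>F n in sequentially. 1 - b n \<le> measure_pmf.prob (D n) (E n)"
    using assms(1) 
  proof eventually_elim
    case (elim n)
    then show ?case using measure_pmf.prob_compl[of "E n" "D n"] by (simp add: Compl_eq_Diff_UNIV)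
  qed
  have "(\<lambda>n. 1 - b n) \<longlonglongrightarrow> 1 - 0" by (intro tendsto_intros assms)
  then show "(\<lambda>n. 1 - b n) \<longlonglongrightarrow> 1" by simp
qed auto

text \<open>
  If two rows of the symmetric matrix \<open>Qs\<close> agreed, two coordinates of \<open>\<alpha> v* Qs\<close> would agree. There are finitely many entries,
  so the distance is uniform.
\<close>

lemma separation_constant:
  fixes Qs :: "real^'k::finite^'k"
  assumes inj: "inj (\<lambda>a. (\<alpha> v* Qs) $ a)" and sym: "\<And>a b. Qs $ a $ b = Qs $ b $ a"
  obtains \<Delta> :: real where "0 < \<Delta>" "\<Delta> \<le> 1" "\<And>a b. a \<noteq> b \<Longrightarrow> \<exists>d. \<Delta> \<le> \<bar>Qs $ a $ d - Qs $ b $ d\<bar>"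
proof -
  define S where "S = insert 1 ((\<lambda>(a, b, d). \<bar>Qs $ a $ d - Qs $ b $ d\<bar>) ` UNIV - {0})"
  have fin: "finite S" "S \<noteq> {}" by (auto simp: S_def)
  have "\<exists>d. Min S \<le> \<bar>Qs $ a $ d - Qs $ b $ d\<bar>" if "a \<noteq> b" for a b
  proof -
    have "\<exists>d. Qs $ a $ d \<noteq> Qs $ b $ d"
    proof (rule ccontr)
      assume "\<not> ?thesis"
      then have "Qs $ d $ a = Qs $ d $ b" for d using sym by metis
      then have "(\<alpha> v* Qs) $ a = (\<alpha> v* Qs) $ b" by (simp add: vector_matrix_mult_def)
      with inj that show False by (auto dest: injD)
    qed
    then obtain d where "Qs $ a $ d \<noteq> Qs $ b $ d" by blast
    then have "\<bar>Qs $ a $ d - Qs $ b $ d\<bar> \<in> S" unfolding S_def by (auto intro!: image_eqI[of _ _ "(a, b, d)"])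
    then show ?thesis using fin by (intro exI[of _ d]) auto
  qed
  moreover have "0 < Min S" using fin by (subst Min_gr_iff) (auto simp: S_def)
  moreover have "Min S \<le> 1" using fin by (auto simp: S_def)
  ultimately show thesis using that by blast
qed

theorem theorem2:
  fixes Qs :: "real^'k::finite^'k"
  shows "\<exists>C>0. \<forall>(\<A> :: (real^'k) set) (\<Q> :: (real^'k^'k) set) (\<alpha>s :: real^'k) (p :: nat \<Rightarrow> real)
      (Qhat :: nat \<Rightarrow> nmat \<Rightarrow> nmat \<Rightarrow> real^'k^'k) (zhat :: nat \<Rightarrow> nmat \<Rightarrow> nmat \<Rightarrow> nat \<Rightarrow> 'k)
      (\<alpha>var :: nat \<Rightarrow> nmat \<Rightarrow> nmat \<Rightarrow> real^'k) (Qvar :: nat \<Rightarrow> nmat \<Rightarrow> nmat \<Rightarrow> real^'k^'k)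
      (\<tau>var :: nat \<Rightarrow> nmat \<Rightarrow> nmat \<Rightarrow> nat \<Rightarrow> real^'k) (zvar :: nat \<Rightarrow> nmat \<Rightarrow> nmat \<Rightarrow> nat \<Rightarrow> 'k).
      \<A> \<subseteq> prob_simplex \<and> \<Q> \<subseteq> sym_mats \<and> \<alpha>s \<in> \<A> \<and> Qs \<in> \<Q> \<and>
      (\<exists>c>0. \<forall>\<alpha>\<in>\<A>. \<forall>a. \<alpha> $ a \<in> {c..1 - c}) \<and>
      (\<exists>l u. {l..u} \<subseteq> {0<..<1} \<and> (\<forall>Q\<in>\<Q>. \<forall>a b. Q $ a $ b \<in> {l..u})) \<and>
      \<alpha>s \<in> top_of_set prob_simplex interior_of \<A> \<and>
      Qs \<in> top_of_set sym_mats interior_of \<Q> \<and>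
      inj (\<lambda>a. (\<alpha>s v* Qs) $ a) \<and>
      (\<forall>n. 0 \<le> p n \<and> p n \<le> 1) \<and>
      p \<longlonglongrightarrow> 0 \<and>
      filterlim (\<lambda>n. p n * real n / ln (real n)) at_top sequentially \<and>
      (\<forall>n. \<forall>((zs, A), X) \<in> set_pmf (observed_sbm_pmf n \<alpha>s Qs (p n)).
         is_mle \<Q> n X A (Qhat n X A) (zhat n X A) \<and>
         is_variational_est \<A> \<Q> n X A (\<alpha>var n X A) (Qvar n X A) (\<tau>var n X A) \<and>
         is_var_labels n (\<tau>var n X A) (zvar n X A))
      \<longrightarrow>
      (\<lambda>n. measure_pmf.prob (observed_sbm_pmf n \<alpha>s Qs (p n))
             {((zs, A), X). label_equiv n (zvar n X A) (zhat n X A)}) \<longlonglongrightarrow> 1 \<and>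
      (\<lambda>n. measure_pmf.prob (observed_sbm_pmf n \<alpha>s Qs (p n))
             {((zs, A), X).
                (frob_norm n (\<lambda>i j. theta Qs zs i j - theta_var n X A (zvar n X A) i j))\<^sup>2
                  \<le> C * (real CARD('k) ^ 2 + real n * ln (real CARD('k))) / p n}) \<longlonglongrightarrow> 1"
proof (intro exI[of _ "1::real"] conjI[OF zero_less_one] allI impI, elim conjE exE bexE)
  fix \<A> :: "(real^'k) set" and \<Q> :: "(real^'k^'k) set" and \<alpha>s :: "real^'k" and p :: "nat \<Rightarrow> real"
    and Qhat :: "nat \<Rightarrow> nmat \<Rightarrow> nmat \<Rightarrow> real^'k^'k" and zhat :: "nat \<Rightarrow> nmat \<Rightarrow> nmat \<Rightarrow> nat \<Rightarrow> 'k"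
    and \<alpha>var :: "nat \<Rightarrow> nmat \<Rightarrow> nmat \<Rightarrow> real^'k" and Qvar :: "nat \<Rightarrow> nmat \<Rightarrow> nmat \<Rightarrow> real^'k^'k"
    and \<tau>var :: "nat \<Rightarrow> nmat \<Rightarrow> nmat \<Rightarrow> nat \<Rightarrow> real^'k" and zvar :: "nat \<Rightarrow> nmat \<Rightarrow> nmat \<Rightarrow> nat \<Rightarrow> 'k"
    and c l u :: real
  assume \<A>: "\<A> \<subseteq> prob_simplex" "\<alpha>s \<in> \<A>" and \<Q>: "\<Q> \<subseteq> sym_mats" "Qs \<in> \<Q>"
    and c: "0 < c" "\<forall>\<alpha>\<in>\<A>. \<forall>a. \<alpha> $ a \<in> {c..1 - c}"
    and lu: "{l..u} \<subseteq> {0<..<1}" "\<forall>Q\<in>\<Q>. \<forall>a b. Q $ a $ b \<in> {l..u}"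
    and inj: "inj (\<lambda>a. (\<alpha>s v* Qs) $ a)"
    and p01: "\<forall>n. 0 \<le> p n \<and> p n \<le> 1"
    and dense: "filterlim (\<lambda>n. p n * real n / ln (real n)) at_top sequentially"
    and est: "\<forall>n. \<forall>((zs, A), X) \<in> set_pmf (observed_sbm_pmf n \<alpha>s Qs (p n)).
         is_mle \<Q> n X A (Qhat n X A) (zhat n X A) \<and>
         is_variational_est \<A> \<Q> n X A (\<alpha>var n X A) (Qvar n X A) (\<tau>var n X A) \<and>
         is_var_labels n (\<tau>var n X A) (zvar n X A)"
  let ?k = "real CARD('k)"
  have sym: "Q $ a $ b = Q $ b $ a" if "Q \<in> \<Q>" for Q a b
  proof -
    have "transpose Q = Q" using \<Q>(1) that by (auto simp: sym_mats_def)
    then have "transpose Q $ b $ a = Q $ b $ a" by simp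
    then show ?thesis by (simp add: transpose_def)
  qed
  have lu': "0 < l" "u < 1"
  proof -
    have "l \<le> u" using lu(2) \<Q>(2) by (metis atLeastAtMost_iff order_trans)
    then have "l \<in> {l..u}" "u \<in> {l..u}" by auto
    then show "0 < l" "u < 1" using lu(1) by auto
  qed
  have Qs01: "Qs $ a $ b \<in> {0..1}" for a b
    using lu(1) lu(2)[rule_format, OF \<Q>(2), of a b] by (auto dest!: subsetD)
  have k2: "2 \<le> CARD('k)"
  proof (rule ccontr)
    assume "\<not> ?thesis"
    then have "CARD('k) = 1" using zero_less_card_finite[where 'a = 'k] by linarith
    then obtain a where a: "(UNIV :: 'k set) = {a}" by (rule card_1_singletonE)
    have "(\<Sum>b\<in>UNIV. \<alpha>s $ b) = 1" using \<A> by (auto simp: prob_simplex_def)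
    then have "\<alpha>s $ a = 1" by (simp add: a)
    with c \<A>(2) show False by (metis atLeastAtMost_iff diff_gt_0_iff_gt le_diff_eq add_le_same_cancel1 not_le)
  qed
  obtain \<Delta> where \<Delta>: "0 < \<Delta>" "\<Delta> \<le> 1" "\<And>a b. a \<noteq> b \<Longrightarrow> \<exists>d. \<Delta> \<le> \<bar>Qs $ a $ d - Qs $ b $ d\<bar>"
    using separation_constant[OF inj sym[OF \<Q>(2)]] by blast
  define \<gamma> where "\<gamma> = c / 4"
  have \<gamma>: "0 < \<gamma>" "\<gamma> \<le> 1"
  proof -
    have "c \<le> 1 - c" using c(2) \<A>(2) by (metis atLeastAtMost_iff order_trans)
    then show "0 < \<gamma>" "\<gamma> \<le> 1" using c(1) by (auto simp: \<gamma>_def)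
  qed
  define e where "e = fit_tolerance CARD('k) l u \<gamma> \<Delta>"
  have e: "0 < e" using \<Delta> \<gamma> lu' by (simp add: e_def fit_tolerance_def)
  define B where "B = sbm_sample.log_bound l u"
  \<comment> \<open>small enough for the recovery lemmas and independent of n\<close>
  define \<epsilon> where "\<epsilon> = min 1 (e / (64 * ?k\<^sup>2 * (\<bar>B\<bar> + 1)))"
  have \<epsilon>: "0 < \<epsilon>" "\<epsilon> \<le> 1" "64 * ?k\<^sup>2 * (B + 1) * \<epsilon> \<le> e"
  proof -
    have pos: "0 < 64 * ?k\<^sup>2 * (\<bar>B\<bar> + 1)" by simp
    show "0 < \<epsilon>" "\<epsilon> \<le> 1" using e pos by (auto simp: \<epsilon>_def)
    have "64 * ?k\<^sup>2 * (B + 1) * \<epsilon> \<le> 64 * ?k\<^sup>2 * (\<bar>B\<bar> + 1) * \<epsilon>"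
      using \<open>0 < \<epsilon>\<close> by (intro mult_right_mono mult_left_mono) auto
    also have "\<dots> \<le> 64 * ?k\<^sup>2 * (\<bar>B\<bar> + 1) * (e / (64 * ?k\<^sup>2 * (\<bar>B\<bar> + 1)))"
      using pos by (intro mult_left_mono) (auto simp: \<epsilon>_def)
    also have "\<dots> = e" using pos by (simp only: times_divide_eq_right nonzero_mult_div_cancel_left less_imp_neq[symmetric] not_False_eq_True) 
    finally show "64 * ?k\<^sup>2 * (B + 1) * \<epsilon> \<le> e" .
  qed
  \<comment> \<open>noise level of the true blocks: the tail exponent is then a multiple of \<open>n\<close>, and the error bound a
     multiple of \<open>n / p n\<close>; the factor \<open>\<gamma> / (8 * k)\<close> makes that multiple \<open>1 / 2\<close>, which is less than \<open>ln 2\<close>\<close>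
  define \<eta> where "\<eta> n = \<gamma> / (8 * ?k) / sqrt (p n * n)" for n
  \<comment> \<open>balanced classes, noise small uniformly in all labellings, and smaller noise in the true blocks\<close>
  define good where "good n zs A X \<longleftrightarrow>
      (\<forall>a. c / 4 * n < card {i \<in> {1..n}. zs i = a}) \<and>
      low_noise n (\<epsilon> * p n * n) zs (edge_noise (p n) Qs zs X A) \<and>
      (\<forall>a b r. \<bar>\<Sum>e\<in>upper_pairs n. block_ind zs a b e * edge_noise (p n) Qs zs X A r e\<bar> \<le> \<eta> n * p n * n\<^sup>2)"
    for n zs A X
  let ?D = "\<lambda>n. observed_sbm_pmf n \<alpha>s Qs (p n)"
  define bad where "bad n = ?k * exp (- (c * n / 4))
    + 4 * real CARD('k \<Rightarrow> 'k) * ?k\<^sup>2 * ((1 + ?k * exp (- (\<epsilon>\<^sup>2 * p n * n / 4))) ^ n - 1)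
    + 4 * ?k\<^sup>2 * exp (- ((\<gamma> / (8 * ?k))\<^sup>2 * n / 4))" for n :: nat
  note pn_top = dense_sampling_limits(1)[OF dense]
  note n_exp = dense_sampling_limits(2)[OF dense]
  have ev_pn: "\<forall>\<^sub>F n in sequentially. K \<le> p n * real n" for K
    using pn_top by (simp add: filterlim_at_top)
  have ev_n: "\<forall>\<^sub>F n in sequentially. K \<le> real n" for K
    using filterlim_real_sequentially by (simp add: filterlim_at_top)
  have tail_limit: "(\<lambda>n. (1 + K * exp (- (\<kappa> * (p n * n)))) ^ n - 1) \<longlonglongrightarrow> 0" if "0 < \<kappa>" "0 \<le> K" for \<kappa> K
  proof (rule power_perturbation_limit)
    have "(\<lambda>n. K * (real n * exp (- (\<kappa> * (p n * real n))))) \<longlonglongrightarrow> K * 0"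
      by (intro tendsto_intros n_exp that)
    then show "(\<lambda>n. real n * (K * exp (- (\<kappa> * (p n * real n))))) \<longlonglongrightarrow> 0" by (simp add: mult_ac)
  qed (use that in auto)
  have bad_limit: "bad \<longlonglongrightarrow> 0"
  proof -
    have exp_limit: "(\<lambda>n. exp (- (\<kappa> * real n))) \<longlonglongrightarrow> 0" if "0 < \<kappa>" for \<kappa>
    proof -
      have "(\<lambda>n. exp (- \<kappa>) ^ n) \<longlonglongrightarrow> 0" using that by (intro LIMSEQ_power_zero) simp
      then show ?thesis by (simp add: exp_of_nat_mult[symmetric] mult.commute)
    qed
    have "(\<lambda>n. (1 + ?k * exp (- (\<epsilon>\<^sup>2 / 4 * (p n * n)))) ^ n - 1) \<longlonglongrightarrow> 0"
      using \<epsilon> by (intro tail_limit) auto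
    then have 1: "(\<lambda>n. (1 + ?k * exp (- (\<epsilon>\<^sup>2 * p n * n / 4))) ^ n - 1) \<longlonglongrightarrow> 0" by (simp add: mult_ac)
    have 2: "(\<lambda>n. exp (- (c * real n / 4))) \<longlonglongrightarrow> 0" using exp_limit[of "c / 4"] c by (simp add: mult_ac)
    have 3: "(\<lambda>n. exp (- ((\<gamma> / (8 * ?k))\<^sup>2 * real n / 4))) \<longlonglongrightarrow> 0"
      using exp_limit[of "(\<gamma> / (8 * ?k))\<^sup>2 / 4"] \<gamma> by (simp add: mult_ac)
    have "bad \<longlonglongrightarrow> ?k * 0 + 4 * real CARD('k \<Rightarrow> 'k) * ?k\<^sup>2 * 0 + 4 * ?k\<^sup>2 * 0"
      unfolding bad_def by (intro tendsto_add tendsto_mult tendsto_const 1 2 3)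
    then show ?thesis by simp
  qed
  have good_prob: "\<forall>\<^sub>F n in sequentially. measure_pmf.prob (?D n) {((zs, A), X). \<not> good n zs A X} \<le> bad n"
    using ev_pn[of "1 + (\<gamma> / (8 * ?k))\<^sup>2"]
  proof eventually_elim
    case (elim n)
    let ?pr = "measure_pmf.prob (?D n)"
    have pn: "0 < p n * n" "0 \<le> p n" "p n \<in> {0..1}"
    proof -
      show "0 < p n * n" using elim zero_le_power2[of "\<gamma> / (8 * ?k)"] by linarith
    qed (use p01 in auto)
    have \<eta>01: "0 \<le> \<eta> n" "\<eta> n \<le> 1"
    proof -
      show "0 \<le> \<eta> n" using pn \<gamma> by (simp add: \<eta>_def)
      have "\<gamma> / (8 * ?k) \<le> sqrt (p n * n)" using elim by (intro real_le_rsqrt) auto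
      moreover have "0 < sqrt (p n * n)" using pn by simp
      ultimately show "\<eta> n \<le> 1" unfolding \<eta>_def by (simp only: divide_le_eq_1_pos)
    qed
    have \<eta>_sq: "(\<eta> n)\<^sup>2 * p n * n\<^sup>2 = (\<gamma> / (8 * ?k))\<^sup>2 * n"
    proof -
      have "(\<eta> n)\<^sup>2 = (\<gamma> / (8 * ?k))\<^sup>2 / (p n * n)" using pn(1) unfolding \<eta>_def power_divide by simp
      moreover have "(\<gamma> / (8 * ?k))\<^sup>2 / (p n * n) * p n * n\<^sup>2 = (\<gamma> / (8 * ?k))\<^sup>2 * n * (p n * n / (p n * n))"
        by (simp add: power2_eq_square)
      moreover have "p n * n / (p n * n) = 1" using pn(1) by (intro divide_self) linarith
      ultimately show ?thesis by (simp only: mult_1_right)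
    qed
    let ?U = "\<lambda>zs A X. \<exists>a. card {i \<in> {1..n}. zs i = a} \<le> c / 4 * n"
    let ?L = "\<lambda>zs A X. \<not> low_noise n (\<epsilon> * p n * n) zs (edge_noise (p n) Qs zs X A)"
    let ?S = "\<lambda>zs A X. \<exists>a b r. \<eta> n * p n * n\<^sup>2 < \<bar>\<Sum>e\<in>upper_pairs n. block_ind zs a b e * edge_noise (p n) Qs zs X A r e\<bar>"
    have U: "?pr {((zs, A), X). ?U zs A X} \<le> ?k * exp (- (c * n / 4))"
    proof -
      have "?pr {((zs, A), X). ?U zs A X} = measure_pmf.prob (labels_pmf n \<alpha>s) (\<Union>a. {zs. card {i \<in> {1..n}. zs i = a} \<le> c / 4 * n})"
        unfolding observed_prob_labels by (intro arg_cong[where f = "measure_pmf.prob _"]) auto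
      also have "\<dots> \<le> (\<Sum>a\<in>UNIV. measure_pmf.prob (labels_pmf n \<alpha>s) {zs. card {i \<in> {1..n}. zs i = a} \<le> c / 4 * n})"
        by (intro measure_pmf.finite_measure_subadditive_finite) auto
      also have "\<dots> \<le> (\<Sum>a\<in>(UNIV::'k set). exp (- (c * n / 4)))"
        using \<A> c by (intro sum_mono balanced_prob) auto
      finally show ?thesis by simp
    qed
    have L: "?pr {((zs, A), X). ?L zs A X} \<le> 4 * real CARD('k \<Rightarrow> 'k) * ?k\<^sup>2 * ((1 + ?k * exp (- (\<epsilon>\<^sup>2 * p n * n / 4))) ^ n - 1)"
      using \<epsilon> by (intro observed_prob_le low_noise_prob Qs01 pn) (auto intro!: mult_nonneg_nonneg one_le_power)
    have S: "?pr {((zs, A), X). ?S zs A X} \<le> 4 * ?k\<^sup>2 * exp (- ((\<gamma> / (8 * ?k))\<^sup>2 * n / 4))"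
      unfolding \<eta>_sq[symmetric] by (intro observed_prob_le block_noise_prob Qs01 pn \<eta>01) auto
    have "{((zs, A), X). \<not> good n zs A X} \<subseteq> {((zs, A), X). ?U zs A X} \<union> {((zs, A), X). ?L zs A X} \<union> {((zs, A), X). ?S zs A X}"
      by (auto simp: good_def not_le not_less)
    then have "?pr {((zs, A), X). \<not> good n zs A X} \<le> ?pr ({((zs, A), X). ?U zs A X} \<union> {((zs, A), X). ?L zs A X} \<union> {((zs, A), X). ?S zs A X})"
      by (intro measure_pmf.finite_measure_mono) auto
    also have "\<dots> \<le> ?pr {((zs, A), X). ?U zs A X} + ?pr {((zs, A), X). ?L zs A X} + ?pr {((zs, A), X). ?S zs A X}"
      by (intro order_trans[OF measure_Un_le] add_mono measure_Un_le) auto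
    also have "\<dots> \<le> bad n" unfolding bad_def by (intro add_mono U L S)
    finally show ?case .
  qed
  have success: "\<forall>\<^sub>F n in sequentially. \<forall>zs A X. ((zs, A), X) \<in> set_pmf (?D n) \<longrightarrow> good n zs A X \<longrightarrow>
      label_equiv n (zvar n X A) (zhat n X A) \<and>
      (frob_norm n (\<lambda>i j. theta Qs zs i j - theta_var n X A (zvar n X A) i j))\<^sup>2
        \<le> 1 * (?k ^ 2 + real n * ln ?k) / p n"
  proof -
    define \<kappa> where "\<kappa> = \<Delta>\<^sup>2 * \<gamma> / 64"
    have \<kappa>: "0 < \<kappa>" using \<Delta> \<gamma> by (simp add: \<kappa>_def)
    have "\<forall>\<^sub>F n in sequentially. (1 + 1 / c * exp (- (\<kappa> * (p n * n)))) ^ n - 1 < 1 / 2"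
      using c by (intro order_tendstoD[OF tail_limit] \<kappa>) auto
    then show ?thesis
      using ev_pn[of 1] ev_pn[of "1 / \<kappa>"] ev_pn[of "- 16 * ln c / e"] ev_pn[of "(2 / (?k * \<gamma>))\<^sup>2"] ev_n[of "4 / e"] ev_n[of "2 / \<gamma>"]
    proof eventually_elim
      case (elim n)
      note tail = elim(1) and pn1 = elim(2) and pn\<kappa> = elim(3) and pnc = elim(4) and pn\<eta> = elim(5) and ne = elim(6) and n\<gamma> = elim(7)
      have p_pos: "0 < p n"
        using pn1 p01 by (metis less_eq_real_def mult_zero_left not_one_le_zero)
      show ?case
      proof (intro allI impI)
        fix zs A X
        assume supp: "((zs, A), X) \<in> set_pmf (?D n)" and g: "good n zs A X"
        have balanced: "\<gamma> * n \<le> card {i \<in> {1..n}. zs i = a}" for a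
          using g by (auto simp: good_def \<gamma>_def less_imp_le)
        interpret S: sbm_sample n "p n" l u \<gamma> \<Delta> "\<epsilon> * p n * n" zs Qs X A
          by standard (use observed_support(1)[OF supp] sym[OF \<Q>(2)] lu(2) \<Q>(2) lu' p_pos \<gamma> \<Delta> \<epsilon> k2 balanced g in \<open>auto simp: good_def\<close>)
        have cand: "S.candidate Q" if "Q \<in> \<Q>" for Q
          unfolding S.candidate_def using sym[OF that] lu(2)[rule_format, OF that] by blast
        have M_small: "64 * ?k^2 * (S.log_bound + 1) * (\<epsilon> * p n * n) \<le> e * p n * n"
          using mult_right_mono[OF \<epsilon>(3), of "p n * n"] p_pos by (simp add: B_def mult_ac)
        have ests: "is_mle \<Q> n X A (Qhat n X A) (zhat n X A)"
          "is_variational_est \<A> \<Q> n X A (\<alpha>var n X A) (Qvar n X A) (\<tau>var n X A)"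
          "is_var_labels n (\<tau>var n X A) (zvar n X A)"
          using est[rule_format, OF supp] by auto
        obtain \<sigma> where \<sigma>: "bij \<sigma>" "\<And>i. i \<in> {1..n} \<Longrightarrow> zhat n X A i = \<sigma> (zs i)"
          using S.mle_exact_recovery[OF ests(1) cand \<Q>(2) \<gamma>(2) \<Delta>(2), folded e_def, OF _ M_small ne e] by blast
        have prior_small: "- 16 * ln c \<le> e * p n * n" using pnc e by (simp add: field_simps)
        have tail': "(1 + exp (- (p n * n * \<kappa>)) / c) ^ n - 1 < p n * n * \<kappa> / 2"
        proof -
          have "1 \<le> p n * n * \<kappa>" using pn\<kappa> \<kappa> by (simp add: field_simps)
          then show ?thesis using tail by (simp add: mult_ac)
        qed
        obtain \<sigma>' where \<sigma>': "bij \<sigma>'" "\<And>i. i \<in> {1..n} \<Longrightarrow> zvar n X A i = \<sigma>' (zs i)"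
          using S.variational_exact_recovery[OF ests(2,3) cand \<Q>(2) \<A> _ c(1) \<gamma>(2) \<Delta>(2), folded e_def \<kappa>_def, OF _ _ M_small ne prior_small tail'] c(2)
          by (metis atLeastAtMost_iff)
        have \<eta>0: "0 \<le> \<eta> n" using p_pos \<gamma> by (simp add: \<eta>_def)
        have \<eta>_small: "16 * \<eta> n \<le> \<gamma>\<^sup>2"
        proof -
          have "2 / (?k * \<gamma>) \<le> sqrt (p n * n)" using pn\<eta> by (intro real_le_rsqrt)
          then show ?thesis using \<gamma> pn1 by (simp add: \<eta>_def field_simps power2_eq_square)
        qed
        have "(frob_norm n (\<lambda>i j. theta Qs zs i j - theta_var n X A (zvar n X A) i j))\<^sup>2 \<le> 32 * ?k^2 * (\<eta> n)\<^sup>2 * n\<^sup>2 / \<gamma>\<^sup>2"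
          using g n\<gamma> \<gamma> \<eta>0 \<eta>_small
          by (intro frob_error_bound[OF Qs01 sym[OF \<Q>(2)] observed_support(2,3)[OF supp] p_pos \<sigma>' balanced \<gamma>(1)])
            (auto simp: good_def field_simps)
        also have "\<dots> = n * (1 / 2) / p n"
          using p_pos pn1 \<gamma> by (simp add: \<eta>_def power_divide power_mult_distrib field_simps power2_eq_square)
        also have "\<dots> \<le> n * ln ?k / p n"
        proof -
          have "1 / 2 \<le> ln (2::real)" using ln2_ge_two_thirds by simp
          also have "ln 2 \<le> ln ?k" using k2 by simp
          finally show ?thesis using p_pos by (intro divide_right_mono mult_left_mono) auto
        qed
        also have "\<dots> \<le> 1 * (?k ^ 2 + real n * ln ?k) / p n"
          using p_pos by (intro divide_right_mono) auto
        finally show "label_equiv n (zvar n X A) (zhat n X A) \<and>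
          (frob_norm n (\<lambda>i j. theta Qs zs i j - theta_var n X A (zvar n X A) i j))\<^sup>2 \<le> 1 * (?k ^ 2 + real n * ln ?k) / p n"
          using relabel_permutation[OF \<sigma>'(1) \<sigma>(1) \<sigma>'(2) \<sigma>(2)] by simp
      qed
    qed
  qed
  have prob_1: "(\<lambda>n. measure_pmf.prob (?D n) {((zs, A), X). P n zs A X}) \<longlonglongrightarrow> 1"
    if "\<forall>\<^sub>F n in sequentially. \<forall>zs A X. ((zs, A), X) \<in> set_pmf (?D n) \<longrightarrow> good n zs A X \<longrightarrow> P n zs A X" for P
  proof (rule prob_tendsto_1[OF _ bad_limit])
    show "\<forall>\<^sub>F n in sequentially. measure_pmf.prob (?D n) (- {((zs, A), X). P n zs A X}) \<le> bad n"
      using that good_prob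
    proof eventually_elim
      case (elim n)
      have "measure_pmf.prob (?D n) (- {((zs, A), X). P n zs A X}) = measure_pmf.prob (?D n) (- {((zs, A), X). P n zs A X} \<inter> set_pmf (?D n))"
        by (rule measure_Int_set_pmf[symmetric])
      also have "\<dots> \<le> measure_pmf.prob (?D n) {((zs, A), X). \<not> good n zs A X}"
        using elim(1) by (intro measure_pmf.finite_measure_mono) auto
      finally show ?case using elim(2) by linarith
    qed
  qed
  show "(\<lambda>n. measure_pmf.prob (?D n) {((zs, A), X). label_equiv n (zvar n X A) (zhat n X A)}) \<longlonglongrightarrow> 1 \<and>
    (\<lambda>n. measure_pmf.prob (?D n) {((zs, A), X).
      (frob_norm n (\<lambda>i j. theta Qs zs i j - theta_var n X A (zvar n X A) i j))\<^sup>2 \<le> 1 * (?k ^ 2 + real n * ln ?k) / p n}) \<longlonglongrightarrow> 1"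
    by (intro conjI prob_1; rule eventually_mono[OF success]; blast)
qed

end
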